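(* Let $\kappa>0$, $d\ge 1$, and consider the parabolic sine-Gordon equation $$\partial_t u=\kappa^2\Delta u+\sin u,\quad (t,x)\in(0,\infty)\times\mathbb T^d,\qquad u|_{t=0}=u_0,$$ on the periodic torus $\mathbb T^d=[-\pi,\pi]^d$. Suppose $u_0:\mathbb T^d\to\mathbb R$ satisfies $\|u_0\|_{\infty}\le\pi$. Then there exists a unique global solution $u$ which is smooth for all $t>0$. Furthermore, $$\sup_{0\le t<\infty}\|u(t,\cdot)\|_{\infty}\le\pi.$$
   Context: $\mathbb T^d=[-\pi,\pi]^d$ denotes the $d$-dimensional torus, i.e. functions are $2\pi$-periodic in each variable. $u_0$ is a real-valued function in $L^\infty(\mathbb T^d)$ and $\|\cdot\|_\infty$ is the $L^\infty(\mathbb T^d)$ norm. A solution $u$ is real-valued and is understood in the mild (Duhamel) sense: $u\in L^\infty((0,T)\times\mathbb T^d)$ for every $T>0$ and $$u(t)=e^{\kappa^2 t\Delta}u_0+\int_0^t e^{\kappa^2(t-s)\Delta}\sin u(s)\,ds,\qquad t\ge 0,$$ where $e^{\kappa^2 t\Delta}$ is the periodic heat semigroup; uniqueness is within this class. *)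

theory Defs
  imports "HOL-Probability.Essential_Supremum"
begin

text \<open>Functions on the torus are functions on \<open>real ^ 'n\<close> that are \<open>2 \<pi>\<close>-periodic in each
  coordinate; integrals and norms are taken over the cell \<open>[-\<pi>, \<pi>]\<^sup>d\<close>, where \<open>d = CARD('n) \<ge> 1\<close>.\<close>

definition torus_cell :: "(real ^ 'n) set" where
  "torus_cell = cbox (\<chi> i. - pi) (\<chi> i. pi)"

definition torus_periodic :: "(real ^ 'n \<Rightarrow> 'b) \<Rightarrow> bool" where
  "torus_periodic f \<longleftrightarrow> (\<forall>x i. f (x + (2 * pi) *\<^sub>R axis i 1) = f x)"

text \<open>The library's \<open>esssup\<close> is \<open>\<infinity>\<close> on functions that are not measurable.\<close>

definition Linf_norm :: "'a::euclidean_space set \<Rightarrow> ('a \<Rightarrow> real) \<Rightarrow> ereal" where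
  "Linf_norm S f = esssup (lebesgue_on S) (\<lambda>x. ereal \<bar>f x\<bar>)"

definition Linf_on :: "'a::euclidean_space set \<Rightarrow> ('a \<Rightarrow> real) \<Rightarrow> bool" where
  "Linf_on S f \<longleftrightarrow> f \<in> borel_measurable (lebesgue_on S) \<and> Linf_norm S f < \<infinity>"

definition gauss_kernel :: "real \<Rightarrow> real ^ 'n \<Rightarrow> real" where
  "gauss_kernel t z = (4 * pi * t) powr (- (real CARD('n) / 2)) * exp (- (norm z)\<^sup>2 / (4 * t))"

text \<open>The heat kernel of the torus is the periodization of the Gaussian over the lattice
  \<open>(2 \<pi> \<int>)\<^sup>d\<close>.\<close>

definition torus_heat_kernel :: "real \<Rightarrow> real ^ 'n \<Rightarrow> real" where
  "torus_heat_kernel t z =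
     (\<Sum>\<^sub>\<infinity>k::int ^ 'n. gauss_kernel t (z + (\<chi> i. 2 * pi * real_of_int (k $ i))))"

text \<open>\<open>heat_semigroup t\<close> is \<open>exp (t \<Delta>)\<close>, meaningful for \<open>t \<ge> 0\<close>.\<close>

definition heat_semigroup :: "real \<Rightarrow> (real ^ 'n \<Rightarrow> real) \<Rightarrow> real ^ 'n \<Rightarrow> real" where
  "heat_semigroup t f x =
     (if t = 0 then f x
      else (LINT y:torus_cell|lebesgue. torus_heat_kernel t (x - y) * f y))"

text \<open>Only the values \<open>u t\<close> with \<open>t \<ge> 0\<close> matter. As an identity in \<open>L\<^sup>\<infinity>\<close> of the torus, the Duhamel
  formula is required at every time \<open>t \<ge> 0\<close>, for almost every \<open>x\<close>. The integrals are over
  \<open>lebesgue\<close> rather than \<open>lborel\<close> because the integrand in \<open>s\<close> need not be Borel measurable.\<close>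

definition mild_solution ::
    "real \<Rightarrow> (real ^ 'n \<Rightarrow> real) \<Rightarrow> (real \<Rightarrow> real ^ 'n \<Rightarrow> real) \<Rightarrow> bool" where
  "mild_solution \<kappa> u0 u \<longleftrightarrow>
     (\<forall>t\<ge>0. torus_periodic (u t)) \<and>
     (\<forall>T>0. Linf_on ({0<..<T} \<times> torus_cell) (\<lambda>(t, x). u t x)) \<and>
     (\<forall>t\<ge>0. AE x in lebesgue_on torus_cell.
        u t x = heat_semigroup (\<kappa>\<^sup>2 * t) u0 x
          + (LINT s:{0..t}|lebesgue. heat_semigroup (\<kappa>\<^sup>2 * (t - s)) (\<lambda>y. sin (u s y)) x))"

text \<open>\<open>Ck_on k S f\<close> says, for open \<open>S\<close>, that \<open>f\<close> is \<open>k\<close> times continuously differentiable on \<open>S\<close>: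
  all iterated directional derivatives of order at most \<open>k\<close> exist and are continuous.\<close>

primrec Ck_on :: "nat \<Rightarrow> 'a::real_normed_vector set \<Rightarrow> ('a \<Rightarrow> 'b::real_normed_vector) \<Rightarrow> bool" where
  "Ck_on 0 S f \<longleftrightarrow> continuous_on S f"
| "Ck_on (Suc k) S f \<longleftrightarrow>
     (\<forall>x\<in>S. f differentiable (at x)) \<and>
     (\<forall>v. Ck_on k S (\<lambda>x. frechet_derivative f (at x) v))"

definition smooth_on :: "'a::real_normed_vector set \<Rightarrow> ('a \<Rightarrow> 'b::real_normed_vector) \<Rightarrow> bool" where
  "smooth_on S f \<longleftrightarrow> (\<forall>k. Ck_on k S f)"

end

theory Submission
  imports Defs "HOL-Complex_Analysis.Complex_Analysis" "HOL-Probability.Distributions"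
begin

text \<open>Since \<open>v \<mapsto> v + sin v\<close> maps \<open>[-\<pi>, \<pi>]\<close> into itself, Picard iteration for the damped equation
  \<open>\<partial>\<^sub>t u + u = \<kappa>\<^sup>2 \<Delta> u + (u + sin u)\<close> converges to a solution with values in \<open>[-\<pi>, \<pi>]\<close>; Fubini and the
  semigroup law turn the damped Duhamel formula into the required one. Uniqueness is the usual iterated
  Gronwall estimate.

  Smoothness uses Angenent's parameter trick. For \<open>p = (\<lambda>, a)\<close> the function
  \<open>v t x = u (\<lambda> t) (x + t a)\<close> solves a Duhamel equation whose kernel, in suitable variables, is holomorphic
  in \<open>p\<close> near \<open>(1, 0)\<close> with a Gaussian bound that is uniform in time. On a short time interval the Picard
  iterates are bounded holomorphic functions of \<open>p\<close> that converge uniformly, so \<open>v t x\<close> is holomorphic in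
  \<open>p\<close>; varying \<open>p\<close> at a fixed \<open>(t, x)\<close> moves through a neighbourhood of \<open>(t, x)\<close> in space-time. The
  length of the time interval depends only on the bound \<open>\<pi>\<close>, so restarting reaches every positive time.\<close>

section \<open>Functions holomorphic on complex lines\<close>

text \<open>The damping makes the bound \<pi> survive each iteration step without a maximum
  principle: data and forcing enter with weights \<open>exp (- t)\<close> and
  \<open>1 - exp (- t)\<close>, a convex combination of functions bounded by \<pi>. The real
  iteration converges on every time interval. The complex one cannot be run that long, because the
  complex sine grows exponentially; hence a second iteration, confined to a ball and to a short
  time. Differentiating the Duhamel formula twice in space would meet a non-integrable singularity
  of the heat kernel at the final time. Parameters avoid it: once the space variable is scaled by
  the square root of the elapsed time, the kernel is regular down to time 0 and no derivative ever
  falls on the rough data. Holomorphy is asked only along complex lines; with local boundedness this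
  already gives Frechet derivatives of all orders. Mild identities hold almost everywhere, while
  these arguments are pointwise. The data and any competing solution are therefore replaced by
  periodic Borel representatives, and the torus semigroup by Gaussian convolution on the whole
  space.\<close>

lemma Ck_on_local:
  assumes "\<And>x. x \<in> S \<Longrightarrow> \<exists>U g. open U \<and> x \<in> U \<and> (\<forall>y\<in>U. f y = g y) \<and> Ck_on k U g"
  shows "Ck_on k S f"
  using assms
proof (induction k arbitrary: f)
  case 0
  have "continuous (at x within S) f" if "x \<in> S" for x
  proof -
    obtain U g where U: "open U" "x \<in> U" "\<forall>y\<in>U. f y = g y" "continuous_on U g"
      using 0[OF \<open>x \<in> S\<close>] by auto
    then have "continuous_on U f" by (simp cong: continuous_on_cong)
    then show ?thesis
      using U(1,2) continuous_on_eq_continuous_at continuous_at_imp_continuous_at_within by blast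
  qed
  then show ?case by (simp add: continuous_on_eq_continuous_within)
next
  case (Suc k)
  \<comment> \<open>Agreement on an open set carries over to derivatives, so the derivative of
    \<open>f\<close> in a fixed direction is again locally a \<open>Ck_on k\<close> function and the
    induction hypothesis applies to it.\<close>
  have *: "f differentiable (at y) \<and> frechet_derivative f (at y) = frechet_derivative g (at y)"
    if "open U" "\<forall>y\<in>U. f y = g y" "Ck_on (Suc k) U g" "y \<in> U" for U g y
  proof -
    have g: "(g has_derivative frechet_derivative g (at y)) (at y)"
      using that frechet_derivative_works by auto
    have "(f has_derivative frechet_derivative g (at y)) (at y)"
      by (rule has_derivative_transform_within_open[OF g]) (use that in auto)
    then show ?thesis using frechet_derivative_at differentiable_def by metis
  qed
  have "Ck_on k S (\<lambda>x. frechet_derivative f (at x) v)" for v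
  proof (rule Suc.IH)
    fix x assume "x \<in> S"
    then obtain U g where U: "open U" "x \<in> U" "\<forall>y\<in>U. f y = g y" "Ck_on (Suc k) U g"
      using Suc.prems by metis
    show "\<exists>U g. open U \<and> x \<in> U \<and> (\<forall>y\<in>U. frechet_derivative f (at y) v = g y) \<and> Ck_on k U g"
      using U *[OF U(1,3,4)]
      by (intro exI[of _ U] exI[of _ "\<lambda>x. frechet_derivative g (at x) v"]) auto
  qed
  moreover have "f differentiable (at x)" if "x \<in> S" for x
    using Suc.prems[OF that] * by metis
  ultimately show ?case by simp
qed

text \<open>Cauchy estimates: radius \<open>r/2\<close> about 0 for the first derivative, radius
  \<open>r/4\<close> about each point of \<open>cball 0 (r/4)\<close> for the second. The constants
  depend only on \<open>M\<close> and \<open>r\<close>; this uniformity is what later allows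
  integrating the remainder and moving the base point.\<close>

lemma bounded_holomorphic_taylor1:
  fixes \<phi> :: "complex \<Rightarrow> complex"
  assumes hol: "\<phi> holomorphic_on ball 0 r" and r: "r > 0"
    and bd: "\<And>z. z \<in> ball 0 r \<Longrightarrow> norm (\<phi> z) \<le> M"
  shows "norm (deriv \<phi> 0) \<le> 2 * M / r"
    and "norm z \<le> r / 4 \<Longrightarrow> norm (\<phi> z - \<phi> 0 - deriv \<phi> 0 * z) \<le> 32 * M / r\<^sup>2 * (norm z)\<^sup>2"
proof -
  have cauchy: "norm ((deriv ^^ n) \<phi> w) \<le> fact n * M / s ^ n"
    if "s > 0" "cball w s \<subseteq> ball 0 r" for n w s
  proof (rule Cauchy_inequality)
    show "\<phi> holomorphic_on ball w s"
      using that ball_subset_cball by (intro holomorphic_on_subset[OF hol]) blast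
    show "continuous_on (cball w s) \<phi>"
      by (rule holomorphic_on_imp_continuous_on, rule holomorphic_on_subset[OF hol]) (use that in auto)
    show "norm (\<phi> x) \<le> M" if "norm (w - x) = s" for x
    proof -
      have "x \<in> cball w s" using that by (simp add: dist_norm)
      then show ?thesis using \<open>cball w s \<subseteq> _\<close> bd by blast
    qed
  qed (use that in auto)
  have sub: "cball w (r/4) \<subseteq> ball 0 r" if "w \<in> cball 0 (r/4)" for w
  proof
    fix x assume "x \<in> cball w (r/4)"
    then have "dist w x \<le> r/4" "dist 0 w \<le> r/4" using that by auto
    then have "dist 0 x \<le> r/2" using dist_triangle[of 0 x w] by linarith
    then show "x \<in> ball 0 r" using r by (simp only: mem_ball)
  qed
  have "norm ((deriv ^^ 1) \<phi> 0) \<le> fact 1 * M / (r/2) ^ 1"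
    by (rule cauchy) (use r in auto)
  then show "norm (deriv \<phi> 0) \<le> 2 * M / r" by (simp add: mult.commute)
  assume z: "norm z \<le> r / 4"
  have der: "((deriv ^^ i) \<phi> has_field_derivative (deriv ^^ (Suc i)) \<phi> x) (at x within cball 0 (r/4))"
    if "x \<in> cball 0 (r/4)" for x i
  proof -
    have "(deriv ^^ i) \<phi> holomorphic_on ball 0 r"
      using hol by (rule holomorphic_higher_deriv) auto
    moreover have "x \<in> ball 0 r" using that r by auto
    ultimately show ?thesis using holomorphic_derivI[OF _ open_ball] by (auto intro: DERIV_subset)
  qed
  have "norm ((deriv ^^ 0) \<phi> z - (\<Sum>i\<le>1. (deriv ^^ i) \<phi> 0 * (z - 0) ^ i / fact i))
      \<le> (fact 2 * M / (r/4)^2) * norm (z - 0) ^ (Suc 1) / fact 1"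
  proof (rule complex_Taylor[where S = "cball 0 (r/4)"])
    show "norm ((deriv ^^ Suc 1) \<phi> x) \<le> fact 2 * M / (r/4)^2" if "x \<in> cball 0 (r/4)" for x
      using cauchy[of "r/4" x 2] r sub[OF that] by (simp add: numeral_2_eq_2)
  qed (use der z r in auto)
  also have "(fact 2 * M / (r/4)^2) * norm (z - 0) ^ (Suc 1) / fact 1 = 32 * M / r\<^sup>2 * (norm z)\<^sup>2"
    by (simp add: power2_eq_square)
  finally show "norm (\<phi> z - \<phi> 0 - deriv \<phi> 0 * z) \<le> 32 * M / r\<^sup>2 * (norm z)\<^sup>2"
    by (simp add: algebra_simps)
qed

lemma small_multiple_norm_le:
  assumes "r > 0"
  obtains s :: real where "s > 0" "s * norm h \<le> r / 2"
proof
  have "norm h + 1 > 0" by (simp add: add_nonneg_pos)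
  then show "r / (2 * (norm h + 1)) > 0" "r / (2 * (norm h + 1)) * norm h \<le> r / 2"
    using assms by (auto simp: field_simps)
qed

lemma norm_vector_smult: "norm (c *s (v :: complex^'m)) = norm c * norm v"
  by (simp add: norm_vec_def norm_mult L2_set_right_distrib)

text \<open>Gateaux holomorphy together with local boundedness. It can be checked with one complex
  variable at a time, passes to uniform limits through the one-variable theorem, and still implies
  Frechet differentiability (\<open>line_holomorphic_has_derivative\<close>).\<close>

definition line_holomorphic_on :: "(complex^'m) set \<Rightarrow> (complex^'m \<Rightarrow> complex) \<Rightarrow> bool" where
  "line_holomorphic_on \<Omega> F \<longleftrightarrow>
     (\<forall>p h. (\<lambda>\<zeta>. F (p + \<zeta> *s h)) holomorphic_on {\<zeta>. p + \<zeta> *s h \<in> \<Omega>}) \<and>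
     (\<forall>p\<in>\<Omega>. \<exists>r>0. \<exists>M. ball p r \<subseteq> \<Omega> \<and> (\<forall>q\<in>ball p r. norm (F q) \<le> M))"

definition line_deriv :: "(complex^'m \<Rightarrow> complex) \<Rightarrow> complex^'m \<Rightarrow> complex^'m \<Rightarrow> complex" where
  "line_deriv F h p = deriv (\<lambda>\<zeta>. F (p + \<zeta> *s h)) 0"

context
  fixes \<Omega> :: "(complex^'m) set" and F :: "complex^'m \<Rightarrow> complex"
  assumes F: "line_holomorphic_on \<Omega> F"
begin

lemma line_holomorphic_locally_boundedE:
  assumes "p \<in> \<Omega>"
  obtains r M where "r > 0" "M \<ge> 0" "ball p r \<subseteq> \<Omega>" "\<And>q. q \<in> ball p r \<Longrightarrow> norm (F q) \<le> M"
proof -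
  obtain r M where r: "r > 0" "ball p r \<subseteq> \<Omega>" "\<forall>q\<in>ball p r. norm (F q) \<le> M"
    using F assms unfolding line_holomorphic_on_def by metis
  have "0 \<le> norm (F p)" by simp
  also have "norm (F p) \<le> M" using r by auto
  finally show ?thesis using that r by auto
qed

text \<open>The condition \<open>s * norm h \<le> r\<close> keeps the disc of radius
  \<open>s\<close> on the line through \<open>p\<close> in direction \<open>h\<close> inside
  \<open>ball p r\<close>, so the one-variable estimates hold with constants that do not depend on
  \<open>p\<close>.\<close>

lemma line_deriv_bounds:
  assumes "r > 0" "ball p r \<subseteq> \<Omega>" "\<And>q. q \<in> ball p r \<Longrightarrow> norm (F q) \<le> M" "s > 0" "s * norm h \<le> r"
  shows "norm (line_deriv F h p) \<le> 2 * M / s"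
    and "norm \<zeta> \<le> s / 4 \<Longrightarrow>
      norm (F (p + \<zeta> *s h) - F p - line_deriv F h p * \<zeta>) \<le> 32 * M / s\<^sup>2 * (norm \<zeta>)\<^sup>2"
proof -
  have in_ball: "p + \<zeta> *s h \<in> ball p r" if "\<zeta> \<in> ball 0 s" for \<zeta>
  proof -
    have "norm \<zeta> < s" using that by simp
    then have "norm (\<zeta> *s h) < r"
    proof (cases "h = 0")
      case False
      then have "norm \<zeta> * norm h < s * norm h"
        using \<open>norm \<zeta> < s\<close> by (intro mult_strict_right_mono) auto
      then show ?thesis using assms(5) by (simp add: norm_vector_smult)
    qed (use assms(1) in simp)
    then show ?thesis by (simp add: dist_norm)
  qed
  have "(\<lambda>\<zeta>. F (p + \<zeta> *s h)) holomorphic_on ball 0 s"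
  proof (rule holomorphic_on_subset)
    show "(\<lambda>\<zeta>. F (p + \<zeta> *s h)) holomorphic_on {\<zeta>. p + \<zeta> *s h \<in> \<Omega>}"
      using F unfolding line_holomorphic_on_def by blast
  qed (use in_ball assms(2) in blast)
  note * = bounded_holomorphic_taylor1[OF this \<open>s > 0\<close>, of M]
  show "norm (line_deriv F h p) \<le> 2 * M / s"
    unfolding line_deriv_def by (rule *(1)) (use in_ball assms(3) in blast)
  show "norm (F (p + \<zeta> *s h) - F p - line_deriv F h p * \<zeta>) \<le> 32 * M / s\<^sup>2 * (norm \<zeta>)\<^sup>2"
    if "norm \<zeta> \<le> s / 4"
    using *(2)[OF _ that] in_ball assms(3) unfolding line_deriv_def by auto
qed

text \<open>Along any second direction \<open>k\<close>, the derivative in direction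
  \<open>h\<close> is a limit of difference quotients that are holomorphic on that line. The Taylor
  remainder makes the limit uniform, so holomorphy survives; local boundedness is the Cauchy
  estimate. This closure is what drives the induction on the order of differentiability.\<close>

lemma line_holomorphic_line_deriv:
  assumes op: "open \<Omega>"
  shows "line_holomorphic_on \<Omega> (line_deriv F h)"
  unfolding line_holomorphic_on_def
proof (intro conjI allI ballI)
  fix p k
  define A where "A = {\<zeta>. p + \<zeta> *s k \<in> \<Omega>}"
  have cont: "continuous_on UNIV (\<lambda>\<zeta>. p + \<zeta> *s k)"
    unfolding vector_scalar_mult_def by (intro continuous_intros)
  have "open ((\<lambda>\<zeta>. p + \<zeta> *s k) -` \<Omega>)"
    using cont op by (simp add: open_vimage)
  then have "open A" unfolding A_def vimage_def .
  show "(\<lambda>\<zeta>. line_deriv F h (p + \<zeta> *s k)) holomorphic_on {\<zeta>. p + \<zeta> *s k \<in> \<Omega>}"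
    unfolding A_def[symmetric] holomorphic_on_open[OF \<open>open A\<close>]
  proof
    fix \<zeta>0 assume "\<zeta>0 \<in> A"
    define q where "q = p + \<zeta>0 *s k"
    have "q \<in> \<Omega>" using \<open>\<zeta>0 \<in> A\<close> by (auto simp: A_def q_def)
    then obtain r M where rM: "r > 0" "M \<ge> 0" "ball q r \<subseteq> \<Omega>" "\<And>q'. q' \<in> ball q r \<Longrightarrow> norm (F q') \<le> M"
      using line_holomorphic_locally_boundedE by metis
    obtain \<rho> where "\<rho> > 0" and \<rho>k: "\<rho> * norm k \<le> r / 2" using small_multiple_norm_le[OF rM(1), of k] .
    obtain s where "s > 0" and sh: "s * norm h \<le> r / 2" using small_multiple_norm_le[OF rM(1), of h] .
    have sub: "ball (p + \<zeta> *s k) (r/2) \<subseteq> ball q r" if "\<zeta> \<in> ball \<zeta>0 \<rho>" for \<zeta>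
    proof
      fix x assume x: "x \<in> ball (p + \<zeta> *s k) (r/2)"
      have "dist q (p + \<zeta> *s k) = norm (\<zeta>0 - \<zeta>) * norm k"
        by (simp add: q_def dist_norm flip: norm_vector_smult vector_sub_rdistrib)
      also have "\<dots> \<le> \<rho> * norm k"
        using that by (intro mult_right_mono) (auto simp: dist_norm)
      finally have "dist q (p + \<zeta> *s k) \<le> r / 2" using \<rho>k by simp
      then show "x \<in> ball q r"
        using x dist_triangle[of q x "p + \<zeta> *s k"] by simp
    qed
    \<comment> \<open>Steps of size at most \<open>s / 8\<close> lie within the range
      \<open>s / 4\<close> of the Taylor estimate and move a point by less than
      \<open>r / 2\<close>, so the shifted points stay in \<open>ball q r\<close>.\<close>
    define \<epsilon> where "\<epsilon> n = s / 8 / (real n + 1)" for n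
    have \<epsilon>: "0 < \<epsilon> n" "\<epsilon> n \<le> s / 8" for n
      using \<open>s > 0\<close> by (auto simp: \<epsilon>_def field_simps)
    define D where "D n \<zeta> = (F ((p + of_real (\<epsilon> n) *s h) + \<zeta> *s k) - F (p + \<zeta> *s k)) / of_real (\<epsilon> n)" for n \<zeta>
    have eq: "(p + of_real (\<epsilon> n) *s h) + \<zeta> *s k = (p + \<zeta> *s k) + of_real (\<epsilon> n) *s h" for n \<zeta>
      by (simp add: ac_simps)
    have "(\<lambda>\<zeta>. line_deriv F h (p + \<zeta> *s k)) holomorphic_on ball \<zeta>0 \<rho>"
    proof (rule holomorphic_uniform_sequence[where f = D])
      show "D n holomorphic_on ball \<zeta>0 \<rho>" for n
      proof -
        have "(\<lambda>\<zeta>. F ((p + of_real (\<epsilon> n) *s h) + \<zeta> *s k)) holomorphic_on ball \<zeta>0 \<rho>"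
        proof (rule holomorphic_on_subset)
          show "ball \<zeta>0 \<rho> \<subseteq> {\<zeta>. (p + of_real (\<epsilon> n) *s h) + \<zeta> *s k \<in> \<Omega>}"
          proof
            fix \<zeta> assume z: "\<zeta> \<in> ball \<zeta>0 \<rho>"
            have "norm (complex_of_real (\<epsilon> n) *s h) \<le> s / 8 * norm h"
              using \<epsilon>[of n] mult_right_mono[of "\<epsilon> n" "s / 8" "norm h"] by (simp add: norm_vector_smult)
            also have "\<dots> < r / 2" using sh rM(1) by simp
            finally have "(p + \<zeta> *s k) + of_real (\<epsilon> n) *s h \<in> ball (p + \<zeta> *s k) (r/2)"
              by (simp add: dist_norm)
            then show "\<zeta> \<in> {\<zeta>. (p + of_real (\<epsilon> n) *s h) + \<zeta> *s k \<in> \<Omega>}"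
              using sub[OF z] rM(3) by (auto simp: eq)
          qed
        qed (use F in \<open>auto simp: line_holomorphic_on_def\<close>)
        moreover have "(\<lambda>\<zeta>. F (p + \<zeta> *s k)) holomorphic_on ball \<zeta>0 \<rho>"
        proof (rule holomorphic_on_subset)
          show "ball \<zeta>0 \<rho> \<subseteq> {\<zeta>. p + \<zeta> *s k \<in> \<Omega>}"
          proof
            fix \<zeta> assume z: "\<zeta> \<in> ball \<zeta>0 \<rho>"
            have "p + \<zeta> *s k \<in> ball (p + \<zeta> *s k) (r/2)" using rM(1) by simp
            then show "\<zeta> \<in> {\<zeta>. p + \<zeta> *s k \<in> \<Omega>}" using sub[OF z] rM(3) by blast
          qed
        qed (use F in \<open>auto simp: line_holomorphic_on_def\<close>)
        ultimately show ?thesis unfolding D_def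
          using \<epsilon>[of n] by (intro holomorphic_intros) auto
      qed
      have bnd: "dist (D n \<zeta>) (line_deriv F h (p + \<zeta> *s k)) \<le> 32 * M / s\<^sup>2 * \<epsilon> n"
        if z: "\<zeta> \<in> ball \<zeta>0 \<rho>" for n \<zeta>
      proof -
        have "norm (F ((p + \<zeta> *s k) + of_real (\<epsilon> n) *s h) - F (p + \<zeta> *s k)
            - line_deriv F h (p + \<zeta> *s k) * of_real (\<epsilon> n)) \<le> 32 * M / s\<^sup>2 * (norm (complex_of_real (\<epsilon> n)))\<^sup>2"
        proof (rule line_deriv_bounds(2))
          show "ball (p + \<zeta> *s k) (r/2) \<subseteq> \<Omega>" using sub[OF z] rM(3) by blast
          show "norm (F q') \<le> M" if "q' \<in> ball (p + \<zeta> *s k) (r/2)" for q'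
            using sub[OF z] that rM(4) by blast
        qed (use rM \<open>s > 0\<close> sh \<epsilon>[of n] in auto)
        moreover have "dist (D n \<zeta>) (line_deriv F h (p + \<zeta> *s k)) =
          norm (F ((p + \<zeta> *s k) + of_real (\<epsilon> n) *s h) - F (p + \<zeta> *s k)
            - line_deriv F h (p + \<zeta> *s k) * of_real (\<epsilon> n)) / \<epsilon> n"
        proof -
          have "D n \<zeta> - line_deriv F h (p + \<zeta> *s k) =
            (F ((p + \<zeta> *s k) + of_real (\<epsilon> n) *s h) - F (p + \<zeta> *s k)
            - line_deriv F h (p + \<zeta> *s k) * of_real (\<epsilon> n)) / of_real (\<epsilon> n)"
            using \<epsilon>[of n] unfolding D_def eq by (simp add: field_simps)
          then show ?thesis using \<epsilon>(1)[of n] by (simp add: dist_norm norm_divide)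
        qed
        ultimately show ?thesis
          using \<epsilon>(1)[of n] by (simp add: divide_le_eq power2_eq_square mult.assoc)
      qed
      have "(\<lambda>n. 32 * M / s\<^sup>2 * \<epsilon> n) \<longlonglongrightarrow> 32 * M / s\<^sup>2 * 0"
      proof (rule tendsto_mult_left)
        have "(\<lambda>n. s / 8 * inverse (real (Suc n))) \<longlonglongrightarrow> s / 8 * 0"
          by (intro tendsto_mult_left LIMSEQ_inverse_real_of_nat)
        then show "\<epsilon> \<longlonglongrightarrow> 0" unfolding \<epsilon>_def by (simp add: field_simps)
      qed
      then have lim0: "(\<lambda>n. 32 * M / s\<^sup>2 * \<epsilon> n) \<longlonglongrightarrow> 0" by simp
      have ul: "uniform_limit (ball \<zeta>0 \<rho>) D (\<lambda>\<zeta>. line_deriv F h (p + \<zeta> *s k)) sequentially"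
        unfolding uniform_limit_iff
      proof (intro allI impI)
        fix e :: real assume "e > 0"
        show "\<forall>\<^sub>F n in sequentially. \<forall>x\<in>ball \<zeta>0 \<rho>. dist (D n x) (line_deriv F h (p + x *s k)) < e"
          using order_tendstoD(2)[OF lim0 \<open>e > 0\<close>]
          by eventually_elim (intro ballI le_less_trans[OF bnd])
      qed
      show "\<exists>d>0. cball x d \<subseteq> ball \<zeta>0 \<rho> \<and>
          uniform_limit (cball x d) D (\<lambda>\<zeta>. line_deriv F h (p + \<zeta> *s k)) sequentially"
        if x: "x \<in> ball \<zeta>0 \<rho>" for x
      proof -
        obtain d where "d > 0" "cball x d \<subseteq> ball \<zeta>0 \<rho>"
          using open_contains_cball_eq[OF open_ball] x by metis
        then show ?thesis using uniform_limit_on_subset[OF ul] by blast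
      qed
    qed auto
    then show "\<exists>f'. ((\<lambda>\<zeta>. line_deriv F h (p + \<zeta> *s k)) has_field_derivative f') (at \<zeta>0)"
      using \<open>\<rho> > 0\<close> by (auto simp: holomorphic_on_open)
  qed
next
  fix p assume "p \<in> \<Omega>"
  then obtain r M where rM: "r > 0" "M \<ge> 0" "ball p r \<subseteq> \<Omega>" "\<And>q. q \<in> ball p r \<Longrightarrow> norm (F q) \<le> M"
    using line_holomorphic_locally_boundedE by metis
  obtain s where "s > 0" and sh: "s * norm h \<le> r / 2" using small_multiple_norm_le[OF rM(1), of h] .
  have "norm (line_deriv F h q) \<le> 2 * M / s" if "q \<in> ball p (r/2)" for q
  proof (rule line_deriv_bounds(1))
    have *: "ball q (r/2) \<subseteq> ball p r"
    proof
      fix x assume "x \<in> ball q (r/2)"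
      then show "x \<in> ball p r" using that dist_triangle[of p x q] by simp
    qed
    then show "ball q (r/2) \<subseteq> \<Omega>" using rM by blast
    show "norm (F q') \<le> M" if "q' \<in> ball q (r/2)" for q' using * that rM by blast
  qed (use rM \<open>s > 0\<close> sh in auto)
  moreover have "ball p (r/2) \<subseteq> \<Omega>" using rM by auto
  ultimately show "\<exists>r>0. \<exists>M. ball p r \<subseteq> \<Omega> \<and> (\<forall>q\<in>ball p r. norm (line_deriv F h q) \<le> M)"
    using rM(1) by (metis half_gt_zero)
qed

lemma line_deriv_scale:
  assumes "p \<in> \<Omega>"
  shows "line_deriv F (c *s h) p = c * line_deriv F h p"
proof -
  obtain r M where rM: "r > 0" "M \<ge> 0" "ball p r \<subseteq> \<Omega>" "\<And>q. q \<in> ball p r \<Longrightarrow> norm (F q) \<le> M"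
    using line_holomorphic_locally_boundedE[OF assms] by metis
  define A where "A = {\<zeta>. p + \<zeta> *s h \<in> ball p r}"
  have "continuous_on UNIV (\<lambda>\<zeta>. p + \<zeta> *s h)"
    unfolding vector_scalar_mult_def by (intro continuous_intros)
  then have "open A"
    unfolding A_def vimage_def[symmetric] by (simp add: open_vimage)
  moreover have "(\<lambda>\<zeta>. F (p + \<zeta> *s h)) holomorphic_on A"
    using F rM(3) unfolding line_holomorphic_on_def A_def
    by (meson Collect_mono holomorphic_on_subset subsetD)
  moreover have "0 \<in> A" using rM(1) by (simp add: A_def)
  ultimately have d: "((\<lambda>\<zeta>. F (p + \<zeta> *s h)) has_field_derivative line_deriv F h p) (at (c * 0))"
    unfolding line_deriv_def by (simp add: holomorphic_derivI)
  have "((\<lambda>\<zeta>. F (p + (c * \<zeta>) *s h)) has_field_derivative line_deriv F h p * c) (at 0)"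
    by (rule DERIV_chain2[where f = "\<lambda>\<zeta>. F (p + \<zeta> *s h)" and g = "\<lambda>\<zeta>. c * \<zeta>", OF d])
      (auto intro!: derivative_eq_intros)
  then show ?thesis
    unfolding line_deriv_def vector_smult_assoc by (simp add: DERIV_imp_deriv mult.commute)
qed

end

text \<open>Additivity in the direction follows from comparing, for small \<open>t\<close>, the increments of \<open>F\<close> along
  \<open>t h\<close>, \<open>t k\<close> and \<open>t (h + k)\<close>: all Taylor remainders are \<open>O(t\<^sup>2)\<close>, uniformly in the base point.\<close>

lemma line_deriv_add:
  fixes F :: "complex^'m \<Rightarrow> complex"
  assumes F: "line_holomorphic_on \<Omega> F" and op: "open \<Omega>" and p: "p \<in> \<Omega>"
  shows "line_deriv F (h + k) p = line_deriv F h p + line_deriv F k p"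
proof -
  let ?G = "line_deriv F k"
  have G: "line_holomorphic_on \<Omega> ?G" by (rule line_holomorphic_line_deriv[OF F op])
  obtain r1 M1 where r1: "r1 > 0" "M1 \<ge> 0" "ball p r1 \<subseteq> \<Omega>" "\<And>q. q \<in> ball p r1 \<Longrightarrow> norm (F q) \<le> M1"
    using line_holomorphic_locally_boundedE[OF F p] by metis
  obtain r2 M2 where r2: "r2 > 0" "M2 \<ge> 0" "ball p r2 \<subseteq> \<Omega>" "\<And>q. q \<in> ball p r2 \<Longrightarrow> norm (?G q) \<le> M2"
    using line_holomorphic_locally_boundedE[OF G p] by metis
  define r where "r = min r1 r2 / 2"
  define M where "M = max M1 M2"
  have r: "r > 0" "r < r1" "r < r2" "2 * r \<le> r1" using r1 r2 by (auto simp: r_def)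
  have M: "M \<ge> M1" "M \<ge> M2" "M \<ge> 0" using r1(2) by (auto simp: M_def)
  define N where "N = norm h + norm k + norm (h + k) + 1"
  have N: "N > 0" "norm h \<le> N" "norm k \<le> N" "norm (h + k) \<le> N"
    unfolding N_def using norm_ge_zero[of h] norm_ge_zero[of k] norm_ge_zero[of "h + k"] by linarith+
  define s where "s = r / N"
  have s: "s > 0" "s * norm h \<le> r" "s * norm k \<le> r" "s * norm (h + k) \<le> r"
  proof -
    have "r / N * x \<le> r" if "x \<le> N" for x
      using mult_left_mono[OF that, of r] r(1) N(1) by (simp add: pos_divide_le_eq)
    then show "s * norm h \<le> r" "s * norm k \<le> r" "s * norm (h + k) \<le> r"
      unfolding s_def using N by blast+
  qed (use r(1) N(1) s_def in simp)
  have FB: "norm (F (q + \<zeta> *s l) - F q - line_deriv F l q * \<zeta>) \<le> 32 * M / s\<^sup>2 * (norm \<zeta>)\<^sup>2"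
    if "norm \<zeta> \<le> s / 4" "q \<in> ball p r" "s * norm l \<le> r" for q \<zeta> l
  proof (rule line_deriv_bounds(2)[OF F])
    have *: "ball q r \<subseteq> ball p r1"
    proof
      fix x assume "x \<in> ball q r"
      then show "x \<in> ball p r1" using that(2) dist_triangle[of p x q] r by simp
    qed
    then show "ball q r \<subseteq> \<Omega>" using r1(3) by blast
    show "norm (F q') \<le> M" if "q' \<in> ball q r" for q' using * r1(4) M(1) that by force
  qed (use that r s in auto)
  have GB: "norm (?G (p + \<zeta> *s h) - ?G p - line_deriv ?G h p * \<zeta>) \<le> 32 * M / s\<^sup>2 * (norm \<zeta>)\<^sup>2"
    if "norm \<zeta> \<le> s / 4" for \<zeta>
  proof (rule line_deriv_bounds(2)[OF G])
    show "ball p r \<subseteq> \<Omega>" using r(3) r2(3) by auto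
    show "norm (?G q') \<le> M" if "q' \<in> ball p r" for q' using r(3) r2(4)[of q'] M(2) that by force
  qed (use that r s in auto)
  define B where "B = 32 * M / s\<^sup>2"
  have "B \<ge> 0" using M by (simp add: B_def)
  define L where "L = norm (line_deriv ?G h p)"
  define \<Delta> where "\<Delta> = norm (line_deriv F h p + ?G p - line_deriv F (h + k) p)"
  have est: "\<Delta> \<le> (3 * B + L + B * s) * t" if t: "0 < t" "t < s / 4" for t :: real
  proof -
    let ?q = "p + of_real t *s h"
    have "norm (complex_of_real t *s h) \<le> (s / 4) * norm h"
      using t mult_right_mono[of t "s / 4" "norm h"] by (simp add: norm_vector_smult)
    also have "\<dots> < r" using s(2) r(1) by linarith
    finally have q: "?q \<in> ball p r" by (simp add: dist_norm)
    have p': "p \<in> ball p r" using r by simp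
    have nt: "norm (complex_of_real t) \<le> s / 4" "norm (complex_of_real t) = t" using t by auto
    \<comment> \<open>\<open>e1\<close> and \<open>e2\<close> are the remainders of the legs
      \<open>h\<close> and then \<open>k\<close>, and \<open>e3\<close> is that of the direct path
      \<open>h + k\<close>. The second leg starts at \<open>?q\<close> and thus produces
      \<open>?G ?q\<close>; \<open>e4\<close> carries this back to \<open>p\<close> and needs that
      \<open>?G\<close> is itself differentiable along \<open>h\<close>.\<close>
    define e1 where "e1 = F ?q - F p - line_deriv F h p * of_real t"
    define e2 where "e2 = F (?q + of_real t *s k) - F ?q - ?G ?q * of_real t"
    define e3 where "e3 = F (p + of_real t *s (h + k)) - F p - line_deriv F (h + k) p * of_real t"
    define e4 where "e4 = ?G ?q - ?G p - line_deriv ?G h p * of_real t"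
    have e: "norm e1 \<le> B * t\<^sup>2" "norm e2 \<le> B * t\<^sup>2" "norm e3 \<le> B * t\<^sup>2" "norm e4 \<le> B * t\<^sup>2"
      using FB[OF nt(1) p' s(2)] FB[OF nt(1) q s(3)] FB[OF nt(1) p' s(4)] GB[OF nt(1)]
      unfolding e1_def e2_def e3_def e4_def B_def nt(2) by this+
    have "p + of_real t *s (h + k) = ?q + of_real t *s k"
      by (simp add: vector_add_ldistrib ac_simps)
    then have "(line_deriv F h p + ?G p - line_deriv F (h + k) p) * of_real t
        = e3 - e2 - e1 - (e4 + line_deriv ?G h p * of_real t) * of_real t"
      unfolding e1_def e2_def e3_def e4_def by (simp add: algebra_simps)
    moreover have "\<Delta> * t = norm ((line_deriv F h p + ?G p - line_deriv F (h + k) p) * of_real t)"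
      unfolding \<Delta>_def norm_mult nt(2) ..
    ultimately have "\<Delta> * t = norm (e3 - e2 - e1 - (e4 + line_deriv ?G h p * of_real t) * of_real t)"
      by simp
    also have "\<dots> \<le> norm e3 + norm e2 + norm e1 + norm ((e4 + line_deriv ?G h p * of_real t) * of_real t)"
    proof -
      have "norm (a - b - c - d) \<le> norm a + norm b + norm c + norm d" for a b c d :: complex
        using norm_triangle_ineq4[of "a - b - c" d] norm_triangle_ineq4[of "a - b" c]
          norm_triangle_ineq4[of a b] by linarith
      then show ?thesis .
    qed
    also have "norm ((e4 + line_deriv ?G h p * of_real t) * of_real t) \<le> (B * t\<^sup>2 + L * t) * t"
    proof -
      have "norm (e4 + line_deriv ?G h p * of_real t) \<le> B * t\<^sup>2 + L * t"
        using norm_triangle_ineq[of e4 "line_deriv ?G h p * of_real t"] e(4) nt(2)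
        by (simp add: norm_mult L_def)
      then show ?thesis using t by (simp add: norm_mult mult_right_mono)
    qed
    finally have "\<Delta> * t \<le> 3 * (B * t\<^sup>2) + (B * t\<^sup>2 + L * t) * t" using e by linarith
    also have "\<dots> = ((3 * B + L) * t + B * t * t) * t" by (simp add: power2_eq_square algebra_simps)
    also have "\<dots> \<le> ((3 * B + L) * t + B * s * t) * t"
      using t s \<open>B \<ge> 0\<close> by (intro mult_right_mono add_left_mono mult_left_mono) auto
    finally have "\<Delta> * t \<le> ((3 * B + L + B * s) * t) * t" by (simp add: algebra_simps)
    then show ?thesis using t by simp
  qed
  have "((\<lambda>t. (3 * B + L + B * s) * t) \<longlongrightarrow> (3 * B + L + B * s) * 0) (at_right 0)"
    by (intro tendsto_intros)
  moreover have "eventually (\<lambda>t. \<Delta> \<le> (3 * B + L + B * s) * t) (at_right 0)"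
    using est s(1) by (auto simp: eventually_at_right[of 0 "s/4"] intro!: exI[of _ "s / 4"])
  ultimately have "\<Delta> \<le> (3 * B + L + B * s) * 0"
    by (intro tendsto_lowerbound) auto
  then show ?thesis unfolding \<Delta>_def by simp
qed

text \<open>Linearity of the line derivative is already known. The error is quadratic because the
  disc on the line in direction \<open>h\<close> may have radius \<open>r / norm h\<close>, so the
  remainder at \<zeta> = 1 is of order \<open>(norm h)\<^sup>2\<close>.\<close>

lemma line_holomorphic_has_derivative:
  fixes F :: "complex^'m \<Rightarrow> complex"
  assumes F: "line_holomorphic_on \<Omega> F" and op: "open \<Omega>" and p: "p \<in> \<Omega>"
  shows "(F has_derivative (\<lambda>h. line_deriv F h p)) (at p)"
proof -
  obtain r M where rM: "r > 0" "M \<ge> 0" "ball p r \<subseteq> \<Omega>" "\<And>q. q \<in> ball p r \<Longrightarrow> norm (F q) \<le> M"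
    using line_holomorphic_locally_boundedE[OF F p] by metis
  have "linear (\<lambda>h. line_deriv F h p)"
  proof
    show "line_deriv F (b *\<^sub>R h) p = b *\<^sub>R line_deriv F h p" for b h
      using line_deriv_scale[OF F p, of "of_real b" h]
      by (simp add: scaleR_vec_def vector_scalar_mult_def scaleR_conv_of_real)
  qed (rule line_deriv_add[OF assms])
  then have bl: "bounded_linear (\<lambda>h. line_deriv F h p)"
    by (simp add: linear_conv_bounded_linear)
  have est: "norm (F (p + h) - F p - line_deriv F h p) \<le> (512 * M / r\<^sup>2 * norm h) * norm h"
    if h: "norm h < r / 4" for h
  proof (cases "h = 0")
    case True
    then show ?thesis by (simp add: line_deriv_def)
  next
    case False
    have "norm (F (p + 1 *s h) - F p - line_deriv F h p * 1) \<le> 32 * M / (r / norm h)\<^sup>2 * (norm (1::complex))\<^sup>2"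
      by (rule line_deriv_bounds(2)[OF F rM(1,3,4)]) (use False h rM(1) in \<open>auto simp: field_simps\<close>)
    also have "\<dots> = (32 * M / r\<^sup>2 * norm h) * norm h" by (simp add: power2_eq_square)
    also have "\<dots> \<le> (512 * M / r\<^sup>2 * norm h) * norm h"
      using rM by (intro mult_right_mono divide_right_mono) auto
    finally show ?thesis by simp
  qed
  have "((\<lambda>h. norm (F (p + h) - F p - line_deriv F h p) / norm h) \<longlongrightarrow> 0) (at 0)"
  proof (rule tendsto_sandwich[where f = "\<lambda>_. 0" and h = "\<lambda>h. 512 * M / r\<^sup>2 * norm h"])
    show "eventually (\<lambda>h. norm (F (p + h) - F p - line_deriv F h p) / norm h \<le> 512 * M / r\<^sup>2 * norm h) (at 0)"
      unfolding eventually_at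
      using est rM(1) by (intro exI[of _ "r/4"]) (auto simp: divide_le_eq)
    have "((\<lambda>h::complex^'m. 512 * M / r\<^sup>2 * norm h) \<longlongrightarrow> 512 * M / r\<^sup>2 * norm (0::complex^'m)) (at 0)"
      by (intro tendsto_intros)
    then show "((\<lambda>h::complex^'m. 512 * M / r\<^sup>2 * norm h) \<longlongrightarrow> 0) (at 0)" by simp
  qed auto
  then show ?thesis using bl by (simp add: has_derivative_at)
qed

text \<open>The derivative in direction \<open>v\<close> is the real part of
  \<open>line_deriv F (A v)\<close> along the same affine map, a function of the same kind; so the
  induction on \<open>k\<close> never leaves the class.\<close>

lemma Ck_on_Re_line_holomorphic:
  fixes F :: "complex^'m \<Rightarrow> complex" and A :: "'a::euclidean_space \<Rightarrow> complex^'m"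
  assumes "line_holomorphic_on \<Omega> F" and op: "open \<Omega>" and A: "bounded_linear A"
    and opS: "open S" and S: "\<And>x. x \<in> S \<Longrightarrow> c + A x \<in> \<Omega>"
  shows "Ck_on k S (\<lambda>x. Re (F (c + A x)))"
  using assms(1)
proof (induction k arbitrary: F)
  case 0
  have "isCont (\<lambda>x. Re (F (c + A x))) x" if "x \<in> S" for x
  proof -
    have "isCont F (c + A x)"
      using has_derivative_continuous[OF line_holomorphic_has_derivative[OF 0 op S[OF that]]] .
    moreover have "isCont (\<lambda>x. c + A x) x"
      by (intro continuous_intros linear_continuous_at A)
    ultimately have "isCont (\<lambda>x. F (c + A x)) x" by (metis isCont_o2)
    then show ?thesis by (rule isCont_Re)
  qed
  then show ?case by (simp add: continuous_at_imp_continuous_on)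
next
  case (Suc k)
  have der: "((\<lambda>x. Re (F (c + A x))) has_derivative (\<lambda>h. Re (line_deriv F (A h) (c + A x)))) (at x)"
    if "x \<in> S" for x
  proof -
    have "((\<lambda>x. c + A x) has_derivative A) (at x)"
      using A by (auto intro!: derivative_eq_intros bounded_linear_imp_has_derivative)
    from has_derivative_compose[OF this line_holomorphic_has_derivative[OF Suc.prems op S[OF that]]]
    show ?thesis by (rule bounded_linear.has_derivative[OF bounded_linear_Re])
  qed
  have "Ck_on k S (\<lambda>x. frechet_derivative (\<lambda>x. Re (F (c + A x))) (at x) v)" for v
  proof (rule Ck_on_local)
    fix x assume "x \<in> S"
    have "Ck_on k S (\<lambda>x. Re (line_deriv F (A v) (c + A x)))"
      by (rule Suc.IH) (rule line_holomorphic_line_deriv[OF Suc.prems op])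
    moreover have "frechet_derivative (\<lambda>x. Re (F (c + A x))) (at y) v = Re (line_deriv F (A v) (c + A y))"
      if "y \<in> S" for y
      using frechet_derivative_at[OF der[OF that]] by metis
    ultimately show "\<exists>U g. open U \<and> x \<in> U \<and>
        (\<forall>y\<in>U. frechet_derivative (\<lambda>x. Re (F (c + A x))) (at y) v = g y) \<and> Ck_on k U g"
      using opS \<open>x \<in> S\<close> by (intro exI[of _ S] exI[of _ "\<lambda>x. Re (line_deriv F (A v) (c + A x))"]) simp
  qed
  then show ?case using der by (auto simp: differentiable_def)
qed

section \<open>Gaussian convolutions\<close>

lemma gauss_kernel_nonneg: "gauss_kernel t z \<ge> 0"
  by (simp add: gauss_kernel_def)

lemma borel_measurable_gauss_kernel [measurable]: "gauss_kernel t \<in> borel_measurable borel"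
  unfolding gauss_kernel_def by measurable

text \<open>The heat kernel at time \<open>t\<close> is the density of independent centred normal
  coordinates of variance \<open>2 * t\<close>, which reduces its total mass to one
  dimension.\<close>

lemma gauss_kernel_prod_normal_density:
  fixes z :: "real^'n"
  assumes t: "t > 0"
  shows "gauss_kernel t z = (\<Prod>b\<in>Basis. normal_density 0 (sqrt (2 * t)) (z \<bullet> b))"
proof -
  have "(norm z)\<^sup>2 = (\<Sum>b\<in>Basis. (z \<bullet> b)\<^sup>2)"
    using euclidean_inner[of z z] by (simp add: power2_eq_square flip: power2_norm_eq_inner)
  then have "exp (- (norm z)\<^sup>2 / (4 * t)) = (\<Prod>b\<in>Basis. exp (- (z \<bullet> b)\<^sup>2 / (4 * t)))"
    by (simp add: exp_sum sum_divide_distrib flip: sum_negf)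
  moreover have "(4 * pi * t) powr (- (real CARD('n) / 2)) = (\<Prod>b\<in>(Basis :: (real^'n) set). 1 / sqrt (4 * pi * t))"
  proof -
    have "(4 * pi * t) powr (- (real CARD('n) / 2)) = ((4 * pi * t) powr (- (1 / 2))) powr real CARD('n)"
      by (simp add: powr_powr)
    also have "(4 * pi * t) powr (- (1 / 2)) = 1 / sqrt (4 * pi * t)"
      using t by (simp add: powr_minus powr_half_sqrt inverse_eq_divide)
    finally show ?thesis using t by (simp add: powr_realpow)
  qed
  ultimately show ?thesis
    using t unfolding gauss_kernel_def normal_density_def
    by (simp add: prod.distrib[symmetric] mult.assoc power2_eq_square field_simps del: prod_constant)
qed

lemma has_bochner_integral_gauss_kernel:
  assumes t: "t > 0"
  shows "has_bochner_integral lborel (gauss_kernel t :: real^'n \<Rightarrow> real) 1"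
proof -
  have 1: "(\<integral>\<^sup>+x. ennreal (normal_density 0 (sqrt (2 * t)) x) \<partial>lborel) = 1"
  proof -
    interpret prob_space "density lborel (normal_density 0 (sqrt (2 * t)))"
      using t by (intro prob_space_normal_density) simp
    show ?thesis using emeasure_space_1 by (simp add: emeasure_density)
  qed
  have "(\<integral>\<^sup>+z. ennreal (gauss_kernel t (z::real^'n)) \<partial>lborel)
      = (\<integral>\<^sup>+z. (\<Prod>b\<in>Basis. ennreal (normal_density 0 (sqrt (2 * t)) (z \<bullet> b))) \<partial>(lborel :: (real^'n) measure))"
    by (intro nn_integral_cong) (simp add: gauss_kernel_prod_normal_density[OF t] prod_ennreal)
  also have "\<dots> = 1"
    by (subst nn_integral_lborel_prod[where f = "\<lambda>_ x. ennreal (normal_density 0 (sqrt (2 * t)) x)"]) (simp_all add: 1)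
  finally show ?thesis
    by (intro has_bochner_integral_nn_integral) (auto simp: gauss_kernel_nonneg)
qed

lemma integrable_gauss_kernel: "t > 0 \<Longrightarrow> integrable lborel (gauss_kernel t :: real^'n \<Rightarrow> real)"
  and integral_gauss_kernel: "t > 0 \<Longrightarrow> (LINT z|lborel. gauss_kernel t (z :: real^'n)) = 1"
  using has_bochner_integral_gauss_kernel has_bochner_integral_iff by blast+

lemma integrable_gauss_kernel_mult:
  fixes f :: "real^'n \<Rightarrow> real"
  assumes "t > 0" "f \<in> borel_measurable borel" "\<And>z. \<bar>f z\<bar> \<le> C"
  shows "integrable lborel (\<lambda>z. gauss_kernel t z * f z)"
proof (rule Bochner_Integration.integrable_bound)
  show "integrable lborel (\<lambda>z::real^'n. gauss_kernel t z * C)"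
    using integrable_gauss_kernel[OF assms(1), where 'n='n] by simp
  have "norm (gauss_kernel t z * f z) \<le> norm (gauss_kernel t z * C)" for z
    using assms(3)[of z] by (auto simp: abs_mult intro!: mult_left_mono)
  then show "AE z in lborel. norm (gauss_kernel t z * f z) \<le> norm (gauss_kernel t z * C)" by simp
qed (use assms in measurable)

text \<open>The formula is free of integrability conditions: for measurable \<open>f\<close> it is
  the change of variables, and otherwise both integrals take the default value 0.\<close>

lemma lborel_integral_affine:
  fixes f :: "'a::euclidean_space \<Rightarrow> 'b::{banach, second_countable_topology}"
  assumes c: "c \<noteq> 0"
  shows "(LINT x|lborel. f x) = \<bar>c\<bar> ^ DIM('a) *\<^sub>R (LINT x|lborel. f (t + c *\<^sub>R x))"
proof -
  have meas_iff: "f \<in> borel_measurable borel \<longleftrightarrow> (\<lambda>x. f (t + c *\<^sub>R x)) \<in> borel_measurable borel"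
  proof
    assume [measurable]: "f \<in> borel_measurable borel"
    show "(\<lambda>x. f (t + c *\<^sub>R x)) \<in> borel_measurable borel" by measurable
  next
    assume [measurable]: "(\<lambda>x. f (t + c *\<^sub>R x)) \<in> borel_measurable borel"
    have "(\<lambda>y. (\<lambda>x. f (t + c *\<^sub>R x)) ((1 / c) *\<^sub>R (y - t))) \<in> borel_measurable borel" by measurable
    then show "f \<in> borel_measurable borel" using c by simp
  qed
  show ?thesis
  proof (cases "f \<in> borel_measurable borel")
    case True
    note [measurable] = True
    show ?thesis
      by (subst lborel_affine[OF c, of t]) (simp add: integral_density integral_distr c)
  next
    case False
    have "(LINT x|lborel. f x) = 0"
      using False by (intro not_integrable_integral_eq) (auto dest: borel_measurable_integrable)
    moreover have "(LINT x|lborel. f (t + c *\<^sub>R x)) = 0"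
      using False meas_iff by (intro not_integrable_integral_eq) (auto dest: borel_measurable_integrable)
    ultimately show ?thesis by simp
  qed
qed

lemma lborel_integrable_affine:
  fixes f :: "'a::euclidean_space \<Rightarrow> 'b::{banach, second_countable_topology}"
  assumes c: "c \<noteq> 0" and f: "integrable lborel f"
  shows "integrable lborel (\<lambda>x. f (t + c *\<^sub>R x))"
proof -
  note [measurable] = borel_measurable_integrable[OF f]
  have "integrable (density (distr lborel borel (\<lambda>x. t + c *\<^sub>R x)) (\<lambda>_. ennreal (\<bar>c\<bar> ^ DIM('a)))) f"
    using f unfolding lborel_affine[OF c, of t, symmetric] .
  then have "integrable lborel (\<lambda>x. \<bar>c\<bar> ^ DIM('a) *\<^sub>R f (t + c *\<^sub>R x))"
    by (simp add: integrable_density integrable_distr_eq)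
  then have "integrable lborel (\<lambda>x. inverse (\<bar>c\<bar> ^ DIM('a)) *\<^sub>R \<bar>c\<bar> ^ DIM('a) *\<^sub>R f (t + c *\<^sub>R x))"
    by (rule integrable_scaleR_right)
  then show ?thesis using c by simp
qed

text \<open>This is the heat flow at time \<open>c\<^sup>2\<close>, with the integration variable
  scaled so that the kernel stays fixed. The time then sits only in the argument of
  \<open>f\<close>: \<open>c = 0\<close> is the identity instead of a singular case, and joint
  measurability in time and space is immediate.\<close>

definition gauss_conv :: "real \<Rightarrow> (real^'n \<Rightarrow> real) \<Rightarrow> real^'n \<Rightarrow> real" where
  "gauss_conv c f x = (LINT z|lborel. gauss_kernel 1 z * f (x - c *\<^sub>R z))"

lemma borel_measurable_gauss_conv [measurable (raw)]:
  assumes [measurable]: "c \<in> borel_measurable M" "x \<in> borel_measurable M"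
    "case_prod f \<in> borel_measurable (M \<Otimes>\<^sub>M borel)"
  shows "(\<lambda>q. gauss_conv (c q) (f q) (x q :: real^'n)) \<in> borel_measurable M"
proof -
  have "(\<lambda>(q, z). gauss_kernel 1 z * case_prod f (q, x q - c q *\<^sub>R z)) \<in> borel_measurable (M \<Otimes>\<^sub>M lborel)"
    by measurable
  then show ?thesis unfolding gauss_conv_def by (simp add: lborel.borel_measurable_lebesgue_integral)
qed

lemma integrable_gauss_conv:
  assumes [measurable]: "f \<in> borel_measurable borel" and "\<And>y. \<bar>f y\<bar> \<le> C"
  shows "integrable lborel (\<lambda>z. gauss_kernel 1 z * f (x - c *\<^sub>R (z :: real^'n)))"
  using assms(2) by (intro integrable_gauss_kernel_mult[where C = C]) auto

lemma gauss_conv_AE_bound: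
  fixes f :: "real^'n \<Rightarrow> real"
  assumes "AE z in lborel. \<bar>f (x - c *\<^sub>R z)\<bar> \<le> C"
  shows "\<bar>gauss_conv c f x\<bar> \<le> C"
proof (cases "integrable lborel (\<lambda>z. gauss_kernel 1 z * f (x - c *\<^sub>R z))")
  case True
  have "norm (gauss_conv c f x) \<le> (LINT z|lborel. norm (gauss_kernel 1 z * f (x - c *\<^sub>R z)))"
    unfolding gauss_conv_def by (rule integral_norm_bound)
  also have "\<dots> \<le> (LINT z|lborel. gauss_kernel 1 (z::real^'n) * C)"
  proof (rule integral_mono_AE)
    show "AE z in lborel. norm (gauss_kernel 1 z * f (x - c *\<^sub>R z)) \<le> gauss_kernel 1 z * C"
      using assms by eventually_elim (simp add: abs_mult gauss_kernel_nonneg mult_left_mono)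
  qed (use True integrable_gauss_kernel[of 1, where 'n='n] in auto)
  finally show ?thesis using integral_gauss_kernel[of 1, where 'n='n] by simp
next
  case False
  \<comment> \<open>The integral is 0 by default here, so only the sign of \<open>C\<close> matters;
    a negative \<open>C\<close> would make the almost-everywhere bound false at every point.\<close>
  have "C \<ge> 0"
  proof (rule ccontr)
    assume "\<not> C \<ge> 0"
    have "AE z in (lborel :: (real^'n) measure). False" by (rule AE_mp[OF assms], intro AE_I2) (use \<open>\<not> C \<ge> 0\<close> in linarith)
    then show False by (auto simp: AE_iff_null null_sets_def)
  qed
  then show ?thesis unfolding gauss_conv_def by (simp add: not_integrable_integral_eq[OF False])
qed

lemma gauss_conv_bound:
  "(\<And>y. \<bar>f y\<bar> \<le> C) \<Longrightarrow> \<bar>gauss_conv c f (x :: real^'n)\<bar> \<le> C"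
  by (rule gauss_conv_AE_bound) simp

lemma gauss_conv_0 [simp]: "gauss_conv 0 f (x :: real^'n) = f x"
  unfolding gauss_conv_def using integral_gauss_kernel[of 1, where 'n='n] by simp

lemma integrable_product_fun:
  fixes f :: "'a \<Rightarrow> real" and g :: "'b \<Rightarrow> real"
  assumes "sigma_finite_measure M" "sigma_finite_measure N" "integrable M f" "integrable N g"
  shows "integrable (M \<Otimes>\<^sub>M N) (\<lambda>(x, y). f x * g y)"
proof -
  interpret pair_sigma_finite M N using assms by (simp add: pair_sigma_finite_def)
  have [measurable]: "f \<in> borel_measurable M" "g \<in> borel_measurable N" using assms by auto
  show ?thesis
  proof (rule Fubini_integrable)
    show "integrable M (\<lambda>x. LINT y|N. norm (case (x, y) of (x, y) \<Rightarrow> f x * g y))"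
      using assms by (simp add: abs_mult)
    show "AE x in M. integrable N (\<lambda>y. case (x, y) of (x, y) \<Rightarrow> f x * g y)"
      using assms by simp
  qed measurable
qed

text \<open>The semigroup law by completing the square. With
  \<open>e\<^sup>2 = c\<^sup>2 + d\<^sup>2\<close>, the inner variable is replaced by
  \<open>(e / d) *\<^sub>R y - (c / d) *\<^sub>R z\<close>, which turns the argument of
  \<open>f\<close> into \<open>x - e *\<^sub>R y\<close>, free of \<open>z\<close>. The product of
  the two Gaussians is symmetric in \<open>y\<close> and \<open>z\<close>, so the integral over
  \<open>z\<close> can be carried out and cancels the Jacobian \<open>J\<close>.\<close>

lemma gauss_conv_gauss_conv:
  fixes f :: "real^'n \<Rightarrow> real"
  assumes [measurable]: "f \<in> borel_measurable borel" and f: "\<And>y. \<bar>f y\<bar> \<le> C" and "c \<ge> 0" "d \<ge> 0"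
  shows "gauss_conv c (gauss_conv d f) x = gauss_conv (sqrt (c\<^sup>2 + d\<^sup>2)) f x"
proof (cases "d = 0")
  case True
  then have "gauss_conv d f = f" by (auto simp: fun_eq_iff)
  then show ?thesis using True \<open>c \<ge> 0\<close> by simp
next
  case False
  then have d: "d > 0" using assms by simp
  define e where "e = sqrt (c\<^sup>2 + d\<^sup>2)"
  have e: "e > 0" "e\<^sup>2 = c\<^sup>2 + d\<^sup>2" using d by (auto simp: e_def add_nonneg_pos)
  define J where "J = (e / d) ^ CARD('n)"
  have "J > 0" using e d by (simp add: J_def)
  let ?g = "gauss_kernel 1 :: real^'n \<Rightarrow> real"
  \<comment> \<open>The map sending \<open>z\<close> and the substituted inner variable to
    \<open>y\<close> and its counterpart preserves the sum of squared norms; all that enters is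
    \<open>a * a = 1 + b * b\<close> for \<open>a = e / d\<close> and
    \<open>b = c / d\<close>.\<close>
  have g: "?g z * ?g ((e / d) *\<^sub>R y - (c / d) *\<^sub>R z) = ?g y * ?g ((e / d) *\<^sub>R z - (c / d) *\<^sub>R y)" for y z
  proof -
    have "(norm z)\<^sup>2 + (norm ((e / d) *\<^sub>R y - (c / d) *\<^sub>R z))\<^sup>2
       = (norm y)\<^sup>2 + (norm ((e / d) *\<^sub>R z - (c / d) *\<^sub>R y))\<^sup>2"
    proof -
      have *: "(norm z)\<^sup>2 + (norm (a *\<^sub>R y - b *\<^sub>R z))\<^sup>2 = (norm y)\<^sup>2 + (norm (a *\<^sub>R z - b *\<^sub>R y))\<^sup>2"
        if "a * a = 1 + b * b" for a b
      proof -
        have exp: "(norm (a *\<^sub>R u - b *\<^sub>R v))\<^sup>2 = (a * a) * (u \<bullet> u) - 2 * a * b * (u \<bullet> v) + (b * b) * (v \<bullet> v)"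
          for u v :: "real^'n"
          by (simp add: power2_norm_eq_inner inner_diff_left inner_diff_right inner_commute algebra_simps)
        show ?thesis
          unfolding exp that by (simp add: power2_norm_eq_inner inner_commute algebra_simps)
      qed
      show ?thesis
        by (rule *) (use e d in \<open>simp add: power2_eq_square field_simps\<close>)
    qed
    then show ?thesis
      by (simp add: gauss_kernel_def flip: exp_add add_divide_distrib)
  qed
  have inner: "gauss_conv d f (x - c *\<^sub>R z) = J * (LINT y|lborel. ?g ((e / d) *\<^sub>R y - (c / d) *\<^sub>R z) * f (x - e *\<^sub>R y))" for z
    unfolding gauss_conv_def
    by (subst lborel_integral_affine[where c = "e / d" and t = "- (c / d) *\<^sub>R z"])
       (use e d in \<open>auto simp: J_def scaleR_add_right algebra_simps\<close>)
  define h where "h z y = ?g z * (?g ((e / d) *\<^sub>R y - (c / d) *\<^sub>R z) * f (x - e *\<^sub>R y))" for z y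
  have [measurable]: "case_prod h \<in> borel_measurable (borel \<Otimes>\<^sub>M borel)" unfolding h_def by measurable
  have hint: "(LINT z|lborel. ?g ((e / d) *\<^sub>R z - (c / d) *\<^sub>R y)) = 1 / J"
    "integrable lborel (\<lambda>z. ?g ((e / d) *\<^sub>R z - (c / d) *\<^sub>R y))" for y
  proof -
    have "(1::real) = J * (LINT z|lborel. ?g ((e / d) *\<^sub>R z - (c / d) *\<^sub>R y))"
      using lborel_integral_affine[of "e / d" ?g "- (c / d) *\<^sub>R y"] e d integral_gauss_kernel[of 1, where 'n='n]
      by (simp add: J_def)
    then show 1: "(LINT z|lborel. ?g ((e / d) *\<^sub>R z - (c / d) *\<^sub>R y)) = 1 / J"
      using \<open>J > 0\<close> by (simp add: field_simps)
    \<comment> \<open>A non-integrable function would have integral 0, which differs from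
      \<open>1 / J\<close>.\<close>
    show "integrable lborel (\<lambda>z. ?g ((e / d) *\<^sub>R z - (c / d) *\<^sub>R y))"
      using 1 \<open>J > 0\<close> not_integrable_integral_eq by fastforce
  qed
  have hsw: "h z y = (?g y * f (x - e *\<^sub>R y)) * ?g ((e / d) *\<^sub>R z - (c / d) *\<^sub>R y)" for z y
    unfolding h_def using g[of z y] by (simp add: algebra_simps)
  have int': "integrable (lborel \<Otimes>\<^sub>M lborel) (\<lambda>(y, z). h z y)"
  proof (rule lborel_pair.Fubini_integrable)
    have "integrable lborel (\<lambda>y. (?g y * \<bar>f (x - e *\<^sub>R y)\<bar>) * (1 / J))"
      using integrable_gauss_kernel_mult[of 1 "\<lambda>y. \<bar>f (x - e *\<^sub>R y)\<bar>" C] f by simp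
    then show "integrable lborel (\<lambda>y. LINT z|lborel. norm (case (y, z) of (y, z) \<Rightarrow> h z y))"
      by (simp add: hsw abs_mult gauss_kernel_nonneg hint)
    show "AE y in lborel. integrable lborel (\<lambda>z. case (y, z) of (y, z) \<Rightarrow> h z y)"
      by (simp add: hsw hint)
  qed measurable
  have "gauss_conv c (gauss_conv d f) x = J * (LINT z|lborel. LINT y|lborel. h z y)"
    unfolding gauss_conv_def[of c] inner h_def by (simp add: mult.left_commute)
  also have "(LINT z|lborel. LINT y|lborel. h z y) = (LINT y|lborel. LINT z|lborel. h z y)"
    using lborel_pair.Fubini_integral[OF int'] by simp
  also have "\<dots> = (LINT y|lborel. ?g y * f (x - e *\<^sub>R y) * (1 / J))"
    unfolding hsw using hint by simp
  finally show ?thesis using \<open>J > 0\<close> by (simp add: gauss_conv_def e_def)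
qed

lemma gauss_conv_set_integral:
  fixes G :: "real \<Rightarrow> real^'n \<Rightarrow> real"
  assumes [measurable]: "case_prod G \<in> borel_measurable (borel \<Otimes>\<^sub>M borel)"
    and G: "\<And>s y. s \<in> {a..b} \<Longrightarrow> \<bar>G s y\<bar> \<le> C"
  shows "gauss_conv c (\<lambda>y. LINT s:{a..b}|lborel. G s y) x = (LINT s:{a..b}|lborel. gauss_conv c (G s) x)"
proof -
  let ?g = "gauss_kernel 1 :: real^'n \<Rightarrow> real"
  define h where "h s z = indicator {a..b} s *\<^sub>R (?g z * G s (x - c *\<^sub>R z))" for s z
  have [measurable]: "case_prod h \<in> borel_measurable (borel \<Otimes>\<^sub>M borel)"
    unfolding h_def by measurable
  have ind: "integrable lborel (indicator {a..b} :: real \<Rightarrow> real)"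
    by (simp add: integrable_indicator_iff emeasure_lborel_Icc_eq)
  have int: "integrable (lborel \<Otimes>\<^sub>M lborel) (case_prod h)"
  proof (rule Bochner_Integration.integrable_bound)
    show "integrable (lborel \<Otimes>\<^sub>M lborel) (\<lambda>(s, z). (indicator {a..b} s * C) * ?g z)"
      using integrable_gauss_kernel[of 1, where 'n='n]
      by (intro integrable_product_fun integrable_mult_left) (auto intro: lborel.sigma_finite_measure_axioms ind)
    have "norm (h s z) \<le> norm ((indicator {a..b} s * C) * ?g z)" for s z
      using G[of s "x - c *\<^sub>R z"]
        mult_left_mono[of "\<bar>G s (x - c *\<^sub>R z)\<bar>" "\<bar>C\<bar>" "?g z"]
      by (auto simp: h_def indicator_def abs_mult gauss_kernel_nonneg mult.commute)
    then show "AE w in lborel \<Otimes>\<^sub>M lborel. norm (case_prod h w) \<le> norm (case w of (s, z) \<Rightarrow> (indicator {a..b} s * C) * ?g z)"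
      by (auto split: prod.split)
  qed measurable
  have "gauss_conv c (\<lambda>y. LINT s:{a..b}|lborel. G s y) x = (LINT z|lborel. LINT s|lborel. h s z)"
    unfolding gauss_conv_def h_def set_lebesgue_integral_def
    by (intro Bochner_Integration.integral_cong refl)
       (simp add: mult.left_commute flip: integral_mult_right_zero)
  also have "\<dots> = (LINT s|lborel. LINT z|lborel. h s z)"
    using lborel_pair.Fubini_integral[OF int] by simp
  also have "\<dots> = (LINT s:{a..b}|lborel. gauss_conv c (G s) x)"
    unfolding gauss_conv_def h_def set_lebesgue_integral_def by simp
  finally show ?thesis .
qed

section \<open>Unfolding the torus\<close>

definition torus_shift :: "int^'n \<Rightarrow> real^'n" where
  "torus_shift k = (\<chi> i. 2 * pi * real_of_int (k $ i))"

text \<open>The lattice cell containing \<open>y\<close>. Cells are half-open and tile the space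
  exactly, whereas \<open>torus_cell\<close> is closed; the two base cells differ by a null set
  (\<open>AE_torus_cell_index\<close>).\<close>

definition torus_index :: "real^'n \<Rightarrow> int^'n" where
  "torus_index y = (\<chi> i. \<lfloor>(y $ i + pi) / (2 * pi)\<rfloor>)"

lemma torus_index_shift: "torus_index (y + torus_shift k) = torus_index y + k"
proof -
  have "(y $ i + 2 * pi * real_of_int (k $ i) + pi) / (2 * pi) = (y $ i + pi) / (2 * pi) + real_of_int (k $ i)" for i
    by (simp add: field_simps)
  then show ?thesis by (simp add: torus_index_def torus_shift_def vec_eq_iff)
qed

lemma torus_shift_minus: "torus_shift (- k) = - torus_shift k"
  by (simp add: torus_shift_def vec_eq_iff)

lemma torus_index_eq_0_iff: "torus_index y = 0 \<longleftrightarrow> (\<forall>i. - pi \<le> y $ i \<and> y $ i < pi)"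
proof -
  have "\<lfloor>(a + pi) / (2 * pi)\<rfloor> = 0 \<longleftrightarrow> - pi \<le> a \<and> a < pi" for a :: real
    by (auto simp: floor_eq_iff divide_less_eq le_divide_eq)
  then show ?thesis by (simp add: torus_index_def vec_eq_iff)
qed

lemma measurable_torus_index [measurable]: "torus_index \<in> borel \<rightarrow>\<^sub>M count_space (UNIV :: (int^'n) set)"
  unfolding measurable_count_space_eq_countable[OF countableI_type]
proof (intro conjI ballI)
  fix a :: "int^'n"
  have "torus_index -` {a} \<inter> space borel = {y \<in> space borel. \<forall>i. \<lfloor>(y $ i + pi) / (2 * pi)\<rfloor> = a $ i}"
    by (auto simp: torus_index_def vec_eq_iff)
  also have "\<dots> \<in> sets borel" by measurable
  finally show "torus_index -` {a} \<inter> space borel \<in> sets borel" .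
qed auto

lemma torus_periodic_shift:
  fixes f :: "real^'n \<Rightarrow> 'b"
  assumes "torus_periodic f"
  shows "f (x + torus_shift k) = f x"
proof -
  have 1: "f (x + (2 * pi) *\<^sub>R axis i 1) = f x" for x i using assms by (simp add: torus_periodic_def)
  have nat: "f (x + (2 * pi * real n) *\<^sub>R axis i 1) = f x" for x i n
  proof (induction n)
    case (Suc n)
    have "x + (2 * pi * real (Suc n)) *\<^sub>R axis i 1 = (x + (2 * pi * real n) *\<^sub>R axis i 1) + (2 * pi) *\<^sub>R axis i 1"
      by (simp add: algebra_simps)
    then show ?case by (simp only: 1 Suc.IH)
  qed simp
  have int: "f (x + (2 * pi * real_of_int m) *\<^sub>R axis i 1) = f x" for x i m
  proof (cases "m \<ge> 0")
    case True
    then show ?thesis using nat[of x "nat m" i] by simp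
  next
    case False
    then show ?thesis using nat[of "x + (2 * pi * real_of_int m) *\<^sub>R axis i 1" "nat (- m)" i]
      by (simp flip: scaleR_add_left)
  qed
  have fin: "f (x + (\<Sum>i\<in>I. (2 * pi * real_of_int (k $ i)) *\<^sub>R axis i 1)) = f x" if "finite I" for I
    using that
  proof (induction I)
    case (insert i I)
    have "x + (\<Sum>i\<in>insert i I. (2 * pi * real_of_int (k $ i)) *\<^sub>R axis i 1)
       = (x + (\<Sum>i\<in>I. (2 * pi * real_of_int (k $ i)) *\<^sub>R axis i 1)) + (2 * pi * real_of_int (k $ i)) *\<^sub>R axis i 1"
      using insert by (simp add: ac_simps)
    then show ?case by (simp only: int insert.IH)
  qed simp
  have "torus_shift k = (\<Sum>i\<in>UNIV. (2 * pi * real_of_int (k $ i)) *\<^sub>R axis i 1)"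
    by (simp add: torus_shift_def vec_eq_iff axis_def if_distrib cong: if_cong)
  then show ?thesis using fin by simp
qed

definition torus_wrap :: "real^'n \<Rightarrow> real^'n" where
  "torus_wrap y = y - torus_shift (torus_index y)"

lemma torus_index_wrap: "torus_index (torus_wrap y) = 0"
  using torus_index_shift[of y "- torus_index y"] by (simp add: torus_wrap_def torus_shift_minus)

lemma torus_periodic_wrap: "torus_periodic (\<lambda>y. f (torus_wrap y))"
proof -
  have "torus_wrap (y + torus_shift k) = torus_wrap y" for y :: "real^'n" and k
    unfolding torus_wrap_def torus_index_shift by (simp add: torus_shift_def vec_eq_iff algebra_simps)
  moreover have "(2 * pi) *\<^sub>R axis i 1 = (torus_shift (axis i 1) :: real^'n)" for i
    by (simp add: torus_shift_def vec_eq_iff axis_def)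
  ultimately show ?thesis unfolding torus_periodic_def by metis
qed

lemma torus_wrap_eq: "torus_index y = 0 \<Longrightarrow> torus_wrap y = y"
  by (simp add: torus_wrap_def torus_shift_def vec_eq_iff)

lemma measurable_torus_wrap [measurable]: "torus_wrap \<in> borel_measurable borel"
proof -
  have "torus_shift \<in> count_space UNIV \<rightarrow>\<^sub>M borel" by simp
  then show ?thesis unfolding torus_wrap_def by measurable
qed

lemma AE_torus_cell_index: "AE y in lebesgue. (y :: real^'n) \<in> torus_cell \<longleftrightarrow> torus_index y = 0"
proof -
  have "AE y in lborel. y \<notin> frontier (torus_cell :: (real^'n) set)"
    using negligible_frontier_interval(1)[of "\<chi> i::'n. - pi" "\<chi> i. pi"]
    by (intro AE_not_in) (simp add: torus_cell_def frontier_cbox negligible_iff_null_sets null_sets_completion_iff)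
  moreover have "y \<in> torus_cell \<longleftrightarrow> torus_index y = 0" if "y \<notin> frontier torus_cell" for y :: "real^'n"
    using that
    unfolding torus_cell_def frontier_cbox torus_index_eq_0_iff
    by (auto simp: mem_box_cart less_imp_le)
  ultimately show ?thesis unfolding AE_completion_iff by (auto elim: eventually_mono)
qed

text \<open>Fubini for Lebesgue measure times counting measure on the lattice: \<phi> distributes
  \<open>h\<close> over the cells, and \<psi> is the same family with each cell translated to the
  base cell, so the integrals over \<open>y\<close> agree for each \<open>k\<close>. The Borel
  function \<open>H\<close> stands in for the lattice sum, which is identified with it only almost
  everywhere.\<close>

lemma integral_torus_unfold:
  fixes h :: "real^'n \<Rightarrow> real"
  assumes h: "integrable lborel h"
  shows "\<exists>H\<in>borel_measurable borel. (LINT y|lborel. h y) = (LINT y|lborel. H y) \<and>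
    (AE y in lborel. H y = indicator {y. torus_index y = 0} y * (\<Sum>\<^sub>\<infinity>k. h (y + torus_shift k)))"
proof -
  let ?N = "count_space (UNIV :: (int^'n) set)"
  interpret N: sigma_finite_measure ?N by (intro sigma_finite_measure_count_space_countable countableI_type)
  interpret P: pair_sigma_finite "lborel :: (real^'n) measure" ?N ..
  interpret Q: pair_sigma_finite ?N "lborel :: (real^'n) measure" ..
  note [measurable] = borel_measurable_integrable[OF h]
  have [measurable]: "torus_shift \<in> ?N \<rightarrow>\<^sub>M borel" by simp
  define \<phi> where "\<phi> y k = indicator {k} (torus_index y) * h y" for y k
  define \<psi> where "\<psi> y k = indicator {0} (torus_index y) * h (y + torus_shift k)" for y k
  have \<psi>\<phi>: "\<psi> y k = \<phi> (torus_shift k + y) k" for y k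
    by (simp add: \<psi>_def \<phi>_def add.commute torus_index_shift indicator_def)
  have ind: "(\<lambda>(y, k). indicator {k} (torus_index y) :: real) \<in> borel_measurable (lborel \<Otimes>\<^sub>M ?N)"
    unfolding indicator_def by measurable
  have [measurable]: "case_prod \<phi> \<in> borel_measurable (lborel \<Otimes>\<^sub>M ?N)"
    unfolding \<phi>_def using ind by measurable
  have [measurable]: "case_prod \<psi> \<in> borel_measurable (lborel \<Otimes>\<^sub>M ?N)" unfolding \<psi>_def by measurable
  have pt: "has_bochner_integral ?N (\<lambda>k. indicator {k} m * c) c" for m and c :: real
  proof -
    have "has_bochner_integral ?N (\<lambda>k. indicator {m} k *\<^sub>R c) (measure ?N {m} *\<^sub>R c)"
      by (intro has_bochner_integral_scaleR_left has_bochner_integral_real_indicator) auto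
    moreover have "indicator {m} k = (indicator {k} m :: real)" for k by (simp add: indicator_def)
    ultimately show ?thesis by simp
  qed
  have \<phi>1: "integrable ?N (\<phi> y)" "(LINT k|?N. \<phi> y k) = h y" "(LINT k|?N. norm (\<phi> y k)) = \<bar>h y\<bar>" for y
    using pt[of "torus_index y" "h y"] pt[of "torus_index y" "\<bar>h y\<bar>"]
    by (simp_all add: \<phi>_def[abs_def] has_bochner_integral_iff abs_mult)
  have \<phi>int: "integrable (lborel \<Otimes>\<^sub>M ?N) (case_prod \<phi>)"
    by (rule P.Fubini_integrable) (use h in \<open>auto simp: \<phi>1 simp del: real_norm_def\<close>)
  have \<phi>int_norm: "integrable (lborel \<Otimes>\<^sub>M ?N) (\<lambda>(y, k). norm (\<phi> y k))"
    using integrable_norm[OF \<phi>int] by (simp add: case_prod_beta')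
  have shift: "(LINT y|lborel. g (torus_shift k + y)) = (LINT y|lborel. g y)" for g :: "real^'n \<Rightarrow> real" and k
    using lborel_integral_affine[of 1 g "torus_shift k"] by simp
  have \<psi>int: "integrable (?N \<Otimes>\<^sub>M lborel) (\<lambda>(k, y). \<psi> y k)"
  proof (rule Q.Fubini_integrable)
    have "(LINT y|lborel. norm (\<psi> y k)) = (LINT y|lborel. norm (\<phi> y k))" for k
      unfolding \<psi>\<phi> by (rule shift)
    then show "integrable ?N (\<lambda>k. LINT y|lborel. norm (case (k, y) of (k, y) \<Rightarrow> \<psi> y k))"
      using P.integrable_snd[OF \<phi>int_norm] by simp
    have "AE k in ?N. integrable lborel (\<lambda>y. \<phi> y k)"
      using P.AE_integrable_snd[OF \<phi>int] .
    moreover have "integrable lborel (\<lambda>y. \<psi> y k)" if "integrable lborel (\<lambda>y. \<phi> y k)" for k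
    proof -
      have "integrable lborel (\<lambda>y. \<phi> (torus_shift k + 1 *\<^sub>R y) k)"
        using that by (intro lborel_integrable_affine) auto
      then show ?thesis by (simp add: \<psi>\<phi>)
    qed
    ultimately show "AE k in ?N. integrable lborel (\<lambda>y. case (k, y) of (k, y) \<Rightarrow> \<psi> y k)"
      by auto
  qed measurable
  have \<psi>int': "integrable (lborel \<Otimes>\<^sub>M ?N) (case_prod \<psi>)"
    using Q.integrable_product_swap[OF \<psi>int] by (simp add: case_prod_beta')
  have \<psi>0: "(LINT y|lborel. \<psi> y k) = (LINT y|lborel. \<phi> y k)" for k
    unfolding \<psi>\<phi> by (rule shift)
  define H where "H y = (LINT k|?N. \<psi> y k)" for y
  have "(LINT y|lborel. h y) = (LINT y|lborel. LINT k|?N. \<phi> y k)" by (simp add: \<phi>1)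
  also have "\<dots> = (LINT k|?N. LINT y|lborel. \<phi> y k)" using P.Fubini_integral[OF \<phi>int] by simp
  also have "\<dots> = (LINT k|?N. LINT y|lborel. \<psi> y k)" using \<psi>0 by simp
  also have "\<dots> = (LINT y|lborel. H y)" using P.Fubini_integral[OF \<psi>int'] by (simp add: H_def)
  finally have eq: "(LINT y|lborel. h y) = (LINT y|lborel. H y)" .
  \<comment> \<open>Fubini gives absolute summability over the lattice for almost every
    \<open>y\<close>, and only there is the integral over counting measure the unordered
    sum.\<close>
  have "AE y in lborel. integrable ?N (\<psi> y)"
    using P.AE_integrable_fst[OF \<psi>int'] .
  then have ae: "AE y in lborel. H y = indicator {y. torus_index y = 0} y * (\<Sum>\<^sub>\<infinity>k. h (y + torus_shift k))"
  proof eventually_elim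
    case (elim y)
    then have "Infinite_Set_Sum.abs_summable_on (\<psi> y) UNIV" by (simp add: abs_summable_on_def)
    then have "H y = (\<Sum>\<^sub>\<infinity>k. \<psi> y k)"
      unfolding H_def infsetsum_def[symmetric] by (rule infsetsum_infsum)
    also have "\<dots> = indicator {0} (torus_index y) * (\<Sum>\<^sub>\<infinity>k. h (y + torus_shift k))"
      unfolding \<psi>_def by (rule infsum_cmult_right')
    finally show ?case by (simp add: indicator_def)
  qed
  have "H \<in> borel_measurable borel"
    by (simp add: H_def[abs_def] N.borel_measurable_lebesgue_integral)
  then show ?thesis using eq ae by blast
qed

lemma borel_measurable_lebesgue_AE_cong:
  fixes f g :: "'a::euclidean_space \<Rightarrow> real"
  assumes g: "g \<in> borel_measurable lebesgue" and ae: "AE x in lebesgue. f x = g x"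
  shows "f \<in> borel_measurable lebesgue"
proof (rule measurableI)
  fix A :: "real set" assume "A \<in> sets borel"
  then have A: "g -` A \<inter> space lebesgue \<in> sets lebesgue" using g by (rule measurable_sets[rotated])
  have "AE x in lebesgue. x \<in> g -` A \<inter> space lebesgue \<longleftrightarrow> x \<in> f -` A \<inter> space lebesgue"
    using ae by eventually_elim auto
  then show "f -` A \<inter> space lebesgue \<in> sets lebesgue"
    by (rule completion.in_sets_AE[OF _ A]) auto
qed simp

lemma integral_lebesgue_AE_borel:
  fixes f g :: "'a::euclidean_space \<Rightarrow> real"
  assumes g: "g \<in> borel_measurable borel" and ae: "AE x in lebesgue. f x = g x"
  shows "(LINT x|lebesgue. f x) = (LINT x|lborel. g x)"
proof -
  have g': "g \<in> borel_measurable lebesgue" using g by (intro measurable_completion) simp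
  have "(LINT x|lebesgue. f x) = (LINT x|lebesgue. g x)"
    using borel_measurable_lebesgue_AE_cong[OF g' ae] g' ae by (intro integral_cong_AE)
  then show ?thesis using g by (simp add: integral_completion)
qed

text \<open>The only place where the periodized kernel is opened. Periodicity of \<open>g\<close>
  moves it under the lattice sum, unfolding turns the cell into the whole space, and scaling by
  \<open>sqrt t\<close> normalizes the Gaussian. Only the class of \<open>f\<close> modulo null sets
  of the cell matters.\<close>

lemma heat_semigroup_eq_gauss_conv:
  fixes f g :: "real^'n \<Rightarrow> real"
  assumes t: "t > 0" and [measurable]: "g \<in> borel_measurable borel" and gC: "\<And>y. \<bar>g y\<bar> \<le> C"
    and per: "torus_periodic g" and ae: "AE y in lebesgue_on torus_cell. f y = g y"
  shows "heat_semigroup t f x = gauss_conv (sqrt t) g x"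
proof -
  define h where "h y = gauss_kernel t (x - y) * g y" for y
  have "integrable lborel (\<lambda>z. gauss_kernel t z * g (x - z))"
    using gC by (intro integrable_gauss_kernel_mult[OF t, where C = C]) auto
  then have "integrable lborel (\<lambda>y. gauss_kernel t (x + (-1) *\<^sub>R y) * g (x - (x + (-1) *\<^sub>R y)))"
    by (intro lborel_integrable_affine[where f = "\<lambda>z. gauss_kernel t z * g (x - z)"]) auto
  then have h: "integrable lborel h" by (simp add: h_def[abs_def])
  then obtain H where [measurable]: "H \<in> borel_measurable borel"
    and Hint: "(LINT y|lborel. h y) = (LINT y|lborel. H y)"
    and H: "AE y in lborel. H y = indicator {y. torus_index y = 0} y * (\<Sum>\<^sub>\<infinity>k. h (y + torus_shift k))"
    using integral_torus_unfold[OF h] by blast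
  have kernel: "torus_heat_kernel t (x - y) * g y = (\<Sum>\<^sub>\<infinity>k. h (y + torus_shift k))" for y
  proof -
    have "torus_heat_kernel t (x - y) = (\<Sum>\<^sub>\<infinity>k. gauss_kernel t (x - y + torus_shift k))"
      by (simp add: torus_heat_kernel_def torus_shift_def)
    \<comment> \<open>Reflecting the lattice moves the translation from \<open>x\<close> to
      \<open>y\<close>, where \<open>g\<close> can absorb it.\<close>
    also have "\<dots> = (\<Sum>\<^sub>\<infinity>k. gauss_kernel t (x - y + torus_shift (- k)))"
      by (intro infsum_reindex_bij_betw[symmetric, of uminus]) (rule bij_uminus)
    also have "\<dots> = (\<Sum>\<^sub>\<infinity>k. gauss_kernel t (x - (y + torus_shift k)))"
      by (simp add: torus_shift_minus algebra_simps)
    finally have "torus_heat_kernel t (x - y) * g y = (\<Sum>\<^sub>\<infinity>k. gauss_kernel t (x - (y + torus_shift k)) * g y)"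
      by (simp add: infsum_cmult_left')
    then show ?thesis unfolding h_def torus_periodic_shift[OF per] .
  qed
  have cell: "torus_cell \<inter> space (lebesgue :: (real^'n) measure) \<in> sets lebesgue" by (simp add: torus_cell_def)
  have ae': "AE y in lebesgue. indicator torus_cell y *\<^sub>R (torus_heat_kernel t (x - y) * f y) = H y"
    using ae[unfolded AE_restrict_space_iff[OF cell]] AE_torus_cell_index AE_completion[OF H]
    by eventually_elim (auto simp: indicator_def kernel)
  have "heat_semigroup t f x = (LINT y|lebesgue. indicator torus_cell y *\<^sub>R (torus_heat_kernel t (x - y) * f y))"
    using t by (simp add: heat_semigroup_def set_lebesgue_integral_def)
  also have "\<dots> = (LINT y|lborel. h y)"
    unfolding Hint by (rule integral_lebesgue_AE_borel[OF _ ae']) measurable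
  also have "\<dots> = sqrt t ^ CARD('n) * (LINT z|lborel. h (x + (- sqrt t) *\<^sub>R z))"
    using t lborel_integral_affine[of "- sqrt t" h x] by simp
  also have "\<dots> = (LINT z|lborel. sqrt t ^ CARD('n) * h (x - sqrt t *\<^sub>R z))" by simp
  also have "\<dots> = gauss_conv (sqrt t) g x"
    unfolding gauss_conv_def
  proof (intro Bochner_Integration.integral_cong refl)
    fix z :: "real^'n"
    have "sqrt t ^ CARD('n) = t powr (real CARD('n) / 2)"
      using t by (simp add: powr_realpow[symmetric] powr_half_sqrt[symmetric] powr_powr)
    then have "sqrt t ^ CARD('n) * gauss_kernel t (sqrt t *\<^sub>R z) = gauss_kernel 1 z"
      using t by (simp add: gauss_kernel_def power_mult_distrib powr_mult powr_minus field_simps)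
    then show "sqrt t ^ CARD('n) * h (x - sqrt t *\<^sub>R z) = gauss_kernel 1 z * g (x - sqrt t *\<^sub>R z)"
      by (simp add: h_def)
  qed
  finally show ?thesis .
qed

section \<open>The Duhamel integral\<close>

abbreviation joint_borel :: "('a::topological_space \<Rightarrow> 'b::topological_space \<Rightarrow> 'c::topological_space) \<Rightarrow> bool" where
  "joint_borel f \<equiv> case_prod f \<in> borel_measurable (borel \<Otimes>\<^sub>M borel)"

section \<open>Integrals over time intervals\<close>

lemma set_integral_norm_bound_AE:
  fixes f :: "'a \<Rightarrow> 'b::{banach, second_countable_topology}"
  assumes b: "set_integrable M A b" and ae: "AE s in M. s \<in> A \<longrightarrow> norm (f s) \<le> b s"
  shows "norm (LINT s:A|M. f s) \<le> (LINT s:A|M. b s)"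
proof (cases "set_integrable M A f")
  case True
  have "norm (LINT s:A|M. f s) \<le> (LINT s|M. norm (indicator A s *\<^sub>R f s))"
    unfolding set_lebesgue_integral_def by (rule integral_norm_bound)
  also have "\<dots> \<le> (LINT s|M. indicator A s *\<^sub>R b s)"
    using True b unfolding set_integrable_def
    by (intro integral_mono_AE integrable_norm) (use ae in \<open>auto elim!: eventually_mono simp: indicator_def\<close>)
  finally show ?thesis unfolding set_lebesgue_integral_def .
next
  case False
  \<comment> \<open>The left side is 0 by default in this case, and \<open>b\<close> dominates a
    norm almost everywhere on \<open>A\<close>, so the right side is nonnegative.\<close>
  have "0 \<le> (LINT s|M. indicator A s *\<^sub>R b s)"
  proof (rule integral_nonneg_AE)
    show "AE s in M. 0 \<le> indicator A s *\<^sub>R b s"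
      using ae by eventually_elim (auto simp: indicator_def intro: order_trans[OF norm_ge_zero])
  qed
  moreover have "(LINT s:A|M. f s) = 0"
    using False unfolding set_integrable_def set_lebesgue_integral_def by (rule not_integrable_integral_eq)
  ultimately show ?thesis unfolding set_lebesgue_integral_def by simp
qed

lemma set_integrable_Icc_bounded:
  fixes f :: "real \<Rightarrow> 'b::{banach, second_countable_topology}"
  assumes [measurable]: "f \<in> borel_measurable borel" and f: "\<And>s. s \<in> {a..b} \<Longrightarrow> norm (f s) \<le> C"
  shows "set_integrable lborel {a..b} f"
proof (rule set_integrable_bound)
  show "set_integrable lborel {a..b} (\<lambda>_. C)"
    unfolding set_integrable_def
    by (intro integrable_scaleR_left) (simp add: integrable_indicator_iff emeasure_lborel_Icc_eq)
  show "set_borel_measurable lborel {a..b} f" unfolding set_borel_measurable_def by measurable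
  have "norm (f s) \<le> norm C" if "s \<in> {a..b}" for s
    using f[OF that] by simp
  then show "AE s in lborel. s \<in> {a..b} \<longrightarrow> norm (f s) \<le> norm C" by simp
qed

lemma set_integral_power:
  fixes t :: real
  assumes "0 \<le> t"
  shows "(LINT s:{0..t}|lborel. s ^ n) = t ^ Suc n / Suc n"
  using integral_power[OF assms, of n] by (simp add: set_lebesgue_integral_def mult.commute)

lemma set_integral_exp:
  fixes r t :: real
  assumes "r \<le> t"
  shows "(LINT s:{r..t}|lborel. exp (s - c)) = exp (t - c) - exp (r - c)"
proof -
  have "(LINT s|lborel. exp (s - c) * indicator {r..t} s) = exp (t - c) - exp (r - c)"
    by (rule integral_FTC_Icc_real[OF assms]) (auto intro!: derivative_eq_intros continuous_intros)
  then show ?thesis by (simp add: set_lebesgue_integral_def mult.commute)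
qed

lemma set_integral_exp_minus:
  fixes r t :: real
  assumes "r \<le> t"
  shows "(LINT s:{r..t}|lborel. exp (c - s)) = exp (c - r) - exp (c - t)"
proof -
  have "(LINT s|lborel. exp (c - s) * indicator {r..t} s) = - exp (c - t) - (- exp (c - r))"
    by (rule integral_FTC_Icc_real[OF assms]) (auto intro!: derivative_eq_intros continuous_intros)
  then show ?thesis by (simp add: set_lebesgue_integral_def mult.commute)
qed

text \<open>Fubini on the triangle \<open>0 \<le> r \<le> s \<le> t\<close>, where the exponential
  integrates over \<open>s\<close> to \<open>1 - exp (- (t - r))\<close>. This is the computation
  that removes the damping in \<open>damped_limit_duhamel\<close>.\<close>

lemma set_integral_triangle_exp:
  fixes A :: "real \<Rightarrow> real"
  assumes [measurable]: "A \<in> borel_measurable borel" and A: "\<And>r. r \<in> {0..t} \<Longrightarrow> \<bar>A r\<bar> \<le> C"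
  shows "(LINT s:{0..t}|lborel. (LINT r:{0..s}|lborel. exp (- (s - r)) * A r))
       = (LINT r:{0..t}|lborel. (1 - exp (- (t - r))) * A r)"
proof -
  define h where "h s r = (if 0 \<le> r \<and> r \<le> s \<and> s \<le> t then exp (- (s - r)) * A r else 0)" for s r
  have [measurable]: "joint_borel h" unfolding h_def by measurable
  have ind: "integrable lborel (indicator {0..t} :: real \<Rightarrow> real)"
    by (simp add: integrable_indicator_iff emeasure_lborel_Icc_eq)
  have int: "integrable (lborel \<Otimes>\<^sub>M lborel) (case_prod h)"
  proof (rule Bochner_Integration.integrable_bound)
    show "integrable (lborel \<Otimes>\<^sub>M lborel) (\<lambda>(s, r). (indicator {0..t} s * C) * indicator {0..t} r :: real)"
      by (intro integrable_product_fun integrable_mult_left ind) (auto intro: lborel.sigma_finite_measure_axioms)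
    have "norm (h s r) \<le> norm ((indicator {0..t} s * C) * indicator {0..t} r :: real)" for s r
    proof (cases "0 \<le> r \<and> r \<le> s \<and> s \<le> t")
      case True
      then have "exp (- (s - r)) * \<bar>A r\<bar> \<le> 1 * C" using A[of r] by (intro mult_mono) auto
      then show ?thesis using True by (simp add: h_def abs_mult)
    next
      case False
      then have "h s r = 0" unfolding h_def by (rule if_not_P)
      then show ?thesis by simp
    qed
    then show "AE w in lborel \<Otimes>\<^sub>M lborel. norm (case_prod h w)
        \<le> norm (case w of (s, r) \<Rightarrow> (indicator {0..t} s * C) * indicator {0..t} r)"
      by (auto split: prod.split)
  qed measurable
  have "(LINT s:{0..t}|lborel. (LINT r:{0..s}|lborel. exp (- (s - r)) * A r)) = (LINT s|lborel. LINT r|lborel. h s r)"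
    unfolding set_lebesgue_integral_def
  proof (intro Bochner_Integration.integral_cong refl)
    fix s :: real
    show "indicator {0..t} s *\<^sub>R (LINT r|lborel. indicator {0..s} r *\<^sub>R (exp (- (s - r)) * A r)) = (LINT r|lborel. h s r)"
    proof (cases "s \<in> {0..t}")
      case True
      then show ?thesis
        by (simp, intro Bochner_Integration.integral_cong) (auto simp: h_def indicator_def)
    next
      case False
      then have "h s = (\<lambda>_. 0)" by (auto simp: h_def fun_eq_iff)
      then show ?thesis using False by simp
    qed
  qed
  also have "\<dots> = (LINT r|lborel. LINT s|lborel. h s r)"
    using lborel_pair.Fubini_integral[OF int] by simp
  also have "\<dots> = (LINT r:{0..t}|lborel. (1 - exp (- (t - r))) * A r)"
    unfolding set_lebesgue_integral_def
  proof (intro Bochner_Integration.integral_cong refl)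
    fix r :: real
    show "(LINT s|lborel. h s r) = indicator {0..t} r *\<^sub>R ((1 - exp (- (t - r))) * A r)"
    proof (cases "r \<in> {0..t}")
      case True
      have "h s r = A r * (indicator {r..t} s *\<^sub>R exp (r - s))" for s
        using True by (auto simp: h_def indicator_def)
      then have "(LINT s|lborel. h s r) = A r * (LINT s:{r..t}|lborel. exp (r - s))"
        by (simp add: set_lebesgue_integral_def)
      then show ?thesis using True by (simp add: set_integral_exp_minus)
    next
      case False
      then have "(\<lambda>s. h s r) = (\<lambda>_. 0)" by (auto simp: h_def fun_eq_iff)
      then show ?thesis using False by simp
    qed
  qed
  finally show ?thesis .
qed

section \<open>Linearity of the convolution, the heat flow and Duhamel operators\<close>

lemma gauss_conv_diff:
  fixes f g :: "real^'n \<Rightarrow> real"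
  assumes "f \<in> borel_measurable borel" "\<And>y. \<bar>f y\<bar> \<le> C" "g \<in> borel_measurable borel" "\<And>y. \<bar>g y\<bar> \<le> D"
  shows "gauss_conv c (\<lambda>y. f y - g y) x = gauss_conv c f x - gauss_conv c g x"
  using integrable_gauss_conv[OF assms(1,2)] integrable_gauss_conv[OF assms(3,4)]
  by (simp add: gauss_conv_def right_diff_distrib)

lemma gauss_conv_add:
  fixes f g :: "real^'n \<Rightarrow> real"
  assumes "f \<in> borel_measurable borel" "\<And>y. \<bar>f y\<bar> \<le> C" "g \<in> borel_measurable borel" "\<And>y. \<bar>g y\<bar> \<le> D"
  shows "gauss_conv c (\<lambda>y. f y + g y) x = gauss_conv c f x + gauss_conv c g x"
  using integrable_gauss_conv[OF assms(1,2)] integrable_gauss_conv[OF assms(3,4)]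
  by (simp add: gauss_conv_def distrib_left)

lemma gauss_conv_cmult: "gauss_conv c (\<lambda>y. a * f y) x = a * gauss_conv c f x"
  by (simp add: gauss_conv_def mult.left_commute)

definition heat :: "real \<Rightarrow> real \<Rightarrow> (real^'n \<Rightarrow> real) \<Rightarrow> real^'n \<Rightarrow> real" where
  "heat \<kappa> t f = gauss_conv (\<kappa> * sqrt t) f"

text \<open>The weight \<open>w\<close> lets the damped equation, with \<open>exp (- r)\<close>, and
  the undamped one, with 1, share the same estimates.\<close>

definition duhamel :: "real \<Rightarrow> (real \<Rightarrow> real) \<Rightarrow> (real \<Rightarrow> real^'n \<Rightarrow> real) \<Rightarrow> real \<Rightarrow> real^'n \<Rightarrow> real" where
  "duhamel \<kappa> w G t x = (LINT s:{0..t}|lborel. w (t - s) * heat \<kappa> (t - s) (G s) x)"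

abbreviation damped_duhamel :: "real \<Rightarrow> (real \<Rightarrow> real^'n \<Rightarrow> real) \<Rightarrow> real \<Rightarrow> real^'n \<Rightarrow> real" where
  "damped_duhamel \<kappa> v \<equiv> duhamel \<kappa> (\<lambda>r. exp (- r)) (\<lambda>s y. v s y + sin (v s y))"

abbreviation sine_duhamel :: "real \<Rightarrow> (real \<Rightarrow> real^'n \<Rightarrow> real) \<Rightarrow> real \<Rightarrow> real^'n \<Rightarrow> real" where
  "sine_duhamel \<kappa> v \<equiv> duhamel \<kappa> (\<lambda>_. 1) (\<lambda>s y. sin (v s y))"

lemma heat_0 [simp]: "heat \<kappa> 0 f = f"
  by (simp add: heat_def fun_eq_iff)

lemma heat_bound: "(\<And>y. \<bar>f y\<bar> \<le> C) \<Longrightarrow> \<bar>heat \<kappa> t f x\<bar> \<le> C"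
  unfolding heat_def by (rule gauss_conv_bound)

lemma borel_measurable_heat [measurable (raw)]:
  assumes [measurable]: "t \<in> borel_measurable M" "x \<in> borel_measurable M"
    "case_prod f \<in> borel_measurable (M \<Otimes>\<^sub>M borel)"
  shows "(\<lambda>q. heat \<kappa> (t q) (f q) (x q :: real^'n)) \<in> borel_measurable M"
  unfolding heat_def by measurable

lemma heat_heat:
  fixes f :: "real^'n \<Rightarrow> real"
  assumes "f \<in> borel_measurable borel" "\<And>y. \<bar>f y\<bar> \<le> C" "\<kappa> \<ge> 0" "s \<ge> 0" "t \<ge> 0"
  shows "heat \<kappa> s (heat \<kappa> t f) x = heat \<kappa> (s + t) f x"
proof -
  have "sqrt ((\<kappa> * sqrt s)\<^sup>2 + (\<kappa> * sqrt t)\<^sup>2) = \<kappa> * sqrt (s + t)"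
    using assms by (simp add: power_mult_distrib real_sqrt_mult flip: distrib_left)
  then show ?thesis
    unfolding heat_def using gauss_conv_gauss_conv[OF assms(1,2), of "\<kappa> * sqrt s" "\<kappa> * sqrt t" x] assms by simp
qed

lemma borel_measurable_duhamel [measurable (raw)]:
  assumes [measurable]: "joint_borel G" "w \<in> borel_measurable borel"
  shows "(\<lambda>(t, x :: real^'n). duhamel \<kappa> w G t x) \<in> borel_measurable (borel \<Otimes>\<^sub>M borel)"
proof -
  have "(\<lambda>q. if 0 \<le> snd q \<and> snd q \<le> fst (fst q)
      then w (fst (fst q) - snd q) * heat \<kappa> (fst (fst q) - snd q) (G (snd q)) (snd (fst q)) else 0)
      \<in> borel_measurable ((borel \<Otimes>\<^sub>M (borel :: (real^'n) measure)) \<Otimes>\<^sub>M lborel)"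
    by measurable
  then have "(\<lambda>(t, x). LINT s|lborel. (if 0 \<le> s \<and> s \<le> t then w (t - s) * heat \<kappa> (t - s) (G s) x else 0))
      \<in> borel_measurable (borel \<Otimes>\<^sub>M (borel :: (real^'n) measure))"
    by (simp add: case_prod_beta' lborel.borel_measurable_lebesgue_integral)
  moreover have "duhamel \<kappa> w G t x = (LINT s|lborel. (if 0 \<le> s \<and> s \<le> t then w (t - s) * heat \<kappa> (t - s) (G s) x else 0))" for t x
    unfolding duhamel_def set_lebesgue_integral_def
    by (intro Bochner_Integration.integral_cong) (auto simp: indicator_def)
  ultimately show ?thesis by simp
qed

context
  fixes G :: "real \<Rightarrow> real^'n \<Rightarrow> real" and w :: "real \<Rightarrow> real" and C T :: real and \<kappa> :: real
  assumes G_meas [measurable]: "joint_borel G"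
    and G: "\<And>s y. 0 \<le> s \<Longrightarrow> s \<le> T \<Longrightarrow> \<bar>G s y\<bar> \<le> C"
    and w_meas [measurable]: "w \<in> borel_measurable borel"
    and w: "\<And>s. 0 \<le> s \<Longrightarrow> 0 \<le> w s \<and> w s \<le> 1"
begin

lemma duhamel_integrand_bound:
  assumes "t \<le> T" "s \<in> {0..t}"
  shows "\<bar>w (t - s) * heat \<kappa> r (G s) x\<bar> \<le> C"
proof -
  have "\<bar>heat \<kappa> r (G s) x\<bar> \<le> C" using assms G by (intro heat_bound) auto
  then have "w (t - s) * \<bar>heat \<kappa> r (G s) x\<bar> \<le> 1 * C"
    using w[of "t - s"] assms by (intro mult_mono) auto
  then show ?thesis using w[of "t - s"] assms by (simp add: abs_mult)
qed

lemma duhamel_integrable: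
  assumes "t \<le> T"
  shows "set_integrable lborel {0..t} (\<lambda>s. w (t - s) * heat \<kappa> (t + \<tau> - s) (G s) x)"
  by (rule set_integrable_Icc_bounded[where C = C])
     (use duhamel_integrand_bound[OF assms] in \<open>measurable, auto\<close>)

text \<open>Fubini and the semigroup law. Only the heat factor ages by \<tau>; the weight keeps the
  argument \<open>t - s\<close>. This serves both to remove the damping and to restart the solution
  at a later time.\<close>

lemma heat_duhamel:
  assumes "\<kappa> \<ge> 0" "\<tau> \<ge> 0" "t \<le> T"
  shows "heat \<kappa> \<tau> (duhamel \<kappa> w G t) x = (LINT s:{0..t}|lborel. w (t - s) * heat \<kappa> (t + \<tau> - s) (G s) x)"
proof -
  have "heat \<kappa> \<tau> (duhamel \<kappa> w G t) x
      = (LINT s:{0..t}|lborel. heat \<kappa> \<tau> (\<lambda>y. w (t - s) * heat \<kappa> (t - s) (G s) y) x)"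
    unfolding heat_def[of \<kappa> \<tau>] duhamel_def[abs_def]
    by (rule gauss_conv_set_integral[where C = C], measurable)
       (use duhamel_integrand_bound[OF assms(3)] in auto)
  also have "\<dots> = (LINT s:{0..t}|lborel. w (t - s) * heat \<kappa> (t + \<tau> - s) (G s) x)"
  proof (rule set_lebesgue_integral_cong)
    show "\<forall>s. s \<in> {0..t} \<longrightarrow> heat \<kappa> \<tau> (\<lambda>y. w (t - s) * heat \<kappa> (t - s) (G s) y) x = w (t - s) * heat \<kappa> (t + \<tau> - s) (G s) x"
    proof (intro allI impI)
      fix s assume s: "s \<in> {0..t}"
      have "heat \<kappa> \<tau> (heat \<kappa> (t - s) (G s)) x = heat \<kappa> (\<tau> + (t - s)) (G s) x"
        using s G assms by (intro heat_heat[where C = C]) auto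
      moreover have "heat \<kappa> \<tau> (\<lambda>y. w (t - s) * heat \<kappa> (t - s) (G s) y) x = w (t - s) * heat \<kappa> \<tau> (heat \<kappa> (t - s) (G s)) x"
        unfolding heat_def[of \<kappa> \<tau>] by (rule gauss_conv_cmult)
      ultimately show "heat \<kappa> \<tau> (\<lambda>y. w (t - s) * heat \<kappa> (t - s) (G s) y) x = w (t - s) * heat \<kappa> (t + \<tau> - s) (G s) x"
        by (simp add: algebra_simps)
    qed
  qed simp
  finally show ?thesis .
qed

lemma duhamel_diff_bound:
  assumes [measurable]: "joint_borel H"
    and H: "\<And>s y. 0 \<le> s \<Longrightarrow> s \<le> T \<Longrightarrow> \<bar>H s y\<bar> \<le> D"
    and b: "set_integrable lborel {0..t} b" "\<And>s y. s \<in> {0..t} \<Longrightarrow> \<bar>G s y - H s y\<bar> \<le> b s"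
    and t: "t \<le> T"
  shows "\<bar>duhamel \<kappa> w G t x - duhamel \<kappa> w H t x\<bar> \<le> (LINT s:{0..t}|lborel. b s)"
proof -
  have intH: "set_integrable lborel {0..t} (\<lambda>s. w (t - s) * heat \<kappa> (t - s) (H s) x)"
  proof (rule set_integrable_Icc_bounded[where C = D])
    fix s assume s: "s \<in> {0..t}"
    have "\<bar>heat \<kappa> (t - s) (H s) x\<bar> \<le> D" using s t H by (intro heat_bound) auto
    then have "w (t - s) * \<bar>heat \<kappa> (t - s) (H s) x\<bar> \<le> 1 * D"
      using w[of "t - s"] s by (intro mult_mono) auto
    then show "norm (w (t - s) * heat \<kappa> (t - s) (H s) x) \<le> D" using w[of "t - s"] s by (simp add: abs_mult)
  qed measurable
  have intG: "set_integrable lborel {0..t} (\<lambda>s. w (t - s) * heat \<kappa> (t - s) (G s) x)"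
    using duhamel_integrable[OF t, of 0] by simp
  have "duhamel \<kappa> w G t x - duhamel \<kappa> w H t x
      = (LINT s:{0..t}|lborel. w (t - s) * heat \<kappa> (t - s) (G s) x - w (t - s) * heat \<kappa> (t - s) (H s) x)"
    unfolding duhamel_def using intG intH by simp
  moreover have "norm (LINT s:{0..t}|lborel. w (t - s) * heat \<kappa> (t - s) (G s) x - w (t - s) * heat \<kappa> (t - s) (H s) x)
      \<le> (LINT s:{0..t}|lborel. b s)"
  proof (rule set_integral_norm_bound_AE[OF b(1)], intro AE_I2 impI)
    fix s assume s: "s \<in> {0..t}"
    have [measurable]: "H s \<in> borel_measurable borel" by measurable
    have "heat \<kappa> (t - s) (\<lambda>y. G s y - H s y) x = heat \<kappa> (t - s) (G s) x - heat \<kappa> (t - s) (H s) x"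
      unfolding heat_def using s t G H by (intro gauss_conv_diff[where C = C and D = D]) auto
    moreover have "\<bar>heat \<kappa> (t - s) (\<lambda>y. G s y - H s y) x\<bar> \<le> b s"
      using b(2)[OF s] by (rule heat_bound)
    ultimately have "w (t - s) * \<bar>heat \<kappa> (t - s) (G s) x - heat \<kappa> (t - s) (H s) x\<bar> \<le> 1 * b s"
      using w[of "t - s"] s by (intro mult_mono) auto
    then show "norm (w (t - s) * heat \<kappa> (t - s) (G s) x - w (t - s) * heat \<kappa> (t - s) (H s) x) \<le> b s"
      using w[of "t - s"] s by (simp add: abs_mult flip: right_diff_distrib)
  qed
  ultimately show ?thesis by simp
qed

end

section \<open>Damped Picard iteration\<close>

lemma borel_measurable_duhamel_slice:
  fixes G :: "real \<Rightarrow> real^'n \<Rightarrow> real"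
  assumes "joint_borel G" "w \<in> borel_measurable borel"
  shows "duhamel \<kappa> w G t \<in> borel_measurable borel"
proof -
  have "(\<lambda>y. (t, y)) \<in> (borel :: (real^'n) measure) \<rightarrow>\<^sub>M borel \<Otimes>\<^sub>M borel" by measurable
  from measurable_compose[OF this borel_measurable_duhamel[OF assms, of \<kappa>]] show ?thesis by simp
qed

primrec damped_iterate :: "real \<Rightarrow> (real^'n \<Rightarrow> real) \<Rightarrow> nat \<Rightarrow> real \<Rightarrow> real^'n \<Rightarrow> real" where
  "damped_iterate \<kappa> f 0 = (\<lambda>t x. 0)"
| "damped_iterate \<kappa> f (Suc n) = (\<lambda>t x. exp (- t) * heat \<kappa> t f x
     + damped_duhamel \<kappa> (damped_iterate \<kappa> f n) t x)"

declare damped_iterate.simps(2) [simp del]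

text \<open>For \<open>0 \<le> v \<le> pi\<close> the upper bound is
  \<open>sin (pi - v) \<le> pi - v\<close>, as \<open>sin (pi - v) = sin v\<close>; negative
  \<open>v\<close> follows by oddness. This is where the value \<pi> in the theorem comes
  from.\<close>

lemma abs_add_sin_le_pi:
  fixes v :: real
  assumes "\<bar>v\<bar> \<le> pi"
  shows "\<bar>v + sin v\<bar> \<le> pi"
proof -
  have "v + sin v \<le> pi" if "v \<le> pi" "0 \<le> v" for v :: real
    using sin_x_le_x[of "pi - v"] that by simp
  moreover have "0 \<le> v + sin v" if "v \<le> pi" "0 \<le> v" for v :: real
    using sin_ge_zero[of v] that by simp
  ultimately have "\<bar>v + sin v\<bar> \<le> pi" if "v \<le> pi" "0 \<le> v" for v :: real
    using that by (simp add: abs_le_iff)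
  from this[of v] this[of "- v"] show ?thesis using assms by (cases "v \<ge> 0") (auto simp: abs_le_iff)
qed

lemma abs_sin_diff_le:
  fixes a b :: real
  shows "\<bar>sin a - sin b\<bar> \<le> \<bar>a - b\<bar>"
proof -
  have "sin a - sin b = 2 * sin ((a - b) / 2) * cos ((a + b) / 2)"
    by (rule sin_diff_sin)
  then have "\<bar>sin a - sin b\<bar> = 2 * (\<bar>sin ((a - b) / 2)\<bar> * \<bar>cos ((a + b) / 2)\<bar>)"
    by (simp add: abs_mult)
  also have "\<dots> \<le> 2 * (\<bar>(a - b) / 2\<bar> * 1)"
    by (intro mult_left_mono mult_mono abs_sin_x_le_abs_x abs_cos_le_one) auto
  finally show ?thesis by simp
qed

context
  fixes \<kappa> :: real and f :: "real^'n \<Rightarrow> real"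
  assumes \<kappa>: "\<kappa> \<ge> 0" and f_meas [measurable]: "f \<in> borel_measurable borel" and f: "\<And>x. \<bar>f x\<bar> \<le> pi"
begin

lemma borel_measurable_damped_iterate [measurable]:
  "joint_borel (damped_iterate \<kappa> f n)"
proof (induction n)
  case (Suc n)
  define v where "v = damped_iterate \<kappa> f n"
  have [measurable]: "joint_borel v"
    unfolding v_def by (rule Suc)
  have "joint_borel (\<lambda>s y. v s y + sin (v s y))" by measurable
  then have "(\<lambda>(t, x). damped_duhamel \<kappa> v t x) \<in> borel_measurable (borel \<Otimes>\<^sub>M borel)"
    by (rule borel_measurable_duhamel) measurable
  moreover have "(\<lambda>(t, x). exp (- t) * heat \<kappa> t f x) \<in> borel_measurable (borel \<Otimes>\<^sub>M borel)"
    by measurable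
  ultimately show ?case
    unfolding damped_iterate.simps v_def[symmetric] case_prod_beta' by (rule borel_measurable_add[rotated])
qed simp

text \<open>The data contribute at most \<open>exp (- t) * pi\<close>, and the forcing, bounded by
  \<pi>, at most \<open>(1 - exp (- t)) * pi\<close>. The weights add up to 1, so nothing is
  lost.\<close>

lemma damped_bound:
  fixes v :: "real \<Rightarrow> real^'n \<Rightarrow> real"
  assumes t: "0 \<le> t" and v: "\<And>s y. 0 \<le> s \<Longrightarrow> \<bar>v s y\<bar> \<le> pi"
  shows "\<bar>exp (- t) * heat \<kappa> t f x + damped_duhamel \<kappa> v t x\<bar> \<le> pi"
proof -
  have "\<bar>heat \<kappa> t f x\<bar> \<le> pi" using f by (rule heat_bound)
  then have 1: "\<bar>exp (- t) * heat \<kappa> t f x\<bar> \<le> exp (- t) * pi" by (simp add: abs_mult)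
  have "set_integrable lborel {0..t} (\<lambda>s. exp (s - t) * pi)"
    by (rule set_integrable_Icc_bounded[where C = pi]) (auto simp: mult_le_cancel_right1)
  moreover have "\<bar>exp (- (t - s)) * heat \<kappa> (t - s) (\<lambda>y. v s y + sin (v s y)) x\<bar> \<le> exp (s - t) * pi"
    if "s \<in> {0..t}" for s
  proof -
    have "\<bar>heat \<kappa> (t - s) (\<lambda>y. v s y + sin (v s y)) x\<bar> \<le> pi"
      using v that by (intro heat_bound abs_add_sin_le_pi) auto
    then show ?thesis by (simp add: abs_mult)
  qed
  ultimately have "norm (damped_duhamel \<kappa> v t x) \<le> (LINT s:{0..t}|lborel. exp (s - t) * pi)"
    unfolding duhamel_def by (intro set_integral_norm_bound_AE) auto
  also have "\<dots> = (1 - exp (- t)) * pi"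
    using t set_integral_exp[of 0 t t] by simp
  finally have "\<bar>damped_duhamel \<kappa> v t x\<bar> \<le> (1 - exp (- t)) * pi" by simp
  with 1 have "\<bar>exp (- t) * heat \<kappa> t f x + damped_duhamel \<kappa> v t x\<bar>
      \<le> exp (- t) * pi + (1 - exp (- t)) * pi" by linarith
  then show ?thesis by (simp add: algebra_simps)
qed

lemma damped_iterate_bound: "0 \<le> t \<Longrightarrow> \<bar>damped_iterate \<kappa> f n t x\<bar> \<le> pi"
proof (induction n arbitrary: t x)
  case (Suc n)
  then show ?case unfolding damped_iterate.simps by (intro damped_bound) auto
qed simp

text \<open>The factor 2 is the Lipschitz constant of \<open>v + sin v\<close>.\<close>

lemma damped_contraction:
  fixes v w :: "real \<Rightarrow> real^'n \<Rightarrow> real"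
  assumes [measurable]: "joint_borel v"
    "joint_borel w"
    and vw: "\<And>s y. 0 \<le> s \<Longrightarrow> \<bar>v s y\<bar> \<le> pi" "\<And>s y. 0 \<le> s \<Longrightarrow> \<bar>w s y\<bar> \<le> pi"
    and b: "set_integrable lborel {0..t} b" "\<And>s y. s \<in> {0..t} \<Longrightarrow> \<bar>v s y - w s y\<bar> \<le> b s"
  shows "\<bar>damped_duhamel \<kappa> v t x
     - damped_duhamel \<kappa> w t x\<bar> \<le> 2 * (LINT s:{0..t}|lborel. b s)"
proof -
  have "\<bar>damped_duhamel \<kappa> v t x
     - damped_duhamel \<kappa> w t x\<bar> \<le> (LINT s:{0..t}|lborel. 2 * b s)"
  proof (rule duhamel_diff_bound[where C = pi and D = pi and T = t])
    show "\<bar>v s y + sin (v s y) - (w s y + sin (w s y))\<bar> \<le> 2 * b s" if "s \<in> {0..t}" for s y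
      using b(2)[OF that, of y] abs_sin_diff_le[of "v s y" "w s y"] by linarith
    show "set_integrable lborel {0..t} (\<lambda>s. 2 * b s)" using b(1) by simp
  qed (use vw in \<open>auto intro!: abs_add_sin_le_pi\<close>)
  then show ?thesis by simp
qed

text \<open>The first iterate differs from 0 by at most \<pi>; each further step costs the Lipschitz
  constant 2 and one time integration. The factorial gives convergence on every bounded time
  interval, without a restriction to short times.\<close>

lemma damped_iterate_diff:
  "0 \<le> t \<Longrightarrow> \<bar>damped_iterate \<kappa> f (Suc n) t x - damped_iterate \<kappa> f n t x\<bar> \<le> pi * (2 * t) ^ n / fact n"
proof (induction n arbitrary: t x)
  case 0
  then show ?case using damped_iterate_bound[of t "Suc 0" x] by simp
next
  case (Suc n)
  define b where "b s = pi * 2 ^ n / fact n * s ^ n" for s :: real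
  have intb: "set_integrable lborel {0..t} b"
  proof (rule set_integrable_Icc_bounded[where C = "b t"])
    show "b \<in> borel_measurable borel" unfolding b_def by measurable
    fix s assume s: "s \<in> {0..t}"
    then have "b s \<le> b t" unfolding b_def by (intro mult_left_mono power_mono) auto
    moreover have "0 \<le> b s" using s by (simp add: b_def)
    ultimately show "norm (b s) \<le> b t" by simp
  qed
  have bb: "\<bar>damped_iterate \<kappa> f (Suc n) s y - damped_iterate \<kappa> f n s y\<bar> \<le> b s" if "s \<in> {0..t}" for s y
    using Suc.IH[of s y] that by (simp add: b_def power_mult_distrib mult_ac)
  have "\<bar>damped_duhamel \<kappa> (damped_iterate \<kappa> f (Suc n)) t x
     - damped_duhamel \<kappa> (damped_iterate \<kappa> f n) t x\<bar>
      \<le> 2 * (LINT s:{0..t}|lborel. b s)"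
    by (rule damped_contraction[OF borel_measurable_damped_iterate borel_measurable_damped_iterate
          damped_iterate_bound damped_iterate_bound intb bb])
  moreover have "damped_iterate \<kappa> f (Suc m) t x = exp (- t) * heat \<kappa> t f x
     + damped_duhamel \<kappa> (damped_iterate \<kappa> f m) t x" for m
    by (simp only: damped_iterate.simps(2))
  ultimately have "\<bar>damped_iterate \<kappa> f (Suc (Suc n)) t x - damped_iterate \<kappa> f (Suc n) t x\<bar> \<le> 2 * (LINT s:{0..t}|lborel. b s)"
    by (simp only: add_diff_cancel_left)
  also have "\<dots> = 2 * (pi * 2 ^ n / fact n * (t ^ Suc n / real (Suc n)))"
    unfolding b_def using set_integral_power[OF Suc.prems, of n] by simp
  also have "\<dots> = pi * (2 * t) ^ Suc n / fact (Suc n)"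
    by (simp add: power_mult_distrib field_simps)
  finally show ?case .
qed

section \<open>Limit of the damped iteration and removal of the damping\<close>

definition damped_limit :: "real \<Rightarrow> real^'n \<Rightarrow> real" where
  "damped_limit t x = lim (\<lambda>n. damped_iterate \<kappa> f n t x)"

lemma damped_limit_measurable [measurable]: "joint_borel damped_limit"
proof -
  have "(\<lambda>q. lim (\<lambda>n. case_prod (damped_iterate \<kappa> f n) q)) \<in> borel_measurable (borel \<Otimes>\<^sub>M borel)"
    by (intro borel_measurable_lim_metric borel_measurable_damped_iterate)
  moreover have "case_prod damped_limit = (\<lambda>q. lim (\<lambda>n. case_prod (damped_iterate \<kappa> f n) q))"
    by (auto simp: damped_limit_def fun_eq_iff)
  ultimately show ?thesis by simp
qed

lemma damped_iterate_uniform_limit: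
  assumes T: "0 \<le> T"
  shows "uniform_limit ({0..T} \<times> UNIV) (\<lambda>n (t, x). damped_iterate \<kappa> f n t x) (\<lambda>(t, x). damped_limit t x) sequentially"
proof -
  let ?d = "\<lambda>n (t, x). damped_iterate \<kappa> f (Suc n) t x - damped_iterate \<kappa> f n t x"
  have "uniform_limit ({0..T} \<times> UNIV) (\<lambda>n q. \<Sum>k<n. ?d k q) (\<lambda>q. \<Sum>k. ?d k q) sequentially"
  proof (rule Weierstrass_m_test)
    show "norm (?d n q) \<le> pi * ((2 * T) ^ n / fact n)" if q': "q \<in> {0..T} \<times> UNIV" for n q
    proof -
      obtain t x where q: "q = (t, x)" "0 \<le> t" "t \<le> T" using q' by (cases q) auto
      have "norm (?d n q) \<le> pi * (2 * t) ^ n / fact n"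
        using damped_iterate_diff[OF q(2), of n x] unfolding q(1) real_norm_def by simp
      also have "\<dots> \<le> pi * (2 * T) ^ n / fact n"
        using q by (intro divide_right_mono mult_left_mono power_mono) auto
      finally show ?thesis by simp
    qed
    have "summable (\<lambda>n. (2 * T) ^ n / fact n)"
      using summable_exp[of "2 * T"] by (simp add: divide_inverse mult.commute)
    then show "summable (\<lambda>n. pi * ((2 * T) ^ n / fact n))" by (rule summable_mult)
  qed
  moreover have "(\<Sum>k<n. ?d k q) = (case q of (t, x) \<Rightarrow> damped_iterate \<kappa> f n t x)" for n q
    using sum_lessThan_telescope[of "\<lambda>k. damped_iterate \<kappa> f k (fst q) (snd q)" n]
    by (simp add: case_prod_beta')
  ultimately have ul: "uniform_limit ({0..T} \<times> UNIV) (\<lambda>n (t, x). damped_iterate \<kappa> f n t x) (\<lambda>q. \<Sum>k. ?d k q) sequentially"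
    by simp
  have "(\<Sum>k. ?d k q) = (case q of (t, x) \<Rightarrow> damped_limit t x)" if "q \<in> {0..T} \<times> UNIV" for q
    using tendsto_uniform_limitI[OF ul that] unfolding damped_limit_def
    by (cases q) (simp add: limI)
  then show ?thesis using ul by (simp cong: uniform_limit_cong')
qed

lemma damped_iterate_tendsto:
  assumes t: "0 \<le> t"
  shows "(\<lambda>n. damped_iterate \<kappa> f n t x) \<longlonglongrightarrow> damped_limit t x"
  using tendsto_uniform_limitI[OF damped_iterate_uniform_limit[OF t], of "(t, x)"] t by simp

lemma damped_limit_bound:
  assumes "0 \<le> t"
  shows "\<bar>damped_limit t x\<bar> \<le> pi"
  by (rule LIMSEQ_le_const2[OF tendsto_rabs[OF damped_iterate_tendsto[OF assms]]])
     (use damped_iterate_bound[OF assms] in auto)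

lemma damped_limit_eq:
  assumes t: "0 \<le> t"
  shows "damped_limit t x = exp (- t) * heat \<kappa> t f x
     + damped_duhamel \<kappa> damped_limit t x"
proof (rule LIMSEQ_unique)
  show "(\<lambda>n. damped_iterate \<kappa> f (Suc n) t x) \<longlonglongrightarrow> damped_limit t x"
    using damped_iterate_tendsto[OF t] by (rule LIMSEQ_Suc)
  show "(\<lambda>n. damped_iterate \<kappa> f (Suc n) t x) \<longlonglongrightarrow> exp (- t) * heat \<kappa> t f x
     + damped_duhamel \<kappa> damped_limit t x"
    unfolding damped_iterate.simps
  proof (intro tendsto_add tendsto_const, unfold tendsto_iff, intro allI impI)
    fix e :: real assume e: "e > 0"
    \<comment> \<open>The summand 1 makes \<open>2 * e' * t < e\<close> strict and keeps the
      denominator positive at \<open>t = 0\<close>.\<close>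
    define e' where "e' = e / (2 * t + 1)"
    have "e' > 0" using e t by (simp add: e'_def)
    have "\<forall>\<^sub>F n in sequentially. \<forall>q\<in>{0..t} \<times> UNIV. dist (case q of (s, y) \<Rightarrow> damped_iterate \<kappa> f n s y)
        (case q of (s, y) \<Rightarrow> damped_limit s y) < e'"
      using damped_iterate_uniform_limit[OF t] \<open>e' > 0\<close> unfolding uniform_limit_iff by blast
    then show "\<forall>\<^sub>F n in sequentially.
      dist (damped_duhamel \<kappa> (damped_iterate \<kappa> f n) t x)
        (damped_duhamel \<kappa> damped_limit t x) < e"
    proof eventually_elim
      case (elim n)
      \<comment> \<open>The factor \<open>s ^ 0\<close> writes a constant as a power, so that
        \<open>set_integral_power\<close> evaluates the integral.\<close>
      have "\<bar>damped_duhamel \<kappa> (damped_iterate \<kappa> f n) t x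
        - damped_duhamel \<kappa> damped_limit t x\<bar>
        \<le> 2 * (LINT s:{0..t}|lborel. e' * s ^ 0)"
      proof (rule damped_contraction)
        show "set_integrable lborel {0..t} (\<lambda>s. e' * s ^ 0)"
          by (rule set_integrable_Icc_bounded[where C = "\<bar>e'\<bar>"]) auto
        show "\<bar>damped_iterate \<kappa> f n s y - damped_limit s y\<bar> \<le> e' * s ^ 0" if "s \<in> {0..t}" for s y
          using bspec[OF elim, of "(s, y)"] that by (simp add: dist_real_def)
      qed (auto intro: damped_iterate_bound damped_limit_bound)
      also have "\<dots> = 2 * e' * t"
        unfolding set_integral_mult_right set_integral_power[OF t] by simp
      also have "\<dots> < e' * (2 * t + 1)" using \<open>e' > 0\<close> by (simp add: algebra_simps)
      also have "\<dots> = e" using t by (simp add: e'_def add_nonneg_eq_0_iff)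
      finally show ?case by (simp add: dist_real_def)
    qed
  qed
qed

lemma damped_limit_periodic:
  assumes "\<And>x. f (x + h) = f x" and t: "0 \<le> t"
  shows "damped_limit t (x + h) = damped_limit t x"
proof -
  have gc: "gauss_conv c g (x + h) = gauss_conv c g x" if "\<And>x. g (x + h) = g x" for c and g :: "real^'n \<Rightarrow> real" and x
  proof -
    have "g (x + h - c *\<^sub>R z) = g (x - c *\<^sub>R z)" for z
      using that[of "x - c *\<^sub>R z"] by (simp add: algebra_simps)
    then show ?thesis by (simp add: gauss_conv_def)
  qed
  have "damped_iterate \<kappa> f n t (x + h) = damped_iterate \<kappa> f n t x" for n t x
  proof (induction n arbitrary: t x)
    case (Suc n)
    then show ?case using assms(1) by (simp add: damped_iterate.simps(2) duhamel_def heat_def gc)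
  qed simp
  then show ?thesis by (simp add: damped_limit_def)
qed

text \<open>Since \<open>sin u = ?F - u\<close>, the undamped integral is the integral of
  \<open>A\<close> minus that of \<open>heat \<kappa> (t - s) (?u s) x\<close>. Inserting the damped
  formula for \<open>?u s\<close> and the semigroup law turns the latter integrand into
  \<open>exp (- s) * heat \<kappa> t f x + B s\<close>. Integrating over \<open>s\<close> leaves the
  damped integral minus \<open>(1 - exp (- t)) * heat \<kappa> t f x\<close>, so adding
  \<open>heat \<kappa> t f x\<close> restores the damped formula.\<close>

lemma damped_limit_duhamel:
  assumes t: "0 \<le> t"
  shows "damped_limit t x = heat \<kappa> t f x + sine_duhamel \<kappa> damped_limit t x"
proof -
  let ?u = damped_limit
  let ?F = "\<lambda>s y. ?u s y + sin (?u s y)"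
  define A where "A r = heat \<kappa> (t - r) (?F r) x" for r
  have F: "\<bar>?F s y\<bar> \<le> pi" if "0 \<le> s" for s y
    using damped_limit_bound[OF that] by (rule abs_add_sin_le_pi)
  have [measurable]: "A \<in> borel_measurable borel" unfolding A_def by measurable
  have A: "\<bar>A r\<bar> \<le> pi" if "r \<in> {0..t}" for r
    unfolding A_def using F that by (intro heat_bound) auto
  define B where "B s = (LINT r:{0..s}|lborel. exp (- (s - r)) * A r)" for s
  have u_heat: "heat \<kappa> (t - s) (?u s) x = exp (- s) * heat \<kappa> t f x + B s" if s: "s \<in> {0..t}" for s
  proof -
    let ?D = "duhamel \<kappa> (\<lambda>r. exp (- r)) ?F s"
    have Dm: "(\<lambda>y. ?D y) \<in> borel_measurable borel"
      by (rule borel_measurable_duhamel_slice) measurable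
    have "?u s = (\<lambda>y. exp (- s) * heat \<kappa> s f y + ?D y)"
      using damped_limit_eq[of s] s by auto
    then have "heat \<kappa> (t - s) (?u s) x = heat \<kappa> (t - s) (\<lambda>y. exp (- s) * heat \<kappa> s f y + ?D y) x"
      by simp
    also have "\<dots> = heat \<kappa> (t - s) (\<lambda>y. exp (- s) * heat \<kappa> s f y) x + heat \<kappa> (t - s) ?D x"
    proof -
      have 1: "\<bar>exp (- s) * heat \<kappa> s f y\<bar> \<le> pi" for y
      proof -
        have "exp (- s) * \<bar>heat \<kappa> s f y\<bar> \<le> 1 * pi"
          using s heat_bound[of f pi \<kappa> s y] f by (intro mult_mono) auto
        then show ?thesis by (simp add: abs_mult)
      qed
      have 2: "\<bar>?D y\<bar> \<le> 2 * pi" for y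
        using damped_limit_eq[of s y] damped_limit_bound[of s y] 1[of y] s by simp
      show ?thesis unfolding heat_def[of \<kappa> "t - s"]
        by (rule gauss_conv_add[OF _ 1 Dm 2]) measurable
    qed
    also have "heat \<kappa> (t - s) (\<lambda>y. exp (- s) * heat \<kappa> s f y) x = exp (- s) * heat \<kappa> (t - s) (heat \<kappa> s f) x"
      unfolding heat_def[of \<kappa> "t - s"] by (rule gauss_conv_cmult)
    also have "heat \<kappa> (t - s) (heat \<kappa> s f) x = heat \<kappa> t f x"
      using heat_heat[OF f_meas f \<kappa>, of "t - s" s x] s by simp
    also have "heat \<kappa> (t - s) ?D x = B s"
      unfolding B_def A_def using s F \<kappa>
      by (subst heat_duhamel[where C = pi and T = s]) auto
    finally show ?thesis .
  qed
  have intA: "set_integrable lborel {0..t} A"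
    by (rule set_integrable_Icc_bounded[where C = pi]) (use A in auto)
  have intU: "set_integrable lborel {0..t} (\<lambda>s. heat \<kappa> (t - s) (?u s) x)"
    by (rule set_integrable_Icc_bounded[where C = pi])
       (use damped_limit_bound in \<open>measurable, auto intro!: heat_bound\<close>)
  have intE: "set_integrable lborel {0..t} (\<lambda>s. exp (- s) * heat \<kappa> t f x)"
    by (rule set_integrable_Icc_bounded[where C = "\<bar>heat \<kappa> t f x\<bar>"]) (auto simp: abs_mult mult_le_cancel_right2)
  \<comment> \<open>Integrability of \<open>B\<close> is read off from \<open>u_heat\<close>, which
    exhibits it on the interval as a difference of two integrable functions.\<close>
  have intB: "set_integrable lborel {0..t} B"
    using set_integral_diff(1)[OF intU intE] by (rule set_integrable_cong[THEN iffD1, rotated -1]) (auto simp: u_heat)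
  have intA': "set_integrable lborel {0..t} (\<lambda>r. exp (- (t - r)) * A r)"
  proof (rule set_integrable_Icc_bounded[where C = pi])
    fix r assume r: "r \<in> {0..t}"
    have "exp (- (t - r)) * \<bar>A r\<bar> \<le> 1 * pi" using r A by (intro mult_mono) auto
    then show "norm (exp (- (t - r)) * A r) \<le> pi" by (simp add: abs_mult)
  qed measurable
  have "sine_duhamel \<kappa> ?u t x = (LINT s:{0..t}|lborel. A s - heat \<kappa> (t - s) (?u s) x)"
    unfolding duhamel_def
  proof (rule set_lebesgue_integral_cong, simp, intro allI impI)
    fix s assume s: "s \<in> {0..t}"
    have "heat \<kappa> (t - s) (\<lambda>y. ?F s y - ?u s y) x = A s - heat \<kappa> (t - s) (?u s) x"
      unfolding heat_def A_def using s F damped_limit_bound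
      by (intro gauss_conv_diff[where C = pi and D = pi]) auto
    then show "1 * heat \<kappa> (t - s) (\<lambda>y. sin (?u s y)) x = A s - heat \<kappa> (t - s) (?u s) x" by simp
  qed
  also have "\<dots> = (LINT s:{0..t}|lborel. A s) - (LINT s:{0..t}|lborel. heat \<kappa> (t - s) (?u s) x)"
    using intA intU by simp
  also have "(LINT s:{0..t}|lborel. heat \<kappa> (t - s) (?u s) x) = (LINT s:{0..t}|lborel. exp (- s) * heat \<kappa> t f x + B s)"
    by (rule set_lebesgue_integral_cong) (auto simp: u_heat)
  also have "\<dots> = (LINT s:{0..t}|lborel. exp (- s) * heat \<kappa> t f x) + (LINT s:{0..t}|lborel. B s)"
    using intE intB by simp
  also have "(LINT s:{0..t}|lborel. exp (- s) * heat \<kappa> t f x) = (1 - exp (- t)) * heat \<kappa> t f x"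
    using set_integral_exp_minus[OF t, of 0] by simp
  also have "(LINT s:{0..t}|lborel. B s) = (LINT r:{0..t}|lborel. (1 - exp (- (t - r))) * A r)"
    unfolding B_def by (rule set_integral_triangle_exp[where C = pi]) (use A in auto)
  also have "\<dots> = (LINT r:{0..t}|lborel. A r) - (LINT r:{0..t}|lborel. exp (- (t - r)) * A r)"
    using intA intA' by (simp add: left_diff_distrib del: exp_diff)
  also have "(LINT r:{0..t}|lborel. exp (- (t - r)) * A r) = duhamel \<kappa> (\<lambda>r. exp (- r)) ?F t x"
    by (simp add: duhamel_def A_def)
  finally show ?thesis using damped_limit_eq[OF t, of x] by (simp add: algebra_simps)
qed

end

text \<open>The Duhamel integral is split at \<tau>: by the semigroup law the earlier part, together
  with the data, is the flow of \<open>u \<tau>\<close>, and the later part is translated back to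
  start at 0. Smoothness at late times thereby reduces to short times after a restart.\<close>

lemma heat_equation_sine_restart:
  fixes u :: "real \<Rightarrow> real^'n \<Rightarrow> real"
  assumes \<kappa>: "\<kappa> \<ge> 0" and f_meas [measurable]: "f \<in> borel_measurable borel" and f: "\<And>x. \<bar>f x\<bar> \<le> C"
    and [measurable]: "joint_borel u"
    and u: "\<And>t x. 0 \<le> t \<Longrightarrow> u t x = heat \<kappa> t f x + sine_duhamel \<kappa> u t x"
    and \<tau>: "0 \<le> \<tau>" and t: "0 \<le> t"
  shows "u (\<tau> + t) x = heat \<kappa> t (u \<tau>) x + sine_duhamel \<kappa> (\<lambda>s. u (\<tau> + s)) t x"
proof -
  let ?D = "sine_duhamel \<kappa> u"
  define A where "A s = heat \<kappa> (\<tau> + t - s) (\<lambda>y. sin (u s y)) x" for s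
  have [measurable]: "A \<in> borel_measurable borel" unfolding A_def by measurable
  have A: "\<bar>A s\<bar> \<le> 1" for s unfolding A_def by (intro heat_bound) simp
  have intA: "set_integrable lborel {a..b} A" for a b
    by (rule set_integrable_Icc_bounded[where C = 1]) (use A in auto)
  have Dm: "(\<lambda>y. ?D \<tau> y) \<in> borel_measurable borel"
    by (rule borel_measurable_duhamel_slice) measurable
  have Db: "\<bar>?D \<tau> y\<bar> \<le> (LINT s:{0..\<tau>}|lborel. 1)" for y
  proof -
    have "norm (?D \<tau> y) \<le> (LINT s:{0..\<tau>}|lborel. 1)"
      unfolding duhamel_def
      by (rule set_integral_norm_bound_AE)
         (auto intro!: heat_bound set_integrable_Icc_bounded[where C = 1])
    then show ?thesis by simp
  qed
  have hb: "\<bar>heat \<kappa> \<tau> f y\<bar> \<le> C" for y using f by (rule heat_bound)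
  have "u \<tau> = (\<lambda>y. heat \<kappa> \<tau> f y + ?D \<tau> y)" using u[OF \<tau>] by auto
  then have "heat \<kappa> t (u \<tau>) x = heat \<kappa> t (\<lambda>y. heat \<kappa> \<tau> f y + ?D \<tau> y) x" by simp
  also have "\<dots> = heat \<kappa> t (heat \<kappa> \<tau> f) x + heat \<kappa> t (?D \<tau>) x"
    unfolding heat_def[of \<kappa> t] by (rule gauss_conv_add[OF _ hb Dm Db]) measurable
  also have "heat \<kappa> t (heat \<kappa> \<tau> f) x = heat \<kappa> (\<tau> + t) f x"
    using heat_heat[OF f_meas f \<kappa> t \<tau>] by (simp add: add.commute)
  also have "heat \<kappa> t (?D \<tau>) x = (LINT s:{0..\<tau>}|lborel. A s)"
    unfolding A_def using \<kappa> t by (subst heat_duhamel[where C = 1 and T = \<tau>]) auto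
  finally have 1: "heat \<kappa> t (u \<tau>) x = heat \<kappa> (\<tau> + t) f x + (LINT s:{0..\<tau>}|lborel. A s)" .
  have "sine_duhamel \<kappa> (\<lambda>s. u (\<tau> + s)) t x = (LINT s|lborel. indicator {\<tau>..\<tau> + t} (\<tau> + 1 *\<^sub>R s) *\<^sub>R A (\<tau> + 1 *\<^sub>R s))"
    unfolding duhamel_def A_def set_lebesgue_integral_def
    by (intro Bochner_Integration.integral_cong) (auto simp: indicator_def algebra_simps)
  also have "\<dots> = (LINT s:{\<tau>..\<tau> + t}|lborel. A s)"
    unfolding set_lebesgue_integral_def
    using lborel_integral_affine[of 1 "\<lambda>s. indicator {\<tau>..\<tau> + t} s *\<^sub>R A s" \<tau>] by simp
  finally have 2: "sine_duhamel \<kappa> (\<lambda>s. u (\<tau> + s)) t x = (LINT s:{\<tau>..\<tau> + t}|lborel. A s)" .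
  have "(LINT s:{0..\<tau> + t}|lborel. A s) = (LINT s:{0..\<tau>} \<union> {\<tau>..\<tau> + t}|lborel. A s)"
    using \<tau> t by (simp add: ivl_disj_un_two_touch(4))
  also have "\<dots> = (LINT s:{0..\<tau>}|lborel. A s) + (LINT s:{\<tau>..\<tau> + t}|lborel. A s)"
  proof (rule set_integral_Un_AE)
    show "AE s in lborel. \<not> (s \<in> {0..\<tau>} \<and> s \<in> {\<tau>..\<tau> + t})"
      using AE_lborel_singleton[of \<tau>] by eventually_elim auto
  qed (auto simp: intA)
  finally have 3: "?D (\<tau> + t) x = (LINT s:{0..\<tau>}|lborel. A s) + (LINT s:{\<tau>..\<tau> + t}|lborel. A s)"
    by (simp add: duhamel_def A_def)
  show ?thesis using u[of "\<tau> + t" x] \<tau> t 1 2 3 by simp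
qed

section \<open>Holomorphic dependence on parameters\<close>

no_notation fps_nth (infixl \<open>$\<close> 75)

text \<open>Differentiation under the integral sign, with no bound on the derivative assumed. The
  Cauchy estimates with constant \<open>h \<omega>\<close> control both the derivative and the
  quadratic remainder, and integrating the remainder gives an error of at most
  \<open>C * norm z\<close> in the difference quotient.\<close>

lemma holomorphic_on_integral:
  fixes F :: "complex \<Rightarrow> 'a \<Rightarrow> complex"
  assumes S: "open S"
    and hol: "\<And>\<omega>. (\<lambda>\<zeta>. F \<zeta> \<omega>) holomorphic_on S"
    and meas: "\<And>\<zeta>. \<zeta> \<in> S \<Longrightarrow> F \<zeta> \<in> borel_measurable M"
    and h: "integrable M h" and bound: "\<And>\<zeta> \<omega>. \<zeta> \<in> S \<Longrightarrow> norm (F \<zeta> \<omega>) \<le> h \<omega>"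
  shows "(\<lambda>\<zeta>. LINT \<omega>|M. F \<zeta> \<omega>) holomorphic_on S"
  unfolding holomorphic_on_open[OF S]
proof
  fix \<zeta>0 assume "\<zeta>0 \<in> S"
  then obtain r where r: "r > 0" "ball \<zeta>0 r \<subseteq> S" using S openE by blast
  have int: "integrable M (F \<zeta>)" if "\<zeta> \<in> S" for \<zeta>
    by (rule Bochner_Integration.integrable_bound[OF h meas[OF that]])
       (use bound[OF that] in \<open>auto intro: order_trans[OF _ abs_ge_self]\<close>)
  define d where "d \<omega> = deriv (\<lambda>z. F (\<zeta>0 + z) \<omega>) 0" for \<omega>
  have in_S: "\<zeta>0 + z \<in> S" if "norm z < r" for z
    using r(2) that by (auto simp: dist_norm)
  have hol0: "(\<lambda>z. F (\<zeta>0 + z) \<omega>) holomorphic_on ball 0 r" for \<omega>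
  proof -
    have "((\<lambda>\<zeta>. F \<zeta> \<omega>) \<circ> (\<lambda>z. \<zeta>0 + z)) holomorphic_on ball 0 r"
      by (rule holomorphic_on_compose_gen[OF _ hol]) (use r(2) in \<open>auto intro!: holomorphic_intros\<close>)
    then show ?thesis by (simp add: o_def)
  qed
  have taylor: "norm (d \<omega>) \<le> 2 * h \<omega> / r"
    "norm z \<le> r / 4 \<Longrightarrow> norm (F (\<zeta>0 + z) \<omega> - F \<zeta>0 \<omega> - d \<omega> * z) \<le> 32 * h \<omega> / r\<^sup>2 * (norm z)\<^sup>2" for \<omega> z
    using bounded_holomorphic_taylor1[OF hol0[of \<omega>] r(1), of "h \<omega>"] bound in_S unfolding d_def by auto
  \<comment> \<open>The derivative \<open>d\<close> is presented as a limit along a fixed sequence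
    of increments because its measurability in \<omega> comes from that of the difference
    quotients.\<close>
  have d_lim: "(\<lambda>n. (F (\<zeta>0 + of_real (r / 4 / real (Suc n))) \<omega> - F \<zeta>0 \<omega>) / of_real (r / 4 / real (Suc n))) \<longlonglongrightarrow> d \<omega>" for \<omega>
  proof -
    have "((\<lambda>z. F (\<zeta>0 + z) \<omega>) has_field_derivative d \<omega>) (at 0)"
      unfolding d_def by (rule holomorphic_derivI[OF hol0]) (use r in auto)
    then have "(\<lambda>z. (F (\<zeta>0 + z) \<omega> - F \<zeta>0 \<omega>) / z) \<midarrow>0\<rightarrow> d \<omega>"
      by (simp add: DERIV_def)
    moreover have "filterlim (\<lambda>n. complex_of_real (r / 4 / real (Suc n))) (at 0) sequentially"
    proof (rule filterlim_atI)
      have "(\<lambda>n. r / 4 * inverse (real (Suc n))) \<longlonglongrightarrow> r / 4 * 0"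
        by (intro tendsto_mult_left LIMSEQ_inverse_real_of_nat)
      then have "(\<lambda>n. complex_of_real (r / 4 * inverse (real (Suc n)))) \<longlonglongrightarrow> of_real (r / 4 * 0)"
        by (rule tendsto_of_real)
      then show "(\<lambda>n. complex_of_real (r / 4 / real (Suc n))) \<longlonglongrightarrow> 0"
        by (simp only: divide_inverse mult_zero_right of_real_0)
      have "complex_of_real (r / 4 / real (Suc n)) \<noteq> 0" for n
        unfolding of_real_eq_0_iff using r by simp
      then show "\<forall>\<^sub>F n in sequentially. complex_of_real (r / 4 / real (Suc n)) \<noteq> 0"
        by (intro always_eventually allI)
    qed
    ultimately show ?thesis by (rule filterlim_compose)
  qed
  have d_meas: "d \<in> borel_measurable M"
  proof (rule borel_measurable_LIMSEQ_metric[OF _ d_lim])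
    fix n
    have "r / 4 / real (Suc n) \<le> r / 4 / 1" "0 \<le> r / 4 / real (Suc n)"
      using r(1) by (intro divide_left_mono divide_nonneg_nonneg; simp)+
    then have "norm (complex_of_real (r / 4 / real (Suc n))) < r"
      unfolding norm_of_real using r(1) by linarith
    then have [measurable]: "F (\<zeta>0 + of_real (r / 4 / real (Suc n))) \<in> borel_measurable M"
      by (intro meas in_S)
    have [measurable]: "F \<zeta>0 \<in> borel_measurable M" by (rule meas[OF \<open>\<zeta>0 \<in> S\<close>])
    show "(\<lambda>\<omega>. (F (\<zeta>0 + of_real (r / 4 / real (Suc n))) \<omega> - F \<zeta>0 \<omega>) / of_real (r / 4 / real (Suc n))) \<in> borel_measurable M"
      by measurable
  qed
  have d_int: "integrable M d"
  proof (rule Bochner_Integration.integrable_bound[OF _ d_meas])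
    show "integrable M (\<lambda>\<omega>. 2 * h \<omega> / r)" using h by simp
    show "AE \<omega> in M. norm (d \<omega>) \<le> norm (2 * h \<omega> / r)"
      by (intro AE_I2) (use order_trans[OF taylor(1) abs_ge_self] in \<open>simp only: real_norm_def\<close>)
  qed
  define I where "I \<zeta> = (LINT \<omega>|M. F \<zeta> \<omega>)" for \<zeta>
  define D where "D = (LINT \<omega>|M. d \<omega>)"
  define C where "C = 32 * (LINT \<omega>|M. h \<omega>) / r\<^sup>2"
  have quad: "norm ((I (\<zeta>0 + z) - I \<zeta>0) / z - D) \<le> C * norm z" if z: "norm z \<le> r / 4" "z \<noteq> 0" for z
  proof -
    have "\<zeta>0 + z \<in> S" using z r by (intro in_S) auto
    note ints = int[OF this] int[OF \<open>\<zeta>0 \<in> S\<close>]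
    have "I (\<zeta>0 + z) - I \<zeta>0 - D * z = (LINT \<omega>|M. F (\<zeta>0 + z) \<omega> - F \<zeta>0 \<omega> - d \<omega> * z)"
      unfolding I_def D_def using ints d_int by simp
    also have "norm \<dots> \<le> (LINT \<omega>|M. norm (F (\<zeta>0 + z) \<omega> - F \<zeta>0 \<omega> - d \<omega> * z))"
      by (rule integral_norm_bound)
    also have "\<dots> \<le> (LINT \<omega>|M. 32 * h \<omega> / r\<^sup>2 * (norm z)\<^sup>2)"
      using ints d_int h taylor(2)[OF z(1)] by (intro integral_mono) auto
    also have "\<dots> = C * norm z * norm z" by (simp add: C_def power2_eq_square)
    finally have "norm (I (\<zeta>0 + z) - I \<zeta>0 - D * z) \<le> C * norm z * norm z" .
    moreover have "(I (\<zeta>0 + z) - I \<zeta>0) / z - D = (I (\<zeta>0 + z) - I \<zeta>0 - D * z) / z"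
      using z by (simp add: field_simps)
    ultimately show ?thesis using z by (simp add: norm_divide divide_le_eq)
  qed
  have "((\<lambda>z. (I (\<zeta>0 + z) - I \<zeta>0) / z - D) \<longlongrightarrow> 0) (at 0)"
  proof (rule Lim_null_comparison)
    show "\<forall>\<^sub>F z in at 0. norm ((I (\<zeta>0 + z) - I \<zeta>0) / z - D) \<le> C * norm z"
      unfolding eventually_at using quad r(1) by (intro exI[of _ "r / 4"]) auto
    have "((\<lambda>z::complex. C * norm z) \<longlongrightarrow> C * norm (0::complex)) (at 0)" by (intro tendsto_intros)
    then show "((\<lambda>z::complex. C * norm z) \<longlongrightarrow> 0) (at 0)" by simp
  qed
  then have "(I has_field_derivative D) (at \<zeta>0)"
    unfolding DERIV_def by (rule Lim_null[THEN iffD2])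
  then show "\<exists>f'. ((\<lambda>\<zeta>. LINT \<omega>|M. F \<zeta> \<omega>) has_field_derivative f') (at \<zeta>0)"
    unfolding I_def[abs_def] by blast
qed

lemma cmod_sin_le_exp_norm: "norm (sin (z :: complex)) \<le> exp (norm z)"
proof -
  have "norm (sin z) \<le> exp \<bar>Im z\<bar>" using cmod_sin_le_exp[of 1 z] by simp
  also have "\<dots> \<le> exp (norm z)" using abs_Im_le_cmod[of z] by simp
  finally show ?thesis .
qed

lemma cmod_sin_diff_le:
  assumes "norm a \<le> M" "norm b \<le> M"
  shows "norm (sin a - sin (b :: complex)) \<le> exp M * norm (a - b)"
proof (rule field_differentiable_bound[where S = "cball 0 M" and f = sin and f' = cos])
  show "norm (cos z) \<le> exp M" if "z \<in> cball 0 M" for z :: complex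
    using norm_cos_le[of z] that by (auto intro: order_trans)
  show "(sin has_field_derivative cos z) (at z within cball 0 M)" for z :: complex
    by (auto intro!: derivative_eq_intros)
qed (use assms in auto)

text \<open>Parameters \<open>p = (\<lambda>, a)\<close> are stored as \<open>p $ None = \<lambda>\<close> and \<open>p $ Some i = a $ i\<close>. For real parameters,
  \<open>v t x = u (\<lambda> t) (x + t a)\<close> solves \<open>\<partial>\<^sub>t v = \<lambda> \<kappa>\<^sup>2 \<Delta> v + a \<cdot> \<nabla> v + \<lambda> sin v\<close> with the same initial value as \<open>u\<close>.
  The kernel below is that of its linear part at time \<open>r\<close>, in the variable \<open>z = (x - y) / (\<kappa> \<surd>r)\<close>; in
  this variable it is holomorphic in \<open>p\<close> and has a Gaussian bound that is uniform in \<open>r\<close>.\<close>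

definition shift_kernel :: "real \<Rightarrow> complex^('n::finite option) \<Rightarrow> real \<Rightarrow> real^'n \<Rightarrow> complex" where
  "shift_kernel \<kappa> p r z = inverse (csqrt (of_real (4 * pi) * p $ None)) ^ CARD('n) *
     exp (- (\<Sum>i\<in>UNIV. (of_real (z $ i) + of_real (sqrt r / \<kappa>) * p $ Some i)\<^sup>2) / (4 * p $ None))"

text \<open>The disc around 1 keeps \<lambda> in the right half-plane, away from the branch cut of
  \<open>csqrt\<close> and with Gaussian decay. The bound \<kappa> on the drift makes
  \<open>sqrt r / \<kappa>\<close> times each component at most 1 in norm for
  \<open>r \<le> 1\<close>.\<close>

definition shift_domain :: "real \<Rightarrow> (complex^('n::finite option)) set" where
  "shift_domain \<kappa> = {p. norm (p $ None - 1) < 1 / 2 \<and> (\<forall>i. norm (p $ Some i) < \<kappa>)}"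

abbreviation shift_line ::
  "real \<Rightarrow> complex^('n::finite option) \<Rightarrow> complex^('n option) \<Rightarrow> complex set" where
  "shift_line \<kappa> p h \<equiv> {\<zeta>. p + \<zeta> *s h \<in> shift_domain \<kappa>}"

text \<open>Each coordinate costs a factor \<open>exp 10\<close> when the complex drift is absorbed
  into a wider Gaussian; the power of \<open>36 * pi\<close> undoes the normalization of
  \<open>gauss_kernel 9\<close>.\<close>

definition shift_bound :: "'n::finite itself \<Rightarrow> real" where
  "shift_bound _ = exp (10 * real CARD('n)) * (36 * pi) powr (real CARD('n) / 2)"

lemma open_shift_domain: "open (shift_domain \<kappa> :: (complex^('n::finite option)) set)"
proof -
  have "shift_domain \<kappa> = {p :: complex^('n::finite option). norm (p $ None - 1) < 1 / 2} \<inter> (\<Inter>i. {p. norm (p $ Some i) < \<kappa>})"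
    by (auto simp: shift_domain_def)
  also have "open \<dots>"
    by (intro open_Int open_INT ballI open_Collect_less continuous_intros) auto
  finally show ?thesis .
qed

lemma shift_bound_ge_1: "shift_bound TYPE('n::finite) \<ge> 1"
proof -
  have "1 * 1 \<le> exp (10 * real CARD('n)) * (36 * pi) powr (real CARD('n) / 2)"
    using pi_gt3 by (intro mult_mono ge_one_powr_ge_zero) auto
  then show ?thesis by (simp add: shift_bound_def)
qed

lemma shift_domain_None:
  assumes "p \<in> shift_domain \<kappa>"
  shows "Re (p $ None) > 1 / 2" "norm (p $ None) < 3 / 2" "norm (p $ None) > 1 / 2"
proof -
  have *: "norm (p $ None - 1) < 1 / 2" using assms by (simp add: shift_domain_def)
  then show "Re (p $ None) > 1 / 2" using abs_Re_le_cmod[of "p $ None - 1"] by (simp add: abs_le_iff)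
  then show "norm (p $ None) > 1 / 2" using complex_Re_le_cmod[of "p $ None"] by linarith
  show "norm (p $ None) < 3 / 2" using * norm_triangle_ineq[of "p $ None - 1" 1] by simp
qed

text \<open>The real part of \<open>1 / l\<close> is at least
  \<open>(1 / 2) / (3 / 2)\<^sup>2 = 2 / 9\<close>. Half of the resulting quadratic term pays for
  the mixed term through \<open>4 * \<bar>z\<bar> \<le> z\<^sup>2 / 9 + 36\<close>; the remaining 2
  bounds the term with \<open>b\<^sup>2\<close>.\<close>

lemma Re_square_divide_ge:
  fixes l b :: complex and z :: real
  assumes l: "Re l > 1 / 2" "norm l < 3 / 2" "norm l > 1 / 2" and b: "norm b \<le> 1"
  shows "Re ((of_real z + b)\<^sup>2 / l) \<ge> z\<^sup>2 / 9 - 38"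
proof -
  define w where "w = inverse l"
  have wn: "norm w \<le> 2"
    using l(3) le_imp_inverse_le[of "1 / 2" "norm l"] by (simp add: w_def norm_inverse)
  have wr: "Re w \<ge> 2 / 9"
  proof -
    have "(norm l)\<^sup>2 \<le> (3/2)\<^sup>2" using l by (intro power_mono) auto
    then have "(2 / 9) * (norm l)\<^sup>2 \<le> Re l" using l(1) by (simp add: power2_eq_square)
    then have "2 / 9 \<le> Re l / (norm l)\<^sup>2" using l by (subst pos_le_divide_eq) auto
    then show ?thesis by (simp add: w_def cmod_power2)
  qed
  have "(of_real z + b)\<^sup>2 / l = of_real (z\<^sup>2) * w + (of_real (2 * z) * b * w + b\<^sup>2 * w)"
    unfolding divide_inverse w_def[symmetric] power2_eq_square by (simp add: algebra_simps)
  then have "Re ((of_real z + b)\<^sup>2 / l) = z\<^sup>2 * Re w + Re (of_real (2 * z) * b * w + b\<^sup>2 * w)"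
    by simp
  moreover have "z\<^sup>2 * Re w \<ge> z\<^sup>2 * (2 / 9)" using wr by (intro mult_left_mono) auto
  moreover have "\<bar>Re (of_real (2 * z) * b * w + b\<^sup>2 * w)\<bar> \<le> 4 * \<bar>z\<bar> + 2"
  proof -
    have "norm (of_real (2 * z) * b * w) \<le> (2 * \<bar>z\<bar>) * 1 * 2"
      unfolding norm_mult using b wn by (intro mult_mono) auto
    moreover have "norm (b\<^sup>2 * w) \<le> 1 * 2"
      unfolding norm_mult norm_power using b wn by (intro mult_mono power_le_one) auto
    ultimately show ?thesis
      using abs_Re_le_cmod[of "of_real (2 * z) * b * w + b\<^sup>2 * w"]
        norm_triangle_ineq[of "of_real (2 * z) * b * w" "b\<^sup>2 * w"] by linarith
  qed
  moreover have "4 * \<bar>z\<bar> \<le> z\<^sup>2 / 9 + 36"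
  proof -
    have "0 \<le> (\<bar>z\<bar> / 3 - 6)\<^sup>2" by simp
    also have "\<dots> = z\<^sup>2 / 9 - 4 * \<bar>z\<bar> + 36" by (simp add: power2_diff power_divide)
    finally show ?thesis by simp
  qed
  ultimately show ?thesis by linarith
qed

text \<open>Dividing the previous estimate by 4 gives \<open>(z $ i)\<^sup>2 / 36 - 19 / 2\<close>
  in each coordinate, hence the Gaussian of time 9 and, after rounding up, the factor
  \<open>exp 10\<close>. The bound does not depend on \<open>r\<close>, so the time integral meets
  no singularity.\<close>

lemma norm_shift_kernel_le:
  fixes p :: "complex^('n::finite option)"
  assumes \<kappa>: "\<kappa> > 0" and p: "p \<in> shift_domain \<kappa>" and r: "0 \<le> r" "r \<le> 1"
  shows "norm (shift_kernel \<kappa> p r z) \<le> shift_bound TYPE('n) * gauss_kernel 9 z"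
proof -
  let ?q = "\<lambda>i. (of_real (z $ i) + of_real (sqrt r / \<kappa>) * p $ Some i)\<^sup>2"
  note l = shift_domain_None[OF p]
  have b: "norm (of_real (sqrt r / \<kappa>) * p $ Some i) \<le> 1" for i
  proof -
    have "norm (p $ Some i) \<le> \<kappa>" using p by (auto simp: shift_domain_def less_imp_le)
    moreover have "norm (complex_of_real (sqrt r / \<kappa>)) \<le> 1 / \<kappa>"
      unfolding norm_of_real using \<kappa> r by (simp add: divide_right_mono)
    ultimately have "norm (of_real (sqrt r / \<kappa>) * p $ Some i) \<le> (1 / \<kappa>) * \<kappa>"
      unfolding norm_mult using \<kappa> by (intro mult_mono) auto
    then show ?thesis using \<kappa> by simp
  qed
  have "norm (inverse (csqrt (of_real (4 * pi) * p $ None)) ^ CARD('n)) \<le> 1"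
  proof -
    have "1 \<le> sqrt (4 * pi * norm (p $ None))"
    proof -
      have "(1 / 2) * 2 \<le> norm (p $ None) * (4 * pi)"
        using l pi_gt3 by (intro mult_mono) auto
      then show ?thesis by (simp add: mult.commute)
    qed
    then have "norm (csqrt (of_real (4 * pi) * p $ None)) \<ge> 1"
      by (simp add: norm_csqrt norm_mult)
    then have "norm (inverse (csqrt (of_real (4 * pi) * p $ None))) \<le> 1"
      by (simp add: norm_inverse inverse_le_1_iff)
    then show ?thesis unfolding norm_power by (intro power_le_one) auto
  qed
  moreover have "norm (exp (- (\<Sum>i\<in>UNIV. ?q i) / (4 * p $ None)))
      \<le> exp (10 * real CARD('n)) * exp (- (norm z)\<^sup>2 / 36)"
  proof -
    have "(norm z)\<^sup>2 = (\<Sum>i\<in>UNIV. (z $ i)\<^sup>2)"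
      by (simp add: norm_vec_def L2_set_def sum_nonneg)
    then have "(norm z)\<^sup>2 / 36 - 10 * real CARD('n) = (\<Sum>i\<in>UNIV. (z $ i)\<^sup>2 / 36 - 10)"
      by (simp add: sum_subtractf sum_divide_distrib)
    also have "\<dots> \<le> (\<Sum>i\<in>UNIV. Re (?q i / p $ None) / 4)"
    proof (rule sum_mono)
      fix i :: 'n
      show "(z $ i)\<^sup>2 / 36 - 10 \<le> Re (?q i / p $ None) / 4"
        using Re_square_divide_ge[OF l b[of i], of "z $ i"] by linarith
    qed
    also have "\<dots> = Re ((\<Sum>i\<in>UNIV. ?q i) / (4 * p $ None))"
    proof -
      have "(\<Sum>i\<in>UNIV. ?q i) / (4 * p $ None)
         = (\<Sum>i\<in>UNIV. ?q i / p $ None / of_real 4)"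
        by (simp add: sum_divide_distrib mult.commute)
      also have "Re \<dots> = (\<Sum>i\<in>UNIV. Re (?q i / p $ None) / 4)"
        unfolding Re_sum Re_divide_of_real ..
      finally show ?thesis by simp
    qed
    finally show ?thesis by (simp flip: exp_add)
  qed
  ultimately have "norm (shift_kernel \<kappa> p r z) \<le> 1 * (exp (10 * real CARD('n)) * exp (- (norm z)\<^sup>2 / 36))"
    unfolding shift_kernel_def norm_mult by (intro mult_mono) auto
  also have "\<dots> = shift_bound TYPE('n) * gauss_kernel 9 z"
    by (simp add: shift_bound_def gauss_kernel_def powr_minus field_simps)
  finally show ?thesis .
qed

lemma borel_measurable_shift_kernel [measurable (raw)]:
  assumes [measurable]: "r \<in> borel_measurable M" "z \<in> borel_measurable M"
  shows "(\<lambda>q. shift_kernel \<kappa> p (r q) (z q)) \<in> borel_measurable M"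
proof (rule borel_measurable_continuous_Pair[OF assms])
  show "continuous_on UNIV (\<lambda>w. shift_kernel \<kappa> p (fst w) (snd w))"
    unfolding shift_kernel_def divide_inverse by (intro continuous_intros)
qed

lemma holomorphic_shift_kernel:
  "(\<lambda>\<zeta>. shift_kernel \<kappa> (p + \<zeta> *s h) r z) holomorphic_on shift_line \<kappa> p h"
proof -
  have gen: "of_real (4 * pi) * l \<notin> \<real>\<^sub>\<le>\<^sub>0 \<and> l \<noteq> 0" if "Re l > 1 / 2" for l :: complex
  proof -
    have *: "Re (of_real (4 * pi) * l) > 0" using that by simp
    have "of_real (4 * pi) * l \<notin> \<real>\<^sub>\<le>\<^sub>0"
    proof
      assume "of_real (4 * pi) * l \<in> \<real>\<^sub>\<le>\<^sub>0"
      then have "Re (of_real (4 * pi) * l) \<le> 0" by (simp only: complex_nonpos_Reals_iff)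
      then show False using * by linarith
    qed
    then show ?thesis using that by auto
  qed
  have *: "of_real (4 * pi) * (p + \<zeta> *s h) $ None \<notin> \<real>\<^sub>\<le>\<^sub>0 \<and> (p + \<zeta> *s h) $ None \<noteq> 0"
    if "\<zeta> \<in> shift_line \<kappa> p h" for \<zeta>
    using that by (intro gen shift_domain_None(1)) auto
  show ?thesis
    unfolding shift_kernel_def vector_add_component vector_smult_component
    using *[unfolded vector_add_component vector_smult_component]
    by (intro holomorphic_intros) (auto simp only: csqrt_eq_0 mult_eq_0_iff of_real_eq_0_iff pi_neq_zero zero_neq_numeral[symmetric])
qed

definition shift_conv :: "real \<Rightarrow> complex^('n::finite option) \<Rightarrow> real \<Rightarrow> (real^'n \<Rightarrow> complex) \<Rightarrow> real^'n \<Rightarrow> complex" where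
  "shift_conv \<kappa> p r f x = (LINT z|lborel. shift_kernel \<kappa> p r z * f (x - (\<kappa> * sqrt r) *\<^sub>R z))"

lemma borel_measurable_shift_conv [measurable (raw)]:
  assumes [measurable]: "r \<in> borel_measurable M" "x \<in> borel_measurable M"
    "case_prod f \<in> borel_measurable (M \<Otimes>\<^sub>M borel)"
  shows "(\<lambda>q. shift_conv \<kappa> p (r q) (f q) (x q)) \<in> borel_measurable M"
proof -
  have "(\<lambda>(q, z). shift_kernel \<kappa> p (r q) z * case_prod f (q, x q - (\<kappa> * sqrt (r q)) *\<^sub>R z)) \<in> borel_measurable (M \<Otimes>\<^sub>M lborel)"
    by measurable
  then show ?thesis unfolding shift_conv_def by (simp add: lborel.borel_measurable_lebesgue_integral)
qed

context
  fixes \<kappa> :: real and p :: "complex^('n::finite option)" and r :: real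
  assumes \<kappa>: "\<kappa> > 0" and p: "p \<in> shift_domain \<kappa>" and r: "0 \<le> r" "r \<le> 1"
begin

lemma norm_shift_integrand_le:
  assumes f: "\<And>y. norm (f y) \<le> C"
  shows "norm (shift_kernel \<kappa> p r z * f y) \<le> shift_bound TYPE('n) * C * gauss_kernel 9 z"
proof -
  have "norm (shift_kernel \<kappa> p r z) * norm (f y) \<le> (shift_bound TYPE('n) * gauss_kernel 9 z) * C"
    using norm_shift_kernel_le[OF \<kappa> p r] f shift_bound_ge_1[where 'n='n] gauss_kernel_nonneg[of 9 z]
    by (intro mult_mono) auto
  then show ?thesis by (simp add: norm_mult mult_ac)
qed

lemma integrable_shift_conv:
  assumes [measurable]: "f \<in> borel_measurable borel" and f: "\<And>y. norm (f y) \<le> C"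
  shows "integrable lborel (\<lambda>z. shift_kernel \<kappa> p r z * f (x - (\<kappa> * sqrt r) *\<^sub>R z))"
proof (rule Bochner_Integration.integrable_bound)
  show "integrable lborel (\<lambda>z::real^'n. shift_bound TYPE('n) * C * gauss_kernel 9 z)"
    using integrable_gauss_kernel[of 9, where 'n='n] by simp
  show "AE z in lborel. norm (shift_kernel \<kappa> p r z * f (x - (\<kappa> * sqrt r) *\<^sub>R z))
      \<le> norm (shift_bound TYPE('n) * C * gauss_kernel 9 z)"
    using norm_shift_integrand_le[of f, OF f] by (auto intro: order_trans[OF _ abs_ge_self])
qed measurable

lemma norm_shift_conv_le:
  assumes [measurable]: "f \<in> borel_measurable borel" and f: "\<And>y. norm (f y) \<le> C"
  shows "norm (shift_conv \<kappa> p r f x) \<le> shift_bound TYPE('n) * C"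
proof -
  have "norm (shift_conv \<kappa> p r f x) \<le> (LINT z|lborel. norm (shift_kernel \<kappa> p r z * f (x - (\<kappa> * sqrt r) *\<^sub>R z)))"
    unfolding shift_conv_def by (rule integral_norm_bound)
  also have "\<dots> \<le> (LINT z|lborel. shift_bound TYPE('n) * C * gauss_kernel 9 (z::real^'n))"
    using integrable_shift_conv[OF assms(1) f] integrable_gauss_kernel[of 9, where 'n='n]
    by (intro integral_mono norm_shift_integrand_le[OF f]) auto
  also have "\<dots> = shift_bound TYPE('n) * C"
    using integral_gauss_kernel[of 9, where 'n='n] by simp
  finally show ?thesis .
qed

lemma shift_conv_diff:
  assumes "f \<in> borel_measurable borel" "\<And>y. norm (f y) \<le> C" "g \<in> borel_measurable borel" "\<And>y. norm (g y) \<le> D"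
  shows "shift_conv \<kappa> p r (\<lambda>y. f y - g y) x = shift_conv \<kappa> p r f x - shift_conv \<kappa> p r g x"
  using integrable_shift_conv[OF assms(1,2)] integrable_shift_conv[OF assms(3,4)]
  by (simp add: shift_conv_def right_diff_distrib)

end

section \<open>Real parameters and the iteration with complex parameters\<close>

definition complex_shift :: "real \<Rightarrow> real^'n \<Rightarrow> complex^('n::finite option)" where
  "complex_shift l a = (\<chi> j. case j of None \<Rightarrow> of_real l | Some i \<Rightarrow> of_real (a $ i))"

lemma complex_shift_nth [simp]:
  "complex_shift l a $ None = of_real l" "complex_shift l a $ Some i = of_real (a $ i)"
  by (simp_all add: complex_shift_def)

text \<open>For real parameters the exponent is a Gaussian centred at \<open>- b\<close> with
  variance scaled by \<open>l\<close>. Substituting \<open>?w z\<close> standardizes it: the scale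
  turns the elapsed time \<open>r\<close> into \<open>l * r\<close>, and the centre becomes the
  translation by \<open>r *\<^sub>R a\<close>.\<close>

lemma shift_conv_complex_shift:
  fixes f :: "real^'n \<Rightarrow> real"
  assumes \<kappa>: "\<kappa> > 0" and l: "l > 0" and r: "r \<ge> 0"
  shows "shift_conv \<kappa> (complex_shift l a) r (\<lambda>y. of_real (f y)) x = of_real (heat \<kappa> (l * r) f (x + r *\<^sub>R a))"
proof -
  define b where "b = (sqrt r / \<kappa>) *\<^sub>R a"
  let ?w = "\<lambda>z. (1 / sqrt l) *\<^sub>R b + (1 / sqrt l) *\<^sub>R z"
  have kernel: "shift_kernel \<kappa> (complex_shift l a) r z = of_real ((1 / sqrt l) ^ CARD('n) * gauss_kernel 1 (?w z))" for z :: "real^'n"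
  proof -
    have c: "csqrt (of_real (4 * pi) * of_real l) = of_real (sqrt (4 * pi * l))"
    proof -
      have "csqrt (of_real (4 * pi * l)) = of_real (sqrt (Re (of_real (4 * pi * l))))"
        by (rule csqrt_of_real_nonneg) (use l in auto)
      then show ?thesis by (simp only: of_real_mult[of "4 * pi" l, symmetric] Re_complex_of_real)
    qed
    have e: "(\<Sum>i\<in>UNIV. (of_real (z $ i) + of_real (sqrt r / \<kappa>) * of_real (a $ i))\<^sup>2) = complex_of_real ((norm (z + b))\<^sup>2)"
      by (simp add: norm_vec_def L2_set_def sum_nonneg b_def)
    have n: "(norm (?w z))\<^sup>2 = (norm (z + b))\<^sup>2 / l"
    proof -
      have "?w z = (1 / sqrt l) *\<^sub>R (z + b)" by (simp add: scaleR_add_right add.commute)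
      then show ?thesis using l by (simp add: power_divide)
    qed
    have "shift_kernel \<kappa> (complex_shift l a) r z = of_real (inverse (sqrt (4 * pi * l)) ^ CARD('n) * exp (- ((norm (z + b))\<^sup>2) / (4 * l)))"
      unfolding shift_kernel_def complex_shift_nth c e by (simp flip: exp_of_real)
    also have "inverse (sqrt (4 * pi * l)) ^ CARD('n) * exp (- ((norm (z + b))\<^sup>2) / (4 * l))
        = (1 / sqrt l) ^ CARD('n) * gauss_kernel 1 (?w z)"
    proof -
      have "(4 * pi) powr (- (real CARD('n) / 2)) = inverse (sqrt (4 * pi)) ^ CARD('n)"
        by (simp add: powr_minus powr_half_sqrt[symmetric] power_inverse powr_powr powr_realpow[symmetric])
      then show ?thesis
        unfolding gauss_kernel_def n using l
        by (simp add: real_sqrt_mult power_mult_distrib power_inverse power_one_over inverse_eq_divide field_simps)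
    qed
    finally show ?thesis .
  qed
  have "heat \<kappa> (l * r) f (x + r *\<^sub>R a)
      = (1 / sqrt l) ^ CARD('n) * (LINT z|lborel. gauss_kernel 1 (?w z)
          * f (x + r *\<^sub>R a - (\<kappa> * sqrt (l * r)) *\<^sub>R (?w z)))"
    unfolding heat_def gauss_conv_def
    using l by (subst lborel_integral_affine[of "1 / sqrt l" _ "(1 / sqrt l) *\<^sub>R b"]) (auto simp: power_one_over)
  also have "\<dots> = (LINT z|lborel. ((1 / sqrt l) ^ CARD('n) * gauss_kernel 1 (?w z))
          * f (x - (\<kappa> * sqrt r) *\<^sub>R z))"
  proof -
    have "x + r *\<^sub>R a - (\<kappa> * sqrt (l * r)) *\<^sub>R (?w z) = x - (\<kappa> * sqrt r) *\<^sub>R z" for z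
    proof -
      have "(\<kappa> * sqrt (l * r)) *\<^sub>R (?w z) = (\<kappa> * sqrt r) *\<^sub>R b + (\<kappa> * sqrt r) *\<^sub>R z"
        using l by (simp add: scaleR_add_right real_sqrt_mult)
      also have "(\<kappa> * sqrt r) *\<^sub>R b = r *\<^sub>R a" using \<kappa> r by (simp add: b_def)
      finally show ?thesis by simp
    qed
    then show ?thesis by (simp only: mult.assoc integral_mult_right_zero)
  qed
  finally show ?thesis
    unfolding shift_conv_def kernel by (simp flip: of_real_mult)
qed

text \<open>The Duhamel map of the equation for \<open>v\<close> explained at
  \<open>shift_kernel\<close>, extended to complex parameters; the factor \<open>p $ None\<close> is
  the \<lambda> in front of \<open>sin v\<close>.\<close>

definition shift_step ::
  "real \<Rightarrow> (real^'n \<Rightarrow> real) \<Rightarrow> complex^('n::finite option) \<Rightarrow> (real \<Rightarrow> real^'n \<Rightarrow> complex) \<Rightarrow> real \<Rightarrow> real^'n \<Rightarrow> complex" where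
  "shift_step \<kappa> g p v t x = shift_conv \<kappa> p t (\<lambda>y. of_real (g y)) x
     + p $ None * (LINT s:{0..t}|lborel. shift_conv \<kappa> p (t - s) (\<lambda>y. sin (v s y)) x)"

primrec shift_iterate ::
  "real \<Rightarrow> (real^'n \<Rightarrow> real) \<Rightarrow> nat \<Rightarrow> complex^('n::finite option) \<Rightarrow> real \<Rightarrow> real^'n \<Rightarrow> complex" where
  "shift_iterate \<kappa> g 0 p = (\<lambda>t x. 0)"
| "shift_iterate \<kappa> g (Suc n) p = shift_step \<kappa> g p (shift_iterate \<kappa> g n p)"

declare shift_iterate.simps(2) [simp del]

text \<open>The term \<open>shift_bound * pi\<close> bounds the contribution of the data; the 1 is
  the room left for the time integral.\<close>

definition shift_radius :: "'n::finite itself \<Rightarrow> real" where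
  "shift_radius _ = shift_bound TYPE('n) * pi + 1"

text \<open>The cap 1 is where the kernel bound stops. The other term makes kernel bound, sine bound
  \<open>exp shift_radius\<close> and time multiply to at most 1/2; with the factor \<lambda> of
  norm below 3/2 the time integral contributes at most 3/4, less than the room 1 in
  \<open>shift_radius\<close>. No data other than the bound \<pi> enter.\<close>

definition shift_time :: "'n::finite itself \<Rightarrow> real" where
  "shift_time _ = min 1 (1 / (2 * shift_bound TYPE('n) * exp (shift_radius TYPE('n))))"

lemma shift_time_bounds:
  "0 < shift_time TYPE('n::finite)" "shift_time TYPE('n) \<le> 1"
  "shift_bound TYPE('n) * exp (shift_radius TYPE('n)) * shift_time TYPE('n) \<le> 1 / 2"
proof -
  have B: "shift_bound TYPE('n) > 0" using shift_bound_ge_1[where 'n='n] by simp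
  then show "0 < shift_time TYPE('n::finite)" "shift_time TYPE('n) \<le> 1"
    by (auto simp: shift_time_def)
  have "shift_bound TYPE('n) * exp (shift_radius TYPE('n)) * shift_time TYPE('n)
     \<le> shift_bound TYPE('n) * exp (shift_radius TYPE('n)) * (1 / (2 * shift_bound TYPE('n) * exp (shift_radius TYPE('n))))"
    using B by (intro mult_left_mono) (auto simp: shift_time_def)
  also have "\<dots> = 1 / 2" using B by (simp add: field_simps)
  finally show "shift_bound TYPE('n) * exp (shift_radius TYPE('n)) * shift_time TYPE('n) \<le> 1 / 2" .
qed

lemma shift_radius_ge: "pi \<le> shift_radius TYPE('n::finite)"
proof -
  have "1 * pi \<le> shift_bound TYPE('n) * pi"
    using shift_bound_ge_1[where 'n='n] by (intro mult_right_mono) auto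
  then show ?thesis unfolding shift_radius_def by linarith
qed

lemma borel_measurable_shift_step:
  fixes v :: "real \<Rightarrow> real^'n \<Rightarrow> complex"
  assumes [measurable]: "g \<in> borel_measurable borel" "joint_borel v"
  shows "joint_borel (shift_step \<kappa> g p v)"
proof -
  have "(\<lambda>q. if 0 \<le> snd q \<and> snd q \<le> fst (fst q)
      then shift_conv \<kappa> p (fst (fst q) - snd q) (\<lambda>y. sin (v (snd q) y)) (snd (fst q)) else 0)
      \<in> borel_measurable ((borel \<Otimes>\<^sub>M (borel :: (real^'n) measure)) \<Otimes>\<^sub>M lborel)"
    by measurable
  then have "(\<lambda>(t, x). LINT s|lborel. (if 0 \<le> s \<and> s \<le> t then shift_conv \<kappa> p (t - s) (\<lambda>y. sin (v s y)) x else 0))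
      \<in> borel_measurable (borel \<Otimes>\<^sub>M (borel :: (real^'n) measure))"
    by (simp add: case_prod_beta' lborel.borel_measurable_lebesgue_integral)
  moreover have "(LINT s:{0..t}|lborel. shift_conv \<kappa> p (t - s) (\<lambda>y. sin (v s y)) x)
      = (LINT s|lborel. (if 0 \<le> s \<and> s \<le> t then shift_conv \<kappa> p (t - s) (\<lambda>y. sin (v s y)) x else 0))" for t x
    unfolding set_lebesgue_integral_def
    by (intro Bochner_Integration.integral_cong) (auto simp: indicator_def)
  ultimately have [measurable]: "(\<lambda>(t, x). LINT s:{0..t}|lborel. shift_conv \<kappa> p (t - s) (\<lambda>y. sin (v s y)) x)
      \<in> borel_measurable (borel \<Otimes>\<^sub>M (borel :: (real^'n) measure))" by simp
  have "(\<lambda>q. shift_conv \<kappa> p (fst q) (\<lambda>y. of_real (g y)) (snd q)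
     + p $ None * (case q of (t, x) \<Rightarrow> LINT s:{0..t}|lborel. shift_conv \<kappa> p (t - s) (\<lambda>y. sin (v s y)) x))
      \<in> borel_measurable (borel \<Otimes>\<^sub>M borel)"
    by (intro borel_measurable_add borel_measurable_times borel_measurable_const borel_measurable_shift_conv) measurable
  then show ?thesis by (simp add: shift_step_def case_prod_beta')
qed

context
  fixes \<kappa> :: real and g :: "real^'n \<Rightarrow> real"
  assumes \<kappa>: "\<kappa> > 0" and g_meas: "g \<in> borel_measurable borel" and g: "\<And>x. \<bar>g x\<bar> \<le> pi"
begin

lemma shift_integrand:
  fixes v :: "real \<Rightarrow> real^'n \<Rightarrow> complex"
  assumes p: "p \<in> shift_domain \<kappa>"
    and [measurable]: "joint_borel v"
    and v: "\<And>s y. s \<in> {0..shift_time TYPE('n)} \<Longrightarrow> norm (v s y) \<le> shift_radius TYPE('n)"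
    and t: "t \<in> {0..shift_time TYPE('n)}"
  shows "s \<in> {0..t} \<Longrightarrow> norm (shift_conv \<kappa> p (t - s) (\<lambda>y. sin (v s y)) x) \<le> shift_bound TYPE('n) * exp (shift_radius TYPE('n))"
    and "set_integrable lborel {0..t} (\<lambda>s. shift_conv \<kappa> p (t - s) (\<lambda>y. sin (v s y)) x)"
proof -
  show *: "norm (shift_conv \<kappa> p (t - s) (\<lambda>y. sin (v s y)) x) \<le> shift_bound TYPE('n) * exp (shift_radius TYPE('n))"
    if s: "s \<in> {0..t}" for s
  proof (rule norm_shift_conv_le[OF \<kappa> p])
    show "norm (sin (v s y)) \<le> exp (shift_radius TYPE('n))" for y
      using cmod_sin_le_exp_norm[of "v s y"] v[of s y] s t by (auto intro: order_trans)
  qed (use s t shift_time_bounds(2)[where 'n='n] in auto)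
  show "set_integrable lborel {0..t} (\<lambda>s. shift_conv \<kappa> p (t - s) (\<lambda>y. sin (v s y)) x)"
    by (rule set_integrable_Icc_bounded[OF _ *]) auto
qed

lemma norm_shift_step_le:
  fixes v :: "real \<Rightarrow> real^'n \<Rightarrow> complex"
  assumes p: "p \<in> shift_domain \<kappa>"
    and v_meas: "joint_borel v"
    and v: "\<And>s y. s \<in> {0..shift_time TYPE('n)} \<Longrightarrow> norm (v s y) \<le> shift_radius TYPE('n)"
    and t: "t \<in> {0..shift_time TYPE('n)}"
  shows "norm (shift_step \<kappa> g p v t x) \<le> shift_radius TYPE('n)"
proof -
  let ?B = "shift_bound TYPE('n)" and ?M = "shift_radius TYPE('n)"
  have 1: "norm (shift_conv \<kappa> p t (\<lambda>y. of_real (g y)) x) \<le> ?B * pi"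
    using t shift_time_bounds(2)[where 'n='n] g g_meas by (intro norm_shift_conv_le[OF \<kappa> p]) auto
  have "norm (LINT s:{0..t}|lborel. shift_conv \<kappa> p (t - s) (\<lambda>y. sin (v s y)) x) \<le> (LINT s:{0..t}|lborel. ?B * exp ?M * s ^ 0)"
  proof (rule set_integral_norm_bound_AE)
    show "set_integrable lborel {0..t} (\<lambda>s. ?B * exp ?M * s ^ 0)"
      by (rule set_integrable_Icc_bounded[where C = "\<bar>?B * exp ?M\<bar>"]) auto
  qed (use shift_integrand(1)[OF p v_meas v t] in auto)
  also have "\<dots> = ?B * exp ?M * t"
    unfolding set_integral_mult_right using t by (subst set_integral_power) auto
  also have "\<dots> \<le> ?B * exp ?M * shift_time TYPE('n)"
    using t shift_bound_ge_1[where 'n='n] by (intro mult_left_mono) auto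
  also have "\<dots> \<le> 1 / 2" by (rule shift_time_bounds)
  finally have "norm (p $ None) * norm (LINT s:{0..t}|lborel. shift_conv \<kappa> p (t - s) (\<lambda>y. sin (v s y)) x) \<le> (3 / 2) * (1 / 2)"
    using shift_domain_None(2)[OF p] by (intro mult_mono) auto
  then show ?thesis
    using 1 norm_triangle_ineq[of "shift_conv \<kappa> p t (\<lambda>y. of_real (g y)) x"
        "p $ None * (LINT s:{0..t}|lborel. shift_conv \<kappa> p (t - s) (\<lambda>y. sin (v s y)) x)"]
    unfolding shift_step_def shift_radius_def norm_mult by linarith
qed

text \<open>On the ball of radius \<open>shift_radius\<close> the complex sine has Lipschitz
  constant \<open>exp shift_radius\<close>, the same number that bounds its size, so the choice of
  \<open>shift_time\<close> yields the ratio \<open>3 / 2 * (1 / 2)\<close>.\<close>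

lemma shift_step_contraction:
  fixes v w :: "real \<Rightarrow> real^'n \<Rightarrow> complex"
  assumes p: "p \<in> shift_domain \<kappa>"
    and v_meas: "joint_borel v"
    and w_meas: "joint_borel w"
    and v: "\<And>s y. s \<in> {0..shift_time TYPE('n)} \<Longrightarrow> norm (v s y) \<le> shift_radius TYPE('n)"
    and w: "\<And>s y. s \<in> {0..shift_time TYPE('n)} \<Longrightarrow> norm (w s y) \<le> shift_radius TYPE('n)"
    and d: "\<And>s y. s \<in> {0..shift_time TYPE('n)} \<Longrightarrow> norm (v s y - w s y) \<le> d"
    and t: "t \<in> {0..shift_time TYPE('n)}"
  shows "norm (shift_step \<kappa> g p v t x - shift_step \<kappa> g p w t x) \<le> 3 / 4 * d"
proof -
  let ?B = "shift_bound TYPE('n)" and ?M = "shift_radius TYPE('n)"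
  note [measurable] = v_meas w_meas
  let ?V = "\<lambda>s. shift_conv \<kappa> p (t - s) (\<lambda>y. sin (v s y)) x"
  let ?W = "\<lambda>s. shift_conv \<kappa> p (t - s) (\<lambda>y. sin (w s y)) x"
  have "d \<ge> 0" using order_trans[OF norm_ge_zero d[OF t]] .
  have diff: "norm (?V s - ?W s) \<le> ?B * exp ?M * d * s ^ 0" if s: "s \<in> {0..t}" for s
  proof -
    have s': "s \<in> {0..shift_time TYPE('n)}" "0 \<le> t - s" "t - s \<le> 1"
      using s t shift_time_bounds(2)[where 'n='n] by auto
    have sinb: "norm (sin (v s y)) \<le> exp ?M" "norm (sin (w s y)) \<le> exp ?M" for y
      using cmod_sin_le_exp_norm[of "v s y"] v[OF s'(1), of y]
        cmod_sin_le_exp_norm[of "w s y"] w[OF s'(1), of y] by (auto intro: order_trans)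
    have "?V s - ?W s = shift_conv \<kappa> p (t - s) (\<lambda>y. sin (v s y) - sin (w s y)) x"
      by (rule shift_conv_diff[OF \<kappa> p s'(2,3) _ sinb(1) _ sinb(2), symmetric]) measurable
    also have "norm \<dots> \<le> ?B * (exp ?M * d)"
    proof (rule norm_shift_conv_le[OF \<kappa> p s'(2,3)])
      show "norm (sin (v s y) - sin (w s y)) \<le> exp ?M * d" for y
        using cmod_sin_diff_le[OF v[OF s'(1)] w[OF s'(1)], of y y] d[OF s'(1), of y]
        by (auto intro: order_trans mult_left_mono)
    qed measurable
    finally show ?thesis by (simp add: mult.assoc)
  qed
  note ints = shift_integrand(2)[OF p v_meas v t] shift_integrand(2)[OF p w_meas w t]
  have "norm (LINT s:{0..t}|lborel. ?V s - ?W s) \<le> (LINT s:{0..t}|lborel. ?B * exp ?M * d * s ^ 0)"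
  proof (rule set_integral_norm_bound_AE)
    show "set_integrable lborel {0..t} (\<lambda>s. ?B * exp ?M * d * s ^ 0)"
      by (rule set_integrable_Icc_bounded[where C = "\<bar>?B * exp ?M * d\<bar>"]) auto
  qed (use diff in auto)
  also have "\<dots> = (?B * exp ?M * t) * d"
    unfolding set_integral_mult_right using t by (subst set_integral_power) auto
  also have "\<dots> \<le> (?B * exp ?M * shift_time TYPE('n)) * d"
    using t shift_bound_ge_1[where 'n='n] \<open>d \<ge> 0\<close> by (intro mult_right_mono mult_left_mono) auto
  also have "\<dots> \<le> (1 / 2) * d" using shift_time_bounds(3)[where 'n='n] \<open>d \<ge> 0\<close> by (intro mult_right_mono)
  finally have "norm (p $ None) * norm (LINT s:{0..t}|lborel. ?V s - ?W s) \<le> (3 / 2) * ((1 / 2) * d)"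
    using shift_domain_None(2)[OF p] \<open>d \<ge> 0\<close> by (intro mult_mono) auto
  moreover have "shift_step \<kappa> g p v t x - shift_step \<kappa> g p w t x = p $ None * (LINT s:{0..t}|lborel. ?V s - ?W s)"
  proof -
    have "(LINT s:{0..t}|lborel. ?V s - ?W s) = (LINT s:{0..t}|lborel. ?V s) - (LINT s:{0..t}|lborel. ?W s)"
      by (rule set_integral_diff(2)[OF ints])
    then show ?thesis unfolding shift_step_def by (simp only: right_diff_distrib add_diff_cancel_left)
  qed
  ultimately show ?thesis by (simp add: norm_mult)
qed

lemma shift_iterate_measurable: "joint_borel (shift_iterate \<kappa> g n p)"
proof (induction n)
  case (Suc n)
  then show ?case unfolding shift_iterate.simps by (rule borel_measurable_shift_step[OF g_meas])
qed simp

lemma norm_shift_iterate_le: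
  assumes "p \<in> shift_domain \<kappa>" "t \<in> {0..shift_time TYPE('n)}"
  shows "norm (shift_iterate \<kappa> g n p t x) \<le> shift_radius TYPE('n)"
  using assms(2)
proof (induction n arbitrary: t x)
  case 0
  have "0 \<le> shift_radius TYPE('n)" using shift_radius_ge[where 'n='n] pi_gt_zero by linarith
  then show ?case by simp
next
  case (Suc n)
  then show ?case unfolding shift_iterate.simps
    by (intro norm_shift_step_le[OF assms(1) shift_iterate_measurable])
qed

lemma shift_iterate_diff:
  assumes p: "p \<in> shift_domain \<kappa>" and "t \<in> {0..shift_time TYPE('n)}"
  shows "norm (shift_iterate \<kappa> g (Suc n) p t x - shift_iterate \<kappa> g n p t x) \<le> (3 / 4) ^ n * shift_radius TYPE('n)"
  using assms(2)
proof (induction n arbitrary: t x)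
  case 0
  then show ?case using norm_shift_iterate_le[OF p 0, of "Suc 0"] by simp
next
  case (Suc n)
  have "norm (shift_step \<kappa> g p (shift_iterate \<kappa> g (Suc n) p) t x - shift_step \<kappa> g p (shift_iterate \<kappa> g n p) t x)
      \<le> 3 / 4 * ((3 / 4) ^ n * shift_radius TYPE('n))"
    by (rule shift_step_contraction[OF p shift_iterate_measurable shift_iterate_measurable
          norm_shift_iterate_le[OF p] norm_shift_iterate_le[OF p] Suc.IH Suc.prems])
  then show ?case by (simp add: shift_iterate.simps(2))
qed

lemma holomorphic_shift_conv:
  assumes f_meas: "\<And>\<zeta>. \<zeta> \<in> shift_line \<kappa> p h \<Longrightarrow> f \<zeta> \<in> borel_measurable borel"
    and f: "\<And>\<zeta> y. \<zeta> \<in> shift_line \<kappa> p h \<Longrightarrow> norm (f \<zeta> y) \<le> C"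
    and f_hol: "\<And>y. (\<lambda>\<zeta>. f \<zeta> y) holomorphic_on shift_line \<kappa> p h"
    and r: "0 \<le> r" "r \<le> 1" and op: "open (shift_line \<kappa> p h)"
  shows "(\<lambda>\<zeta>. shift_conv \<kappa> (p + \<zeta> *s h) r (f \<zeta>) (x :: real^'n)) holomorphic_on shift_line \<kappa> p h"
  unfolding shift_conv_def
proof (rule holomorphic_on_integral[OF op])
  show "(\<lambda>\<zeta>. shift_kernel \<kappa> (p + \<zeta> *s h) r z * f \<zeta> (x - (\<kappa> * sqrt r) *\<^sub>R z)) holomorphic_on shift_line \<kappa> p h" for z
    by (intro holomorphic_on_mult holomorphic_shift_kernel f_hol)
  show "integrable lborel (\<lambda>z::real^'n. shift_bound TYPE('n) * C * gauss_kernel 9 z)"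
    using integrable_gauss_kernel[of 9, where 'n='n] by simp
  fix \<zeta> assume \<zeta>: "\<zeta> \<in> shift_line \<kappa> p h"
  note [measurable] = f_meas[OF \<zeta>]
  show "(\<lambda>z. shift_kernel \<kappa> (p + \<zeta> *s h) r z * f \<zeta> (x - (\<kappa> * sqrt r) *\<^sub>R z)) \<in> borel_measurable lborel"
    by measurable
  show "norm (shift_kernel \<kappa> (p + \<zeta> *s h) r z * f \<zeta> (x - (\<kappa> * sqrt r) *\<^sub>R z)) \<le> shift_bound TYPE('n) * C * gauss_kernel 9 z" for z
    using \<zeta> r by (intro norm_shift_integrand_le[OF \<kappa>] f[OF \<zeta>]) auto
qed

lemma open_line_shift_domain: "open (shift_line \<kappa> (p :: complex^('n::finite option)) h)"
proof -
  have "continuous_on UNIV (\<lambda>\<zeta>. p + \<zeta> *s h)"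
    unfolding vector_scalar_mult_def by (intro continuous_intros)
  then show ?thesis unfolding vimage_def[symmetric] by (simp add: open_vimage open_shift_domain)
qed

text \<open>Each step composes with the entire function \<open>sin\<close> and integrates twice,
  over space and over time; both integrands have parameter-independent integrable majorants because
  the iterates stay in a fixed ball.\<close>

lemma holomorphic_shift_iterate:
  assumes "t \<in> {0..shift_time TYPE('n)}"
  shows "(\<lambda>\<zeta>. shift_iterate \<kappa> g n (p + \<zeta> *s h) t x) holomorphic_on shift_line \<kappa> p h"
  using assms
proof (induction n arbitrary: t x)
  case 0
  show ?case by simp
next
  case (Suc n)
  let ?I = "\<lambda>\<zeta>. shift_iterate \<kappa> g n (p + \<zeta> *s h)"
  let ?H = "\<lambda>\<zeta> s. indicator {0..t} s *\<^sub>R shift_conv \<kappa> (p + \<zeta> *s h) (t - s) (\<lambda>y. sin (?I \<zeta> s y)) x"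
  let ?A = "shift_line \<kappa> (p :: complex^('n::finite option)) h"
  have t1: "0 \<le> t" "t \<le> 1" using Suc.prems shift_time_bounds(2)[where 'n='n] by auto
  have 1: "(\<lambda>\<zeta>. shift_conv \<kappa> (p + \<zeta> *s h) t (\<lambda>y. of_real (g y)) x) holomorphic_on ?A"
    by (rule holomorphic_shift_conv[where C = pi]) (use g g_meas t1 open_line_shift_domain in auto)
  have 2: "(\<lambda>\<zeta>. LINT s|lborel. ?H \<zeta> s) holomorphic_on ?A"
  proof (rule holomorphic_on_integral[OF open_line_shift_domain])
    fix s :: real
    show "(\<lambda>\<zeta>. ?H \<zeta> s) holomorphic_on ?A"
    proof (cases "s \<in> {0..t}")
      case True
      have s: "s \<in> {0..shift_time TYPE('n)}" "0 \<le> t - s" "t - s \<le> 1" using True Suc.prems t1 by auto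
      have "(\<lambda>\<zeta>. shift_conv \<kappa> (p + \<zeta> *s h) (t - s) (\<lambda>y. sin (?I \<zeta> s y)) x) holomorphic_on ?A"
      proof (rule holomorphic_shift_conv[OF _ _ _ s(2,3) open_line_shift_domain])
        fix \<zeta> assume \<zeta>: "\<zeta> \<in> ?A"
        have [measurable]: "joint_borel (?I \<zeta>)"
          by (rule shift_iterate_measurable)
        show "(\<lambda>y. sin (?I \<zeta> s y)) \<in> borel_measurable borel" by measurable
        show "norm (sin (?I \<zeta> s y)) \<le> exp (shift_radius TYPE('n))" for y
          using cmod_sin_le_exp_norm[of "?I \<zeta> s y"]
            norm_shift_iterate_le[OF _ s(1), of "p + \<zeta> *s h" n y] \<zeta> by (auto intro: order_trans)
      next
        show "(\<lambda>\<zeta>. sin (?I \<zeta> s y)) holomorphic_on ?A" for y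
          using Suc.IH[OF s(1)] by (intro holomorphic_intros)
      qed
      then show ?thesis using True by simp
    qed simp
  next
    have ind: "integrable lborel (indicator {0..t} :: real \<Rightarrow> real)"
      by (simp add: integrable_indicator_iff emeasure_lborel_Icc_eq)
    show "integrable lborel (\<lambda>s. indicator {0..t} s * (shift_bound TYPE('n) * exp (shift_radius TYPE('n))))"
      by (rule integrable_mult_left) (use ind in blast)
  next
    fix \<zeta> assume "\<zeta> \<in> ?A"
    then have p': "p + \<zeta> *s h \<in> shift_domain \<kappa>" by simp
    have m: "joint_borel (?I \<zeta>)"
      by (rule shift_iterate_measurable)
    note [measurable] = m
    show "(\<lambda>s. ?H \<zeta> s) \<in> borel_measurable lborel"
      by measurable
    show "norm (?H \<zeta> s)
        \<le> indicator {0..t} s * (shift_bound TYPE('n) * exp (shift_radius TYPE('n)))" for s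
      using shift_integrand(1)[OF p' m norm_shift_iterate_le[OF p'] Suc.prems, where s = s and x = x]
      by (simp add: indicator_def)
  qed
  have "(\<lambda>\<zeta>. (p + \<zeta> *s h) $ None) holomorphic_on ?A"
    unfolding vector_add_component vector_smult_component by (intro holomorphic_intros)
  with 1 2 show ?case
    unfolding shift_iterate.simps shift_step_def set_lebesgue_integral_def by (intro holomorphic_on_add holomorphic_on_mult)
qed

section \<open>Limit of the complex iteration and its meaning for real parameters\<close>

definition shift_limit :: "complex^('n option) \<Rightarrow> real \<Rightarrow> real^'n \<Rightarrow> complex" where
  "shift_limit p t x = lim (\<lambda>n. shift_iterate \<kappa> g n p t x)"

lemma shift_iterate_uniform_limit:
  assumes t: "t \<in> {0..shift_time TYPE('n)}"
  shows "uniform_limit (shift_domain \<kappa>) (\<lambda>n p. shift_iterate \<kappa> g n p t x) (\<lambda>p. shift_limit p t x) sequentially"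
proof -
  let ?d = "\<lambda>n p. shift_iterate \<kappa> g (Suc n) p t x - shift_iterate \<kappa> g n p t x"
  have "uniform_limit (shift_domain \<kappa>) (\<lambda>n p. \<Sum>k<n. ?d k p) (\<lambda>p. \<Sum>k. ?d k p) sequentially"
  proof (rule Weierstrass_m_test)
    show "norm (?d n p) \<le> (3 / 4) ^ n * shift_radius TYPE('n)" if "p \<in> shift_domain \<kappa>" for n p
      by (rule shift_iterate_diff[OF that t])
    show "summable (\<lambda>n. (3 / 4) ^ n * shift_radius TYPE('n))"
      by (intro summable_mult2 summable_geometric) simp
  qed
  moreover have "(\<Sum>k<n. ?d k p) = shift_iterate \<kappa> g n p t x" for n p
    using sum_lessThan_telescope[of "\<lambda>k. shift_iterate \<kappa> g k p t x" n] by simp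
  ultimately have ul: "uniform_limit (shift_domain \<kappa>) (\<lambda>n p. shift_iterate \<kappa> g n p t x) (\<lambda>p. \<Sum>k. ?d k p) sequentially"
    by simp
  have "(\<Sum>k. ?d k p) = shift_limit p t x" if "p \<in> shift_domain \<kappa>" for p
    using tendsto_uniform_limitI[OF ul that] unfolding shift_limit_def by (simp add: limI)
  then show ?thesis using ul by (simp cong: uniform_limit_cong')
qed

text \<open>The geometric ratio 3/4 is uniform over \<open>shift_domain\<close>, so on each complex
  line the limit of the holomorphic iterates is holomorphic; \<open>shift_radius\<close> is the
  local bound.\<close>

lemma line_holomorphic_shift_limit:
  assumes t: "t \<in> {0..shift_time TYPE('n)}"
  shows "line_holomorphic_on (shift_domain \<kappa>) (\<lambda>p. shift_limit p t x)"
  unfolding line_holomorphic_on_def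
proof (intro conjI allI ballI)
  fix p h :: "complex^('n option)"
  let ?A = "shift_line \<kappa> p h"
  have ul: "uniform_limit ?A (\<lambda>n \<zeta>. shift_iterate \<kappa> g n (p + \<zeta> *s h) t x) (\<lambda>\<zeta>. shift_limit (p + \<zeta> *s h) t x) sequentially"
    unfolding uniform_limit_iff
  proof (intro allI impI)
    fix e :: real assume "e > 0"
    then have "\<forall>\<^sub>F n in sequentially. \<forall>q\<in>shift_domain \<kappa>. dist (shift_iterate \<kappa> g n q t x) (shift_limit q t x) < e"
      using shift_iterate_uniform_limit[OF t, of x] unfolding uniform_limit_iff by blast
    then show "\<forall>\<^sub>F n in sequentially. \<forall>\<zeta>\<in>?A. dist (shift_iterate \<kappa> g n (p + \<zeta> *s h) t x) (shift_limit (p + \<zeta> *s h) t x) < e"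
      by eventually_elim blast
  qed
  show "(\<lambda>\<zeta>. shift_limit (p + \<zeta> *s h) t x) holomorphic_on ?A"
  proof (rule holomorphic_uniform_sequence[OF open_line_shift_domain])
    show "(\<lambda>\<zeta>. shift_iterate \<kappa> g n (p + \<zeta> *s h) t x) holomorphic_on ?A" for n
      by (rule holomorphic_shift_iterate[OF t])
    fix \<zeta> assume \<zeta>: "\<zeta> \<in> ?A"
    obtain d where "d > 0" "cball \<zeta> d \<subseteq> ?A"
      using open_contains_cball_eq[OF open_line_shift_domain] \<zeta> by metis
    then show "\<exists>d>0. cball \<zeta> d \<subseteq> ?A \<and>
        uniform_limit (cball \<zeta> d) (\<lambda>n \<zeta>. shift_iterate \<kappa> g n (p + \<zeta> *s h) t x) (\<lambda>\<zeta>. shift_limit (p + \<zeta> *s h) t x) sequentially"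
      using uniform_limit_on_subset[OF ul] by blast
  qed
next
  fix p :: "complex^('n option)" assume "p \<in> shift_domain \<kappa>"
  then obtain r where r: "r > 0" "ball p r \<subseteq> shift_domain \<kappa>" using openE[OF open_shift_domain] by blast
  have "norm (shift_limit q t x) \<le> shift_radius TYPE('n)" if "q \<in> shift_domain \<kappa>" for q
  proof (rule LIMSEQ_le_const2[OF tendsto_norm])
    show "(\<lambda>n. shift_iterate \<kappa> g n q t x) \<longlonglongrightarrow> shift_limit q t x"
      by (rule tendsto_uniform_limitI[OF shift_iterate_uniform_limit[OF t] that])
  qed (use norm_shift_iterate_le[OF that t] in auto)
  then show "\<exists>r>0. \<exists>M. ball p r \<subseteq> shift_domain \<kappa> \<and> (\<forall>q\<in>ball p r. norm (shift_limit q t x) \<le> M)"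
    using r by blast
qed

lemma heat_translate: "heat \<kappa> t (\<lambda>y. f (y + h)) x = heat \<kappa> t f (x + h)"
  by (simp add: heat_def gauss_conv_def algebra_simps)

context
  fixes v :: "real \<Rightarrow> real^'n \<Rightarrow> real"
  assumes v_meas: "joint_borel v"
    and v_bound: "\<And>t x. 0 \<le> t \<Longrightarrow> \<bar>v t x\<bar> \<le> pi"
    and v_eq: "\<And>t x. 0 \<le> t \<Longrightarrow> v t x = heat \<kappa> t g x + sine_duhamel \<kappa> v t x"
begin

text \<open>The drifts compose, \<open>(t - s) *\<^sub>R a\<close> after
  \<open>s *\<^sub>R a\<close> giving \<open>t *\<^sub>R a\<close>, so every integrand is evaluated
  at the one point \<open>x + t *\<^sub>R a\<close>. The substitution of \<open>l * s\<close> for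
  the time variable is paid for by the factor \<open>l\<close>.\<close>

lemma shift_step_fixpoint:
  assumes l: "l > 0" and t: "0 \<le> t"
  shows "shift_step \<kappa> g (complex_shift l a) (\<lambda>s y. of_real (v (l * s) (y + s *\<^sub>R a))) t x
    = of_real (v (l * t) (x + t *\<^sub>R a))"
proof -
  let ?S = "\<lambda>s. shift_conv \<kappa> (complex_shift l a) (t - s) (\<lambda>y. sin (of_real (v (l * s) (y + s *\<^sub>R a)))) x"
  define A where "A s = heat \<kappa> (l * t - s) (\<lambda>y. sin (v s y)) (x + t *\<^sub>R a)" for s
  have inner: "?S s = of_real (A (l * s))"
    if s: "s \<in> {0..t}" for s
  proof -
    have "?S s
       = shift_conv \<kappa> (complex_shift l a) (t - s) (\<lambda>y. of_real (sin (v (l * s) (y + s *\<^sub>R a)))) x"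
      by (simp only: sin_of_real)
    also have "\<dots> = of_real (heat \<kappa> (l * (t - s)) (\<lambda>y. sin (v (l * s) (y + s *\<^sub>R a))) (x + (t - s) *\<^sub>R a))"
      by (rule shift_conv_complex_shift[OF \<kappa> l]) (use s in auto)
    also have "heat \<kappa> (l * (t - s)) (\<lambda>y. sin (v (l * s) (y + s *\<^sub>R a))) (x + (t - s) *\<^sub>R a) = A (l * s)"
      unfolding A_def heat_translate[of _ "\<lambda>y. sin (v (l * s) y)"] by (simp add: algebra_simps)
    finally show ?thesis .
  qed
  have "(LINT s:{0..t}|lborel. ?S s)
     = (LINT s:{0..t}|lborel. complex_of_real (A (l * s)))"
    by (rule set_lebesgue_integral_cong) (auto simp: inner)
  also have "\<dots> = of_real (LINT s:{0..t}|lborel. A (l * s))"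
    by (rule set_integral_complex_of_real)
  finally have "complex_of_real l * (LINT s:{0..t}|lborel. ?S s)
     = of_real (l * (LINT s:{0..t}|lborel. A (l * s)))" by simp
  also have "l * (LINT s:{0..t}|lborel. A (l * s)) = l * (LINT s|lborel. indicator {0..l * t} (0 + l *\<^sub>R s) *\<^sub>R A (0 + l *\<^sub>R s))"
    unfolding set_lebesgue_integral_def using l
    by (intro arg_cong2[where f = "(*)"] refl Bochner_Integration.integral_cong) (auto simp: indicator_def zero_le_mult_iff)
  also have "\<dots> = (LINT s:{0..l * t}|lborel. A s)"
    unfolding set_lebesgue_integral_def
    using l lborel_integral_affine[of l "\<lambda>s. indicator {0..l * t} s *\<^sub>R A s" 0] by simp
  also have "\<dots> = sine_duhamel \<kappa> v (l * t) (x + t *\<^sub>R a)"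
    by (simp add: duhamel_def A_def)
  finally show ?thesis
    unfolding shift_step_def shift_conv_complex_shift[OF \<kappa> l t]
    using v_eq[of "l * t" "x + t *\<^sub>R a"] l t by simp
qed

text \<open>The transformed solution is a fixed point of \<open>shift_step\<close> within the ball
  where it contracts, so the iterates converge to it. Thus the holomorphic function of the
  parameters extends actual values of \<open>v\<close>.\<close>

lemma shift_limit_real:
  assumes p: "complex_shift l a \<in> shift_domain \<kappa>" and t: "t \<in> {0..shift_time TYPE('n)}"
  shows "shift_limit (complex_shift l a) t x = of_real (v (l * t) (x + t *\<^sub>R a))"
proof -
  let ?y = "\<lambda>s y. complex_of_real (v (l * s) (y + s *\<^sub>R a))"
  let ?M = "shift_radius TYPE('n)"
  note [measurable] = v_meas
  have l: "l > 0" using shift_domain_None(1)[OF p] by simp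
  have y_meas: "joint_borel ?y" by measurable
  have yb: "norm (?y s y) \<le> pi" if "s \<in> {0..shift_time TYPE('n)}" for s y
    using v_bound[of "l * s"] l that by simp
  then have yM: "norm (?y s y) \<le> ?M" if "s \<in> {0..shift_time TYPE('n)}" for s y
    using that shift_radius_ge[where 'n='n] order_trans by blast
  have est: "norm (shift_iterate \<kappa> g n (complex_shift l a) t x - ?y t x) \<le> (3 / 4) ^ n * ?M"
    if "t \<in> {0..shift_time TYPE('n)}" for n t x
    using that
  proof (induction n arbitrary: t x)
    case 0
    then show ?case using yM[OF 0] by simp
  next
    case (Suc n)
    have "norm (shift_step \<kappa> g (complex_shift l a) (shift_iterate \<kappa> g n (complex_shift l a)) t x
        - shift_step \<kappa> g (complex_shift l a) ?y t x) \<le> 3 / 4 * ((3 / 4) ^ n * ?M)"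
      by (rule shift_step_contraction[OF p shift_iterate_measurable y_meas
            norm_shift_iterate_le[OF p] yM Suc.IH Suc.prems])
    moreover have "shift_step \<kappa> g (complex_shift l a) ?y t x = ?y t x"
      using Suc.prems by (intro shift_step_fixpoint[OF l]) simp
    ultimately show ?case by (simp add: shift_iterate.simps(2))
  qed
  have "(\<lambda>n. shift_iterate \<kappa> g n (complex_shift l a) t x - ?y t x) \<longlonglongrightarrow> 0"
  proof (rule Lim_null_comparison)
    show "\<forall>\<^sub>F n in sequentially. norm (shift_iterate \<kappa> g n (complex_shift l a) t x - ?y t x) \<le> (3 / 4) ^ n * ?M"
      using est[OF t] by simp
    have "(\<lambda>n. (3 / 4) ^ n * ?M) \<longlonglongrightarrow> 0 * ?M" by (intro tendsto_mult_right LIMSEQ_power_zero) simp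
    then show "(\<lambda>n. (3 / 4) ^ n * ?M) \<longlonglongrightarrow> 0" by simp
  qed
  then have "(\<lambda>n. shift_iterate \<kappa> g n (complex_shift l a) t x) \<longlonglongrightarrow> ?y t x" by (rule Lim_null[THEN iffD2])
  then show ?thesis unfolding shift_limit_def by (rule limI)
qed

text \<open>With \<open>t0\<close> and \<open>x0\<close> fixed, the parameters
  \<open>(t - \<tau>) / t0\<close> and \<open>(x - x0) / t0\<close> make \<open>shift_limit\<close>
  at \<open>(t0, x0)\<close> equal to \<open>v (t - \<tau>) x\<close>. They depend affinely on
  \<open>(t, x)\<close> and equal \<open>(1, 0)\<close> at \<open>(\<tau> + t0, x0)\<close>, so
  smoothness in the parameters is smoothness in space-time.\<close>

lemma duhamel_solution_smooth_near:
  assumes t0: "0 < t0" "t0 \<le> shift_time TYPE('n)"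
  shows "\<exists>U. open U \<and> (\<tau> + t0, x0) \<in> U \<and> (\<forall>k. Ck_on k U (\<lambda>(t, x). v (t - \<tau>) x))"
proof -
  define A where "A q = complex_shift (fst q / t0) ((1 / t0) *\<^sub>R snd q)" for q :: "real \<times> (real^'n)"
  define c where "c = complex_shift (- \<tau> / t0) (- (1 / t0) *\<^sub>R x0)"
  define U where "U = {q :: real \<times> (real^'n). c + A q \<in> shift_domain \<kappa>}"
  have cA: "c + A q = complex_shift ((fst q - \<tau>) / t0) ((1 / t0) *\<^sub>R (snd q - x0))" for q
    unfolding c_def A_def complex_shift_def
    by (auto simp: vec_eq_iff algebra_simps diff_divide_distrib split: option.split)
  have "linear A"
    unfolding A_def complex_shift_def
    by (auto intro!: linearI simp: vec_eq_iff add_divide_distrib distrib_left scaleR_conv_of_real[where 'a=complex] split: option.split)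
  then have A: "bounded_linear A" by (simp add: linear_conv_bounded_linear)
  have "continuous_on UNIV (\<lambda>q. c + A q)"
    by (intro continuous_intros linear_continuous_on A)
  then have U: "open U"
    unfolding U_def vimage_def[symmetric] by (simp add: open_vimage open_shift_domain)
  have "(\<tau> + t0, x0) \<in> U" unfolding U_def cA using t0 \<kappa> by (simp add: shift_domain_def)
  moreover have "Ck_on k U (\<lambda>(t, x). v (t - \<tau>) x)" for k
  proof -
    have t0': "t0 \<in> {0..shift_time TYPE('n)}" using t0 by simp
    have "Ck_on k U (\<lambda>q. Re (shift_limit (c + A q) t0 x0))"
      by (rule Ck_on_Re_line_holomorphic[OF line_holomorphic_shift_limit[OF t0'] open_shift_domain A U])
         (simp add: U_def)
    moreover have "(\<lambda>(t, x). v (t - \<tau>) x) q = Re (shift_limit (c + A q) t0 x0)" if q: "q \<in> U" for q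
    proof -
      have "shift_limit (c + A q) t0 x0 = of_real (v ((fst q - \<tau>) / t0 * t0) (x0 + t0 *\<^sub>R ((1 / t0) *\<^sub>R (snd q - x0))))"
        using q unfolding U_def cA by (intro shift_limit_real[OF _ t0']) simp
      then show ?thesis using t0 by (simp add: case_prod_beta')
    qed
    ultimately show ?thesis
      using U by (intro Ck_on_local exI[of _ U] exI[of _ "\<lambda>q. Re (shift_limit (c + A q) t0 x0)"]) auto
  qed
  ultimately show ?thesis using U by blast
qed

end

end

section \<open>Mild solutions on the torus\<close>

lemma sets_lebesgue_torus_cell: "torus_cell \<in> sets lebesgue"
  by (simp add: torus_cell_def)

lemma AE_lebesgue_on_iff:
  fixes S :: "'a::euclidean_space set"
  assumes "S \<in> sets lebesgue"
  shows "(AE x in lebesgue_on S. P x) \<longleftrightarrow> (AE x in lborel. x \<in> S \<longrightarrow> P x)"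
  using assms by (simp add: AE_restrict_space_iff AE_completion_iff)

lemma lebesgue_on_borel_version:
  fixes f :: "'a::euclidean_space \<Rightarrow> real"
  assumes S: "S \<in> sets lebesgue" and f: "f \<in> borel_measurable (lebesgue_on S)"
  shows "\<exists>g\<in>borel_measurable borel. AE x in lborel. x \<in> S \<longrightarrow> f x = g x"
proof -
  have "(\<lambda>x. if x \<in> S then f x else 0) \<in> borel_measurable lebesgue"
    by (rule borel_measurable_if[OF S, THEN iffD2, OF f])
  then obtain g where "g \<in> borel_measurable lborel" "AE x in lborel. (if x \<in> S then f x else 0) = g x"
    using completion_ex_borel_measurable_real by blast
  then show ?thesis by (intro bexI[of _ g]) (auto elim!: eventually_mono)
qed

text \<open>Wrapping a Borel version into the base cell and clamping it makes periodicity and the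
  bound hold at every point, at the price of changes on a null set of the cell.\<close>

lemma torus_bounded_borel_version:
  fixes f :: "real^'n \<Rightarrow> real"
  assumes "Linf_on torus_cell f" "Linf_norm torus_cell f \<le> ereal C"
  shows "\<exists>g\<in>borel_measurable borel. torus_periodic g \<and> (\<forall>x. \<bar>g x\<bar> \<le> \<bar>C\<bar>) \<and> (AE x in lebesgue_on torus_cell. f x = g x)"
proof -
  have fm: "f \<in> borel_measurable (lebesgue_on torus_cell)" using assms by (simp add: Linf_on_def)
  have "AE x in lebesgue_on torus_cell. ereal \<bar>f x\<bar> \<le> esssup (lebesgue_on torus_cell) (\<lambda>x. ereal \<bar>f x\<bar>)"
    by (rule esssup_AE)
  then have bd: "AE x in lborel. x \<in> torus_cell \<longrightarrow> \<bar>f x\<bar> \<le> \<bar>C\<bar>"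
    unfolding AE_lebesgue_on_iff[OF sets_lebesgue_torus_cell]
  proof eventually_elim
    case (elim x)
    show ?case
    proof
      assume "x \<in> torus_cell"
      with elim have "ereal \<bar>f x\<bar> \<le> esssup (lebesgue_on torus_cell) (\<lambda>x. ereal \<bar>f x\<bar>)" by simp
      also have "\<dots> \<le> ereal C" using assms(2) unfolding Linf_norm_def .
      finally show "\<bar>f x\<bar> \<le> \<bar>C\<bar>" by simp
    qed
  qed
  obtain h where [measurable]: "h \<in> borel_measurable borel" and h: "AE x in lborel. x \<in> torus_cell \<longrightarrow> f x = h x"
    using lebesgue_on_borel_version[OF sets_lebesgue_torus_cell fm] by blast
  define g where "g x = max (- \<bar>C\<bar>) (min \<bar>C\<bar> (h (torus_wrap x)))" for x
  have "g \<in> borel_measurable borel" unfolding g_def by measurable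
  moreover have "torus_periodic g"
    unfolding g_def by (rule torus_periodic_wrap[of "\<lambda>y. max (- \<bar>C\<bar>) (min \<bar>C\<bar> (h y))"])
  moreover have "\<forall>x. \<bar>g x\<bar> \<le> \<bar>C\<bar>" by (auto simp: g_def)
  moreover have "AE x in lebesgue_on torus_cell. f x = g x"
    unfolding AE_lebesgue_on_iff[OF sets_lebesgue_torus_cell]
    using h bd AE_torus_cell_index[unfolded AE_completion_iff]
    by eventually_elim (auto simp: g_def torus_wrap_eq)
  ultimately show ?thesis by blast
qed

text \<open>The null set in space-time has null slices for almost every time only, so agreement is
  claimed for almost every \<open>s\<close>. No bound on \<open>F\<close> is recorded, since it
  enters later only through its sine.\<close>

lemma torus_spacetime_borel_version:
  fixes v :: "real \<Rightarrow> real^'n \<Rightarrow> real"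
  assumes "Linf_on ({0<..<T} \<times> torus_cell) (\<lambda>(t, x). v t x)"
  shows "\<exists>F. joint_borel F \<and> (\<forall>s. torus_periodic (F s)) \<and>
    (AE s in lborel. s \<in> {0<..<T} \<longrightarrow> (AE y in lebesgue_on torus_cell. v s y = F s y))"
proof -
  have "{0<..<T} \<times> (torus_cell :: (real^'n) set) \<in> sets borel"
    unfolding torus_cell_def by (intro borel_Times borel_open borel_closed) auto
  then have S: "{0<..<T} \<times> (torus_cell :: (real^'n) set) \<in> sets lebesgue" by simp
  obtain h where h_meas: "h \<in> borel_measurable borel"
    and h: "AE q in lborel. q \<in> {0<..<T} \<times> (torus_cell :: (real^'n) set) \<longrightarrow> (\<lambda>(t, x). v t x) q = h q"
    using lebesgue_on_borel_version[OF S] assms unfolding Linf_on_def by blast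
  have [measurable]: "h \<in> borel_measurable (borel \<Otimes>\<^sub>M borel)" using h_meas by (simp add: borel_prod)
  define F where "F s y = h (s, torus_wrap y)" for s y
  have "AE s in lborel. AE y in lborel. (s, y) \<in> {0<..<T} \<times> (torus_cell :: (real^'n) set) \<longrightarrow> (\<lambda>(t, x). v t x) (s, y) = h (s, y)"
    using h unfolding lborel_prod[symmetric] by (rule lborel_pair.AE_pair)
  then have "AE s in lborel. s \<in> {0<..<T} \<longrightarrow> (AE y in lebesgue_on torus_cell. v s y = F s y)"
    unfolding AE_lebesgue_on_iff[OF sets_lebesgue_torus_cell]
  proof eventually_elim
    case (elim s)
    show ?case
    proof
      assume "s \<in> {0<..<T}"
      show "AE y in lborel. y \<in> torus_cell \<longrightarrow> v s y = F s y"
        using elim AE_torus_cell_index[unfolded AE_completion_iff]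
        by eventually_elim (use \<open>s \<in> {0<..<T}\<close> in \<open>auto simp: F_def torus_wrap_eq\<close>)
    qed
  qed
  moreover have "torus_periodic (F s)" for s
    unfolding F_def by (rule torus_periodic_wrap)
  moreover have "joint_borel F" unfolding F_def by measurable
  ultimately show ?thesis by blast
qed

lemma Linf_norm_le:
  fixes f :: "'a::euclidean_space \<Rightarrow> real"
  assumes f: "f \<in> borel_measurable borel" and C: "\<And>x. x \<in> S \<Longrightarrow> \<bar>f x\<bar> \<le> C"
  shows "Linf_norm S f \<le> ereal C" "Linf_on S f"
proof -
  have fm: "f \<in> borel_measurable (lebesgue_on S)"
    using f by (intro measurable_restrict_space1 measurable_completion) simp
  show 1: "Linf_norm S f \<le> ereal C"
    unfolding Linf_norm_def
  proof (rule esssup_I)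
    show "(\<lambda>x. ereal \<bar>f x\<bar>) \<in> borel_measurable (lebesgue_on S)" using fm by measurable
    show "AE x in lebesgue_on S. ereal \<bar>f x\<bar> \<le> ereal C"
      using C by (intro AE_I2) (simp add: space_restrict_space)
  qed
  then show "Linf_on S f" using fm by (auto simp: Linf_on_def intro: le_less_trans)
qed

section \<open>From the torus formula to whole-space convolutions, and the uniqueness
  estimate\<close>

lemma heat_semigroup_eq_heat:
  fixes g :: "real^'n \<Rightarrow> real"
  assumes "\<kappa> > 0" "t > 0" "g \<in> borel_measurable borel" "\<And>y. \<bar>g y\<bar> \<le> C"
    and "torus_periodic g" "AE y in lebesgue_on torus_cell. f y = g y"
  shows "heat_semigroup (\<kappa>\<^sup>2 * t) f x = heat \<kappa> t g x"
  using heat_semigroup_eq_gauss_conv[of "\<kappa>\<^sup>2 * t" g C f x] assms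
  by (simp add: heat_def real_sqrt_mult)

lemma torus_duhamel_eq_duhamel:
  fixes F :: "real \<Rightarrow> real^'n \<Rightarrow> real"
  assumes \<kappa>: "\<kappa> > 0" and F_meas [measurable]: "joint_borel F"
    and per: "\<And>s. s \<in> {0<..<t} \<Longrightarrow> torus_periodic (F s)"
    and ae: "AE s in lborel. s \<in> {0<..<t} \<longrightarrow> (AE y in lebesgue_on torus_cell. v s y = F s y)"
  shows "(LINT s:{0..t}|lebesgue. heat_semigroup (\<kappa>\<^sup>2 * (t - s)) (\<lambda>y. sin (v s y)) x)
    = sine_duhamel \<kappa> F t x"
  unfolding duhamel_def set_lebesgue_integral_def
proof (rule integral_lebesgue_AE_borel)
  show "(\<lambda>s. indicator {0..t} s *\<^sub>R (1 * heat \<kappa> (t - s) (\<lambda>y. sin (F s y)) x)) \<in> borel_measurable borel"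
    by measurable
  \<comment> \<open>Both endpoints are discarded: the hypotheses on \<open>F\<close> concern the
    open interval, and at \<open>s = t\<close> the semigroup returns the value of \<open>v\<close>
    at the single point \<open>x\<close>, which almost-everywhere information does not
    control.\<close>
  have "AE s in lborel. indicator {0..t} s *\<^sub>R heat_semigroup (\<kappa>\<^sup>2 * (t - s)) (\<lambda>y. sin (v s y)) x
      = indicator {0..t} s *\<^sub>R (1 * heat \<kappa> (t - s) (\<lambda>y. sin (F s y)) x)"
    using ae AE_lborel_singleton[of 0] AE_lborel_singleton[of t]
  proof eventually_elim
    case (elim s)
    show ?case
    proof (cases "s \<in> {0..t}")
      case True
      then have s: "s \<in> {0<..<t}" using elim by auto
      have "heat_semigroup (\<kappa>\<^sup>2 * (t - s)) (\<lambda>y. sin (v s y)) x = heat \<kappa> (t - s) (\<lambda>y. sin (F s y)) x"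
      proof (rule heat_semigroup_eq_heat[OF \<kappa>])
        show "torus_periodic (\<lambda>y. sin (F s y))" using per[OF s] by (simp add: torus_periodic_def)
        show "AE y in lebesgue_on torus_cell. sin (v s y) = sin (F s y)"
          using elim(1) s by (auto elim: eventually_mono)
        show "\<bar>sin (F s y)\<bar> \<le> 1" for y by simp
      qed (use s in auto)
      then show ?thesis by simp
    qed simp
  qed
  then show "AE s in lebesgue. indicator {0..t} s *\<^sub>R heat_semigroup (\<kappa>\<^sup>2 * (t - s)) (\<lambda>y. sin (v s y)) x
      = indicator {0..t} s *\<^sub>R (1 * heat \<kappa> (t - s) (\<lambda>y. sin (F s y)) x)"
    by (rule AE_completion)
qed

text \<open>Clipping \<open>g\<close> at the essential bound changes it only on a null set of the cell, which the periodic
  heat semigroup does not see.\<close>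

lemma heat_periodic_AE_bound:
  fixes g :: "real^'n \<Rightarrow> real"
  assumes \<kappa>: "\<kappa> > 0" and t: "t > 0" and [measurable]: "g \<in> borel_measurable borel" and gC: "\<And>y. \<bar>g y\<bar> \<le> C"
    and per: "torus_periodic g" and b: "0 \<le> b" and ae: "AE y in lebesgue_on torus_cell. \<bar>g y\<bar> \<le> b"
  shows "\<bar>heat \<kappa> t g x\<bar> \<le> b"
proof -
  define h where "h y = max (- b) (min b (g y))" for y
  have hb: "\<bar>h y\<bar> \<le> b" for y using b by (auto simp: h_def)
  have "heat \<kappa> t g x = heat_semigroup (\<kappa>\<^sup>2 * t) g x"
    by (rule heat_semigroup_eq_heat[symmetric, OF \<kappa> t _ gC per]) auto
  also have "\<dots> = heat \<kappa> t h x"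
  proof (rule heat_semigroup_eq_heat[OF \<kappa> t _ hb])
    show "h \<in> borel_measurable borel" unfolding h_def by measurable
    show "torus_periodic h" using per by (simp add: h_def torus_periodic_def)
    show "AE y in lebesgue_on torus_cell. g y = h y"
      using ae by eventually_elim (auto simp: h_def)
  qed
  finally show ?thesis using heat_bound[of h, OF hb] by simp
qed

text \<open>One round of the Gronwall iteration. The hypothesis on the sines is almost everywhere in
  time and space, the conclusion holds at every \<open>x\<close>: the heat flow turns the essential
  bound into a pointwise one, and the time integral raises the power.\<close>

lemma duhamel_periodic_diff_bound:
  fixes F U :: "real \<Rightarrow> real^'n \<Rightarrow> real"
  assumes \<kappa>: "\<kappa> > 0" and F_meas [measurable]: "joint_borel F"
    and U_meas [measurable]: "joint_borel U"
    and per: "\<And>s. 0 < s \<Longrightarrow> torus_periodic (F s)" "\<And>s. 0 < s \<Longrightarrow> torus_periodic (U s)"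
    and ae: "AE s in lborel. s \<in> {0<..<t} \<longrightarrow> (AE y in lebesgue_on torus_cell. \<bar>sin (F s y) - sin (U s y)\<bar> \<le> 2 * s ^ n / fact n)"
    and t: "0 \<le> t"
  shows "\<bar>sine_duhamel \<kappa> F t x - sine_duhamel \<kappa> U t x\<bar> \<le> 2 * t ^ Suc n / fact (Suc n)"
proof -
  let ?F = "\<lambda>s. heat \<kappa> (t - s) (\<lambda>y. sin (F s y)) x" and ?U = "\<lambda>s. heat \<kappa> (t - s) (\<lambda>y. sin (U s y)) x"
  have ints: "set_integrable lborel {0..t} ?F" "set_integrable lborel {0..t} ?U"
    by (rule set_integrable_Icc_bounded[where C = 1]; auto intro!: heat_bound)+
  have "sine_duhamel \<kappa> F t x - sine_duhamel \<kappa> U t x = (LINT s:{0..t}|lborel. ?F s - ?U s)"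
    unfolding duhamel_def using set_integral_diff(2)[OF ints] by simp
  also have "norm \<dots> \<le> (LINT s:{0..t}|lborel. 2 / fact n * s ^ n)"
  proof (rule set_integral_norm_bound_AE)
    show "set_integrable lborel {0..t} (\<lambda>s. 2 / fact n * s ^ n)"
    proof (rule set_integrable_Icc_bounded[where C = "2 / fact n * t ^ n"])
      fix s assume s: "s \<in> {0..t}"
      then have "2 / fact n * s ^ n \<le> 2 / fact n * t ^ n" by (intro mult_left_mono power_mono) auto
      moreover have "0 \<le> 2 / fact n * s ^ n" using s by simp
      ultimately show "norm (2 / fact n * s ^ n) \<le> 2 / fact n * t ^ n" by simp
    qed measurable
    show "AE s in lborel. s \<in> {0..t} \<longrightarrow> norm (?F s - ?U s) \<le> 2 / fact n * s ^ n"
      using ae AE_lborel_singleton[of 0] AE_lborel_singleton[of t]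
    proof eventually_elim
      case (elim s)
      show ?case
      proof
        assume "s \<in> {0..t}"
        then have s: "s \<in> {0<..<t}" using elim by auto
        have "heat \<kappa> (t - s) (\<lambda>y. sin (F s y) - sin (U s y)) x = ?F s - ?U s"
          unfolding heat_def by (rule gauss_conv_diff[where C = 1 and D = 1]) auto
        moreover have "\<bar>heat \<kappa> (t - s) (\<lambda>y. sin (F s y) - sin (U s y)) x\<bar> \<le> 2 / fact n * s ^ n"
        proof (rule heat_periodic_AE_bound[where C = 2])
          show "torus_periodic (\<lambda>y. sin (F s y) - sin (U s y))"
            using per s by (simp add: torus_periodic_def)
          show "\<bar>sin (F s y) - sin (U s y)\<bar> \<le> 2" for y
            using abs_sin_le_one[of "F s y"] abs_sin_le_one[of "U s y"] by linarith
          show "AE y in lebesgue_on torus_cell. \<bar>sin (F s y) - sin (U s y)\<bar> \<le> 2 / fact n * s ^ n"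
            using elim(1) s by simp
        qed (use \<kappa> s in auto)
        ultimately show "norm (?F s - ?U s) \<le> 2 / fact n * s ^ n" by simp
      qed
    qed
  qed
  also have "\<dots> = 2 * t ^ Suc n / fact (Suc n)"
    unfolding set_integral_mult_right set_integral_power[OF t] by (simp add: field_simps)
  finally show ?thesis by simp
qed

lemma power_over_fact_tendsto_0: "(\<lambda>n. 2 * t ^ Suc n / fact (Suc n)) \<longlonglongrightarrow> (0 :: real)"
proof -
  have "summable (\<lambda>n. t ^ n / fact n)"
    using summable_exp[of t] by (simp add: divide_inverse mult.commute)
  then have "(\<lambda>n. t ^ Suc n / fact (Suc n)) \<longlonglongrightarrow> 0" by (intro LIMSEQ_Suc summable_LIMSEQ_zero)
  then have "(\<lambda>n. 2 * (t ^ Suc n / fact (Suc n))) \<longlonglongrightarrow> 2 * 0" by (rule tendsto_mult_left)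
  then show ?thesis by simp
qed

theorem theorem2p1:
  fixes \<kappa> :: real and u0 :: "real ^ 'n \<Rightarrow> real"
  assumes "\<kappa> > 0"
    and "torus_periodic u0"
    and "Linf_on torus_cell u0"
    and "Linf_norm torus_cell u0 \<le> ereal pi"
  shows "\<exists>u. mild_solution \<kappa> u0 u
           \<and> (\<forall>v. mild_solution \<kappa> u0 v \<longrightarrow>
                (\<forall>t\<ge>0. AE x in lebesgue_on torus_cell. v t x = u t x))
           \<and> smooth_on ({0<..} \<times> UNIV) (\<lambda>(t, x). u t x)
           \<and> (SUP t\<in>{0..}. Linf_norm torus_cell (u t)) \<le> ereal pi"
proof -
  \<comment> \<open>The solution is built from \<open>f\<close>, bounded by \<pi> everywhere, so
    that its bound and its Duhamel formula hold at every point; \<open>u0\<close> returns only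
    through \<open>heat_u0\<close>.\<close>
  obtain f where f_meas: "f \<in> borel_measurable borel" and f_per: "torus_periodic f"
    and f_bound: "\<And>x. \<bar>f x\<bar> \<le> pi" and f_ae: "AE x in lebesgue_on torus_cell. u0 x = f x"
    using torus_bounded_borel_version[OF assms(3,4)] by auto
  have \<kappa>0: "\<kappa> \<ge> 0" using assms(1) by simp
  note f = \<kappa>0 f_meas f_bound
  define u where "u = damped_limit \<kappa> f"
  have u_meas: "joint_borel u"
    unfolding u_def by (rule damped_limit_measurable[OF f])
  note [measurable] = u_meas
  have u_bound: "\<bar>u t x\<bar> \<le> pi" if "0 \<le> t" for t x
    unfolding u_def by (rule damped_limit_bound[OF f that])
  have u_eq: "u t x = heat \<kappa> t f x + sine_duhamel \<kappa> u t x" if "0 \<le> t" for t x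
    unfolding u_def by (rule damped_limit_duhamel[OF f that])
  have u_per: "torus_periodic (u t)" if "0 \<le> t" for t
    using damped_limit_periodic[OF f _ that] f_per unfolding u_def torus_periodic_def by blast
  have heat_u0: "AE x in lebesgue_on torus_cell. heat_semigroup (\<kappa>\<^sup>2 * t) u0 x = heat \<kappa> t f x" if "0 \<le> t" for t
  proof (cases "t = 0")
    case True
    then show ?thesis using f_ae by (simp add: heat_semigroup_def)
  next
    case False
    then show ?thesis
      using heat_semigroup_eq_heat[OF assms(1) _ f_meas f_bound f_per f_ae] that by simp
  qed
  have "mild_solution \<kappa> u0 u"
    unfolding mild_solution_def
  proof (intro conjI allI impI)
    show "torus_periodic (u t)" if "0 \<le> t" for t by (rule u_per[OF that])
    show "Linf_on ({0<..<T} \<times> torus_cell) (\<lambda>(t, x). u t x)" if "0 < T" for T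
      by (rule Linf_norm_le(2)[where C = pi]) (use u_meas u_bound in \<open>auto simp: borel_prod\<close>)
    fix t :: real assume t: "0 \<le> t"
    show "AE x in lebesgue_on torus_cell. u t x = heat_semigroup (\<kappa>\<^sup>2 * t) u0 x
        + (LINT s:{0..t}|lebesgue. heat_semigroup (\<kappa>\<^sup>2 * (t - s)) (\<lambda>y. sin (u s y)) x)"
    proof -
      have D: "(LINT s:{0..t}|lebesgue. heat_semigroup (\<kappa>\<^sup>2 * (t - s)) (\<lambda>y. sin (u s y)) x)
          = sine_duhamel \<kappa> u t x" for x
        by (rule torus_duhamel_eq_duhamel[OF assms(1) u_meas]) (auto intro: u_per)
      show ?thesis using heat_u0[OF t] by eventually_elim (simp add: u_eq[OF t] D)
    qed
  qed
  moreover have "AE x in lebesgue_on torus_cell. v t x = u t x" if v: "mild_solution \<kappa> u0 v" and t: "0 \<le> t" for v t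
  proof -
    \<comment> \<open>The extra unit keeps \<open>T\<close> positive when \<open>t = 0\<close> and
      places \<open>t\<close> itself below \<open>T\<close>.\<close>
    define T where "T = t + 1"
    have "Linf_on ({0<..<T} \<times> torus_cell) (\<lambda>(t, x). v t x)"
      using v t unfolding mild_solution_def T_def by simp
    then obtain F where F_meas [measurable]: "joint_borel F"
      and F_per: "\<And>s. torus_periodic (F s)"
      and F_ae: "AE s in lborel. s \<in> {0<..<T} \<longrightarrow> (AE y in lebesgue_on torus_cell. v s y = F s y)"
      using torus_spacetime_borel_version by blast
    \<comment> \<open>\<open>Y\<close> is the right side of the Duhamel formula evaluated with the
      representative \<open>F\<close>. It agrees with \<open>v s\<close> at every time below
      \<open>T\<close>, because the mild formula is required at every time, whereas \<open>F\<close>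
      matches \<open>v\<close> for almost every time only.\<close>
    define Y where "Y s x = heat \<kappa> s f x + sine_duhamel \<kappa> F s x" for s x
    have v_Y: "AE x in lebesgue_on torus_cell. v s x = Y s x" if s: "0 \<le> s" "s < T" for s
    proof -
      have "AE r in lborel. r \<in> {0<..<s} \<longrightarrow> (AE y in lebesgue_on torus_cell. v r y = F r y)"
        using F_ae by eventually_elim (use s in auto)
      note D = torus_duhamel_eq_duhamel[OF assms(1) F_meas F_per this]
      have "AE x in lebesgue_on torus_cell. v s x = heat_semigroup (\<kappa>\<^sup>2 * s) u0 x
        + (LINT r:{0..s}|lebesgue. heat_semigroup (\<kappa>\<^sup>2 * (s - r)) (\<lambda>y. sin (v r y)) x)"
        using v s(1) unfolding mild_solution_def by blast
      then show ?thesis using heat_u0[OF s(1)]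
        by eventually_elim (simp add: Y_def D)
    qed
    have Y_u: "\<bar>Y s x - u s x\<bar> \<le> 2 * s ^ Suc n / fact (Suc n)"
      if "AE r in lborel. r \<in> {0<..<T} \<longrightarrow> (AE y in lebesgue_on torus_cell. \<bar>sin (F r y) - sin (u r y)\<bar> \<le> 2 * r ^ n / fact n)"
        and s: "0 \<le> s" "s < T" for n s x
    proof -
      have "AE r in lborel. r \<in> {0<..<s} \<longrightarrow> (AE y in lebesgue_on torus_cell. \<bar>sin (F r y) - sin (u r y)\<bar> \<le> 2 * r ^ n / fact n)"
        using that(1) by eventually_elim (use s in auto)
      from duhamel_periodic_diff_bound[OF assms(1) F_meas u_meas F_per u_per this s(1), of x]
      show ?thesis using u_eq[OF s(1), of x] by (simp add: Y_def)
    qed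
    \<comment> \<open>The induction starts from the trivial bound 2 for a difference of sines, so
      the size of \<open>v\<close> never enters. Each round passes from \<open>F\<close> to
      \<open>v\<close> to \<open>Y\<close>, where \<open>Y_u\<close> improves the power.\<close>
    have sin_ae: "AE r in lborel. r \<in> {0<..<T} \<longrightarrow> (AE y in lebesgue_on torus_cell. \<bar>sin (F r y) - sin (u r y)\<bar> \<le> 2 * r ^ n / fact n)" for n
    proof (induction n)
      case 0
      have "\<bar>sin (F r y) - sin (u r y)\<bar> \<le> 2" for r y
        using abs_sin_le_one[of "F r y"] abs_sin_le_one[of "u r y"] by linarith
      then show ?case by simp
    next
      case (Suc n)
      show ?case using F_ae
      proof eventually_elim
        case (elim r)
        show ?case
        proof
          assume r: "r \<in> {0<..<T}"
          have "AE y in lebesgue_on torus_cell. v r y = F r y" using elim r by blast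
          moreover have "AE y in lebesgue_on torus_cell. v r y = Y r y" using v_Y r by simp
          ultimately show "AE y in lebesgue_on torus_cell. \<bar>sin (F r y) - sin (u r y)\<bar> \<le> 2 * r ^ Suc n / fact (Suc n)"
          proof eventually_elim
            case (elim y)
            have "\<bar>sin (Y r y) - sin (u r y)\<bar> \<le> \<bar>Y r y - u r y\<bar>" by (rule abs_sin_diff_le)
            also have "\<dots> \<le> 2 * r ^ Suc n / fact (Suc n)" using r by (intro Y_u[OF Suc]) auto
            finally show ?case using elim by simp
          qed
        qed
      qed
    qed
    have "Y t x = u t x" for x
    proof -
      have "\<bar>Y t x - u t x\<bar> \<le> 0"
      proof (rule LIMSEQ_le_const[OF power_over_fact_tendsto_0])
        show "\<exists>N. \<forall>n\<ge>N. \<bar>Y t x - u t x\<bar> \<le> 2 * t ^ Suc n / fact (Suc n)"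
          using Y_u[OF sin_ae t] by (auto simp: T_def)
      qed
      then show ?thesis by simp
    qed
    then show ?thesis using v_Y[OF t] by (simp add: T_def)
  qed
  moreover have "smooth_on ({0<..} \<times> UNIV) (\<lambda>(t, x). u t x)"
    unfolding smooth_on_def
  proof (intro allI Ck_on_local)
    fix k and q :: "real \<times> (real^'n)" assume "q \<in> {0<..} \<times> UNIV"
    then obtain t x where q: "q = (t, x)" "t > 0" by auto
    \<comment> \<open>Early times are reached directly from \<tau> = 0, later ones by restarting one
      \<open>shift_time\<close> before \<open>t\<close>. The same length serves for every restart
      because \<open>u \<tau>\<close> always obeys the bound \<pi>.\<close>
    define t0 where "t0 = min t (shift_time TYPE('n))"
    define \<tau> where "\<tau> = t - t0"
    have t0: "0 < t0" "t0 \<le> shift_time TYPE('n)" and \<tau>: "0 \<le> \<tau>"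
      using q(2) shift_time_bounds(1)[where 'n='n] by (auto simp: t0_def \<tau>_def)
    have ut_meas: "u \<tau> \<in> borel_measurable borel" by measurable
    have "(\<lambda>q. case_prod u (\<tau> + fst q, snd q)) \<in> borel_measurable (borel \<Otimes>\<^sub>M borel)" by measurable
    then have v_meas: "joint_borel (\<lambda>s. u (\<tau> + s))"
      by (simp add: case_prod_beta')
    have "\<exists>V. open V \<and> (\<tau> + t0, x) \<in> V \<and> (\<forall>k. Ck_on k V (\<lambda>(t, x). u (\<tau> + (t - \<tau>)) x))"
    proof (rule duhamel_solution_smooth_near[OF assms(1) ut_meas u_bound[OF \<tau>] v_meas _ _ t0])
      show "\<bar>u (\<tau> + s) y\<bar> \<le> pi" if "0 \<le> s" for s y
        using \<tau> that by (intro u_bound) simp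
      show "u (\<tau> + s) y = heat \<kappa> s (u \<tau>) y + sine_duhamel \<kappa> (\<lambda>s. u (\<tau> + s)) s y"
        if "0 \<le> s" for s y
        by (rule heat_equation_sine_restart[OF \<kappa>0 f_meas f_bound u_meas u_eq \<tau> that])
    qed
    then obtain V where V: "open V" "(\<tau> + t0, x) \<in> V" "\<And>k. Ck_on k V (\<lambda>(t, x). u (\<tau> + (t - \<tau>)) x)"
      by blast
    have "q \<in> V" using V(2) q by (simp add: \<tau>_def)
    then show "\<exists>U g. open U \<and> q \<in> U \<and> (\<forall>y\<in>U. (\<lambda>(t, x). u t x) y = g y) \<and> Ck_on k U g"
      using V(1) V(3)[of k] by (intro exI[of _ V] exI[of _ "\<lambda>(t, x). u t x"]) simp
  qed
  moreover have "(SUP t\<in>{0..}. Linf_norm torus_cell (u t)) \<le> ereal pi"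
  proof (rule SUP_least)
    fix t :: real assume "t \<in> {0..}"
    then show "Linf_norm torus_cell (u t) \<le> ereal pi"
      by (intro Linf_norm_le(1)) (auto intro: u_bound)
  qed
  ultimately show ?thesis by blast
qed

end
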